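(* Let $\Omega^\bullet_d$ be an exterior algebra over the $\Bbbk$-algebra $A$ and let $n\ge2$. Then: (1) $\mathcal S^{n-1,1}_d\circ\overline{\mathcal S}^{\{n,0\}}_d=-D^{II}_{J^{n-2}_d}\circ J^1_d(l^{n-1}_d)\circ l^{\{n\}}_d$ as natural transformations $J^{\{n\}}_d\to\Omega^2_dJ^{n-2}_d$; (2) $\ker\big(\mathcal S^{n-1,1}_d\circ\overline{\mathcal S}^{\{n,0\}}_d\big)=J^n_d$; (3) $\ker\big(\mathcal S^{\{n-1,1\}}_d\circ\mathcal S^{\{n,0\}}_d\big)\supseteq J^n_d$, and equality holds if $\Omega^2_d$ is flat as a right $A$-module. Here $J^n_d$ is regarded as a subfunctor of $J^{\{n\}}_d$ via the natural inclusion $t^{\{n\}}_d$.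
   Context: **Setting.** $\Bbbk$ is a commutative unital ring, $A$ an associative unital $\Bbbk$-algebra, $\otimes=\otimes_\Bbbk$. An exterior algebra $(\Omega^\bullet_d,\wedge,d)$ over $A$ is a differential graded $\Bbbk$-algebra with $\Omega^0_d=A$, generated by $A$ and $dA$ (each $\Omega^k_d$ is spanned by elements $a_0da_1\wedge\dots\wedge da_k$), $d$ satisfying the graded Leibniz rule. $\Omega^k_d$ also denotes the functor $E\mapsto\Omega^k_dE=\Omega^k_d\otimes_AE$ on left $A$-modules. All maps below are natural in the left $A$-module $E$; natural transformations are of functors to $\Bbbk$-modules, and kernels are taken componentwise. **1-jets.** $J^1_dE=(A\otimes E)/\{\sum_ia_i\otimes e_i:\sum_ia_ie_i=0,\ \sum_ida_i\otimes_Ae_i=0\}$, with $a[b\otimes e]=[ab\otimes e]$, functorial in $E$. **Holonomic and sesquiholonomic jets.** Let $D^I_E\colon J^1_dJ^1_dE\to\Omega^1_dE$, $[a\otimes[c\otimes e]]\mapsto a\,dc\otimes_Ae$ (left $A$-linear), and $D^{II}_E\colon J^1_dJ^1_dE\to\Omega^2_dE$, $[a\otimes[c\otimes e]]\mapsto da\wedge dc\otimes_Ae$ ($\Bbbk$-linear). Put $J^0_dE=E$, $l^1_d=\mathrm{id}_{J^1_d}$. For $n\ge2$, the holonomic jet functor $J^n_d$, with inclusion $l^n_d\colon J^n_d\hookrightarrow J^1_dJ^{n-1}_d$, is the subfunctor of those $x\in J^1_dJ^{n-1}_dE$ such that both $D^I_{J^{n-2}_dE}$ and $D^{II}_{J^{n-2}_dE}$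 vanish on $J^1_d(l^{n-1}_{d,E})(x)$. The sesquiholonomic jet functor $J^{\{n\}}_d$, with inclusion $l^{\{n\}}_d\colon J^{\{n\}}_d\hookrightarrow J^1_dJ^{n-1}_d$, is the kernel of $D^I_{J^{n-2}_d}\circ J^1_d(l^{n-1}_d)$ for $n\ge2$; $J^{\{0\}}_d=\mathrm{id}$, $J^{\{1\}}_d=J^1_d$, $l^{\{1\}}_d=\mathrm{id}$. The inclusion $t^{\{n\}}_d\colon J^n_d\hookrightarrow J^{\{n\}}_d$ is determined by $l^{\{n\}}_d\circ t^{\{n\}}_d=l^n_d$ ($t^{\{0\}}_d$, $t^{\{1\}}_d$ identities). **Spencer operators.** $\mathcal S^{1,m}_{d,E}\colon\Omega^m_dJ^1_dE\to\Omega^{m+1}_dE$, $\omega\otimes_A[a\otimes e]\mapsto d(\omega a)\otimes_Ae$. For $n\ge1$, $m\ge0$: - $\mathcal S^{n,m}_d=\mathcal S^{1,m}_{d,J^{n-1}_d}\circ\Omega^m_d(l^n_d)\colon\Omega^m_dJ^n_d\to\Omega^{m+1}_dJ^{n-1}_d$; - $\overline{\mathcal S}^{\{n,m\}}_d=\mathcal S^{1,m}_{d,J^{n-1}_d}\circ\Omega^m_d(l^{\{n\}}_d)\colon\Omega^m_dJ^{\{n\}}_d\to\Omega^{m+1}_dJ^{n-1}_d$; - $\mathcal S^{\{n,m\}}_d=\mathcal S^{1,m}_{d,J^{\{n-1\}}_d}\circ\Omega^m_d\big(J^1_d(t^{\{n-1\}}_d)\circ l^{\{n\}}_d\big)\colon\Omega^m_dJ^{\{n\}}_d\to\Omega^{m+1}_dJ^{\{n-1\}}_d$.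 *)

theory Defs
  imports "HOL-Algebra.Module" "HOL-Algebra.AbelCoset" "HOL-Algebra.Generated_Groups"
begin

section \<open>Algebras, modules and exterior algebras\<close>

text \<open>
  A module over a ring is encoded by the record type \<open>('a, 'b) module\<close> of HOL-Algebra, whose
  fields \<open>mult\<close> and \<open>one\<close> carry no information for modules.  The library locale \<open>module\<close> is
  confined to commutative base rings, so left modules and algebras over a commutative ring that
  need not be commutative themselves are introduced here.
\<close>

locale left_module = A?: ring A + E?: abelian_group E
  for A :: "('a, 'i) ring_scheme" (structure) and E :: "('a, 'b, 'j) module_scheme" (structure) +
  assumes lsmult_closed:
      "\<lbrakk>a \<in> carrier A; x \<in> carrier E\<rbrakk> \<Longrightarrow> a \<odot>\<^bsub>E\<^esub> x \<in> carrier E"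
    and lsmult_l_distr:
      "\<lbrakk>a \<in> carrier A; b \<in> carrier A; x \<in> carrier E\<rbrakk> \<Longrightarrow>
        (a \<oplus>\<^bsub>A\<^esub> b) \<odot>\<^bsub>E\<^esub> x = a \<odot>\<^bsub>E\<^esub> x \<oplus>\<^bsub>E\<^esub> b \<odot>\<^bsub>E\<^esub> x"
    and lsmult_r_distr:
      "\<lbrakk>a \<in> carrier A; x \<in> carrier E; y \<in> carrier E\<rbrakk> \<Longrightarrow>
        a \<odot>\<^bsub>E\<^esub> (x \<oplus>\<^bsub>E\<^esub> y) = a \<odot>\<^bsub>E\<^esub> x \<oplus>\<^bsub>E\<^esub> a \<odot>\<^bsub>E\<^esub> y"
    and lsmult_assoc:
      "\<lbrakk>a \<in> carrier A; b \<in> carrier A; x \<in> carrier E\<rbrakk> \<Longrightarrow>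
        (a \<otimes>\<^bsub>A\<^esub> b) \<odot>\<^bsub>E\<^esub> x = a \<odot>\<^bsub>E\<^esub> (b \<odot>\<^bsub>E\<^esub> x)"
    and lsmult_one: "x \<in> carrier E \<Longrightarrow> \<one>\<^bsub>A\<^esub> \<odot>\<^bsub>E\<^esub> x = x"

definition mod_hom ::
  "('a, 'i) ring_scheme \<Rightarrow> ('a, 'b, 'j) module_scheme \<Rightarrow> ('a, 'c, 'l) module_scheme \<Rightarrow> ('b \<Rightarrow> 'c) set"
  where "mod_hom R M N = {f. f \<in> carrier M \<rightarrow> carrier N \<and>
    (\<forall>x\<in>carrier M. \<forall>y\<in>carrier M. f (x \<oplus>\<^bsub>M\<^esub> y) = f x \<oplus>\<^bsub>N\<^esub> f y) \<and>
    (\<forall>r\<in>carrier R. \<forall>x\<in>carrier M. f (r \<odot>\<^bsub>M\<^esub> x) = r \<odot>\<^bsub>N\<^esub> f x)}"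

locale assoc_algebra = module K A + ring A
  for K :: "('k, 'i) ring_scheme" and A :: "('k, 'a, 'j) module_scheme" +
  assumes smult_mult_left:
      "\<lbrakk>k \<in> carrier K; x \<in> carrier A; y \<in> carrier A\<rbrakk> \<Longrightarrow>
        (k \<odot>\<^bsub>A\<^esub> x) \<otimes>\<^bsub>A\<^esub> y = k \<odot>\<^bsub>A\<^esub> (x \<otimes>\<^bsub>A\<^esub> y)"
    and smult_mult_right:
      "\<lbrakk>k \<in> carrier K; x \<in> carrier A; y \<in> carrier A\<rbrakk> \<Longrightarrow>
        x \<otimes>\<^bsub>A\<^esub> (k \<odot>\<^bsub>A\<^esub> y) = k \<odot>\<^bsub>A\<^esub> (x \<otimes>\<^bsub>A\<^esub> y)"

text \<open>
  The record holds the total algebra; \<open>mult\<close> is the wedge product, \<open>grade \<Omega> m\<close> is the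
  homogeneous part of degree \<open>m\<close>.
\<close>

record ('k, 'w) dga = "('k, 'w) module" +
  grade :: "nat \<Rightarrow> 'w set"
  diff :: "'w \<Rightarrow> 'w"

definition deg :: "('k, 'w) dga \<Rightarrow> nat \<Rightarrow> ('k, 'w) module"
  where "deg \<Omega> m = \<lparr>carrier = grade \<Omega> m, mult = mult \<Omega>, one = one \<Omega>,
    zero = zero \<Omega>, add = add \<Omega>, smult = smult \<Omega>\<rparr>"

locale dg_algebra = assoc_algebra K \<Omega>
  for K :: "('k, 'i) ring_scheme" and \<Omega> :: "('k, 'w) dga" (structure) +
  assumes grade_submodule: "submodule (grade \<Omega> m) K \<Omega>"
    and grade_span: "x \<in> carrier \<Omega> \<Longrightarrow>
      \<exists>N f. (\<forall>i. f i \<in> grade \<Omega> i) \<and> x = (\<Oplus>i\<in>{..N::nat}. f i)"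
    and grade_independent: "\<lbrakk>\<forall>i. f i \<in> grade \<Omega> i; (\<Oplus>i\<in>{..N::nat}. f i) = \<zero>; i \<le> N\<rbrakk> \<Longrightarrow> f i = \<zero>"
    and one_grade: "\<one> \<in> grade \<Omega> 0"
    and mult_grade: "\<lbrakk>x \<in> grade \<Omega> i; y \<in> grade \<Omega> j\<rbrakk> \<Longrightarrow> x \<otimes> y \<in> grade \<Omega> (i + j)"
    and diff_linear: "diff \<Omega> \<in> mod_hom K \<Omega> \<Omega>"
    and diff_grade: "x \<in> grade \<Omega> i \<Longrightarrow> diff \<Omega> x \<in> grade \<Omega> (i + 1)"
    and diff_diff: "x \<in> carrier \<Omega> \<Longrightarrow> diff \<Omega> (diff \<Omega> x) = \<zero>"
    and leibniz: "\<lbrakk>x \<in> grade \<Omega> i; y \<in> carrier \<Omega>\<rbrakk> \<Longrightarrow>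
      diff \<Omega> (x \<otimes> y) = diff \<Omega> x \<otimes> y \<oplus> (\<ominus> \<one>) [^] i \<otimes> (x \<otimes> diff \<Omega> y)"

text \<open>
  The set of products of the form \<open>a d b\<^sub>1 \<dots> d b\<^sub>m\<close> is closed under multiplication by scalars, so
  the additive subgroup it generates is its linear span.
\<close>

locale exterior_algebra = dg_algebra K \<Omega> + A: assoc_algebra K A
  for K :: "('k, 'i) ring_scheme" and A :: "('k, 'w) module" and \<Omega> :: "('k, 'w) dga" (structure) +
  assumes deg_0: "deg \<Omega> 0 = A"
    and generated: "grade \<Omega> m = generate (add_monoid \<Omega>)
      {a \<otimes> foldr (\<lambda>b w. diff \<Omega> b \<otimes> w) bs \<one> | a bs.
        a \<in> carrier A \<and> set bs \<subseteq> carrier A \<and> length bs = m}"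


section \<open>Tensor products\<close>

text \<open>
  \<open>M\<close> is a right module over \<open>R\<close> with action \<open>rho\<close>, and \<open>N\<close> a left module over \<open>R\<close> with action
  \<open>lam\<close>.  An element of the tensor product is an equivalence class of formal sums
  \<open>m\<^sub>1 \<otimes> n\<^sub>1 + \<dots> + m\<^sub>r \<otimes> n\<^sub>r\<close>, which are written as lists of pairs.  Formal sums form only a monoid,
  but \<open>(- m) \<otimes> n\<close> is an additive inverse of \<open>m \<otimes> n\<close> by \<open>add_left\<close> and \<open>zero_left\<close>.
\<close>

inductive tensor_eq for R :: "('r, 'i) ring_scheme"
  and M :: "('k, 'm, 'j) module_scheme" and rho :: "'m \<Rightarrow> 'r \<Rightarrow> 'm"
  and N :: "('s, 'n, 'l) module_scheme" and lam :: "'r \<Rightarrow> 'n \<Rightarrow> 'n"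
where
  refl: "set xs \<subseteq> carrier M \<times> carrier N \<Longrightarrow> tensor_eq R M rho N lam xs xs"
| sym: "tensor_eq R M rho N lam xs ys \<Longrightarrow> tensor_eq R M rho N lam ys xs"
| trans: "\<lbrakk>tensor_eq R M rho N lam xs ys; tensor_eq R M rho N lam ys zs\<rbrakk> \<Longrightarrow>
    tensor_eq R M rho N lam xs zs"
| append: "\<lbrakk>tensor_eq R M rho N lam xs ys; tensor_eq R M rho N lam us vs\<rbrakk> \<Longrightarrow>
    tensor_eq R M rho N lam (xs @ us) (ys @ vs)"
| commute: "\<lbrakk>set xs \<subseteq> carrier M \<times> carrier N; set ys \<subseteq> carrier M \<times> carrier N\<rbrakk> \<Longrightarrow>
    tensor_eq R M rho N lam (xs @ ys) (ys @ xs)"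
| add_left: "\<lbrakk>m \<in> carrier M; m' \<in> carrier M; n \<in> carrier N\<rbrakk> \<Longrightarrow>
    tensor_eq R M rho N lam [(m \<oplus>\<^bsub>M\<^esub> m', n)] [(m, n), (m', n)]"
| add_right: "\<lbrakk>m \<in> carrier M; n \<in> carrier N; n' \<in> carrier N\<rbrakk> \<Longrightarrow>
    tensor_eq R M rho N lam [(m, n \<oplus>\<^bsub>N\<^esub> n')] [(m, n), (m, n')]"
| zero_left: "n \<in> carrier N \<Longrightarrow> tensor_eq R M rho N lam [(\<zero>\<^bsub>M\<^esub>, n)] []"
| balanced: "\<lbrakk>m \<in> carrier M; r \<in> carrier R; n \<in> carrier N\<rbrakk> \<Longrightarrow>
    tensor_eq R M rho N lam [(rho m r, n)] [(m, lam r n)]"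

definition tclass ::
  "('r, 'i) ring_scheme \<Rightarrow> ('k, 'm, 'j) module_scheme \<Rightarrow> ('m \<Rightarrow> 'r \<Rightarrow> 'm) \<Rightarrow>
   ('s, 'n, 'l) module_scheme \<Rightarrow> ('r \<Rightarrow> 'n \<Rightarrow> 'n) \<Rightarrow> ('m \<times> 'n) list \<Rightarrow> ('m \<times> 'n) list set"
  where "tclass R M rho N lam xs = {ys. tensor_eq R M rho N lam xs ys}"

definition rep :: "'b set \<Rightarrow> 'b"
  where "rep X = (SOME x. x \<in> X)"

text \<open>
  The tensor product as a module over the scalars of \<open>M\<close>, which act on the left factor.
\<close>

definition tensor ::
  "('r, 'i) ring_scheme \<Rightarrow> ('k, 'm, 'j) module_scheme \<Rightarrow> ('m \<Rightarrow> 'r \<Rightarrow> 'm) \<Rightarrow>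
   ('s, 'n, 'l) module_scheme \<Rightarrow> ('r \<Rightarrow> 'n \<Rightarrow> 'n) \<Rightarrow> ('k, ('m \<times> 'n) list set) module"
  where "tensor R M rho N lam =
    \<lparr>carrier = tclass R M rho N lam ` lists (carrier M \<times> carrier N),
     mult = undefined, one = undefined,
     zero = tclass R M rho N lam [],
     add = (\<lambda>X Y. tclass R M rho N lam (rep X @ rep Y)),
     smult = (\<lambda>k X. tclass R M rho N lam (map (\<lambda>(m, n). (k \<odot>\<^bsub>M\<^esub> m, n)) (rep X)))\<rparr>"

text \<open>The map \<open>id \<otimes> f\<close>; here \<open>N\<close> and \<open>lam\<close> describe the codomain of \<open>f\<close>.\<close>

definition tensor_map ::
  "('r, 'i) ring_scheme \<Rightarrow> ('k, 'm, 'j) module_scheme \<Rightarrow> ('m \<Rightarrow> 'r \<Rightarrow> 'm) \<Rightarrow>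
   ('s, 'n, 'l) module_scheme \<Rightarrow> ('r \<Rightarrow> 'n \<Rightarrow> 'n) \<Rightarrow> ('q \<Rightarrow> 'n) \<Rightarrow>
   ('m \<times> 'q) list set \<Rightarrow> ('m \<times> 'n) list set"
  where "tensor_map R M rho N lam f X = tclass R M rho N lam (map (\<lambda>(m, n). (m, f n)) (rep X))"

text \<open>
  Flatness of a right module: tensoring preserves injectivity of linear maps.  Quantification over
  left modules is only possible over a fixed type of elements, given by the last argument.  As soon
  as that type admits an injection from the elements of \<open>R\<close>, the left ideals of \<open>R\<close> are available
  on it, so the choice of the type does not affect the notion.
\<close>

definition flat_right ::
  "('r, 'i) ring_scheme \<Rightarrow> ('k, 'm, 'j) module_scheme \<Rightarrow> ('m \<Rightarrow> 'r \<Rightarrow> 'm) \<Rightarrow> 'x itself \<Rightarrow> bool"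
  where "flat_right R M rho T \<longleftrightarrow>
    (\<forall>(N :: ('r, 'x) module) (N' :: ('r, 'x) module) f.
      left_module R N \<and> left_module R N' \<and> f \<in> mod_hom R N N' \<and> inj_on f (carrier N) \<longrightarrow>
      inj_on (tensor_map R M rho N' (smult N') f) (carrier (tensor R M rho N (smult N))))"


section \<open>The functors of differential forms\<close>

definition Omod :: "('k, 'w) dga \<Rightarrow> nat \<Rightarrow> ('w, 'x) module \<Rightarrow> ('k, ('w \<times> 'x) list set) module"
  where "Omod \<Omega> m E = tensor (deg \<Omega> 0) (deg \<Omega> m) (mult \<Omega>) E (smult E)"

definition Oclass :: "('k, 'w) dga \<Rightarrow> nat \<Rightarrow> ('w, 'x) module \<Rightarrow> ('w \<times> 'x) list \<Rightarrow> ('w \<times> 'x) list set"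
  where "Oclass \<Omega> m E = tclass (deg \<Omega> 0) (deg \<Omega> m) (mult \<Omega>) E (smult E)"

definition Omap ::
  "('k, 'w) dga \<Rightarrow> nat \<Rightarrow> ('w, 'x) module \<Rightarrow> ('y \<Rightarrow> 'x) \<Rightarrow> ('w \<times> 'y) list set \<Rightarrow> ('w \<times> 'x) list set"
  where "Omap \<Omega> m F f = tensor_map (deg \<Omega> 0) (deg \<Omega> m) (mult \<Omega>) F (smult F) f"

text \<open>The canonical isomorphism from \<open>E\<close> to \<open>\<Omega>\<^sup>0 \<otimes> E\<close>.\<close>

definition unitor :: "('k, 'w) dga \<Rightarrow> ('w, 'x) module \<Rightarrow> 'x \<Rightarrow> ('w \<times> 'x) list set"
  where "unitor \<Omega> E x = Oclass \<Omega> 0 E [(\<one>\<^bsub>\<Omega>\<^esub>, x)]"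


section \<open>First jets\<close>

text \<open>
  Iterating the 1-jet functor an arbitrary number of times requires one type of elements that is
  closed under the construction.  In the type below, \<open>FSum\<close> holds formal sums of tensors
  \<open>a \<otimes> e\<close>, and a 1-jet is represented by one chosen formal sum in its class.  Base elements
  \<open>Base e\<close> allow any module with elements of type \<open>'e\<close> to be transported to this type.
\<close>

datatype ('w, 'e) jet = Base 'e | FSum "('w \<times> ('w, 'e) jet) list"

primrec summands :: "('w, 'e) jet \<Rightarrow> ('w \<times> ('w, 'e) jet) list"
where
  "summands (Base e) = []"
| "summands (FSum xs) = xs"

text \<open>
  A left \<open>A\<close>-module is a module over the scalars \<open>k\<close> through \<open>k \<cdot> e = (k \<cdot> 1) e\<close>.
\<close>

definition restrict_scalars :: "('k, 'w, 'i) module_scheme \<Rightarrow> ('w, 'x) module \<Rightarrow> ('k, 'x) module"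
  where "restrict_scalars A E = \<lparr>carrier = carrier E, mult = mult E, one = one E,
    zero = zero E, add = add E, smult = (\<lambda>k e. (k \<odot>\<^bsub>A\<^esub> \<one>\<^bsub>A\<^esub>) \<odot>\<^bsub>E\<^esub> e)\<rparr>"

definition AE :: "('k, 'i) ring_scheme \<Rightarrow> ('k, 'w) dga \<Rightarrow> ('w, 'x) module \<Rightarrow>
    ('k, ('w \<times> 'x) list set) module"
  where "AE K \<Omega> E = tensor K (deg \<Omega> 0) (\<lambda>a k. k \<odot>\<^bsub>\<Omega>\<^esub> a)
    E (smult (restrict_scalars (deg \<Omega> 0) E))"

definition AEclass :: "('k, 'i) ring_scheme \<Rightarrow> ('k, 'w) dga \<Rightarrow> ('w, 'x) module \<Rightarrow>
    ('w \<times> 'x) list \<Rightarrow> ('w \<times> 'x) list set"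
  where "AEclass K \<Omega> E = tclass K (deg \<Omega> 0) (\<lambda>a k. k \<odot>\<^bsub>\<Omega>\<^esub> a)
    E (smult (restrict_scalars (deg \<Omega> 0) E))"

definition J1_null :: "('k, 'i) ring_scheme \<Rightarrow> ('k, 'w) dga \<Rightarrow> ('w, 'x) module \<Rightarrow>
    ('w \<times> 'x) list set set"
  where "J1_null K \<Omega> E = {AEclass K \<Omega> E xs | xs. xs \<in> lists (grade \<Omega> 0 \<times> carrier E) \<and>
    foldr (add E) (map (\<lambda>(a, e). a \<odot>\<^bsub>E\<^esub> e) xs) \<zero>\<^bsub>E\<^esub> = \<zero>\<^bsub>E\<^esub> \<and>
    Oclass \<Omega> 1 E (map (\<lambda>(a, e). (diff \<Omega> a, e)) xs) = \<zero>\<^bsub>Omod \<Omega> 1 E\<^esub>}"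

text \<open>The class of a formal sum in the quotient of \<open>A \<otimes> E\<close> by \<open>J1_null K \<Omega> E\<close>.\<close>

definition J1_class :: "('k, 'i) ring_scheme \<Rightarrow> ('k, 'w) dga \<Rightarrow> ('w, ('w, 'e) jet) module \<Rightarrow>
    ('w \<times> ('w, 'e) jet) list \<Rightarrow> ('w, 'e) jet"
  where "J1_class K \<Omega> E xs = FSum (SOME ys. ys \<in> lists (grade \<Omega> 0 \<times> carrier E) \<and>
    AEclass K \<Omega> E ys \<ominus>\<^bsub>AE K \<Omega> E\<^esub> AEclass K \<Omega> E xs \<in> J1_null K \<Omega> E)"

definition J1 :: "('k, 'i) ring_scheme \<Rightarrow> ('k, 'w) dga \<Rightarrow> ('w, ('w, 'e) jet) module \<Rightarrow>
    ('w, ('w, 'e) jet) module"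
  where "J1 K \<Omega> E =
    \<lparr>carrier = J1_class K \<Omega> E ` lists (grade \<Omega> 0 \<times> carrier E),
     mult = undefined, one = undefined,
     zero = J1_class K \<Omega> E [],
     add = (\<lambda>x y. J1_class K \<Omega> E (summands x @ summands y)),
     smult = (\<lambda>a x. J1_class K \<Omega> E (map (\<lambda>(b, e). (a \<otimes>\<^bsub>\<Omega>\<^esub> b, e)) (summands x)))\<rparr>"

text \<open>The action on a linear map \<open>f\<close> with codomain \<open>F\<close>.\<close>

definition J1_map :: "('k, 'i) ring_scheme \<Rightarrow> ('k, 'w) dga \<Rightarrow> ('w, ('w, 'e) jet) module \<Rightarrow>
    (('w, 'e) jet \<Rightarrow> ('w, 'e) jet) \<Rightarrow> ('w, 'e) jet \<Rightarrow> ('w, 'e) jet"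
  where "J1_map K \<Omega> F f x = J1_class K \<Omega> F (map (\<lambda>(a, e). (a, f e)) (summands x))"

definition D_I :: "('k, 'w) dga \<Rightarrow> ('w, ('w, 'e) jet) module \<Rightarrow> ('w, 'e) jet \<Rightarrow>
    ('w \<times> ('w, 'e) jet) list set"
  where "D_I \<Omega> E x = Oclass \<Omega> 1 E (concat (map (\<lambda>(a, y).
    map (\<lambda>(c, e). (a \<otimes>\<^bsub>\<Omega>\<^esub> diff \<Omega> c, e)) (summands y)) (summands x)))"

definition D_II :: "('k, 'w) dga \<Rightarrow> ('w, ('w, 'e) jet) module \<Rightarrow> ('w, 'e) jet \<Rightarrow>
    ('w \<times> ('w, 'e) jet) list set"
  where "D_II \<Omega> E x = Oclass \<Omega> 2 E (concat (map (\<lambda>(a, y).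
    map (\<lambda>(c, e). (diff \<Omega> a \<otimes>\<^bsub>\<Omega>\<^esub> diff \<Omega> c, e)) (summands y)) (summands x)))"


section \<open>Holonomic and sesquiholonomic jets\<close>

text \<open>
  The carriers of \<open>J K \<Omega> n E\<close> and \<open>SJ K \<Omega> n E\<close> are subsets of the carrier of
  \<open>J1 K \<Omega> (J K \<Omega> (n - 1) E)\<close>, so the inclusions \<open>l_hol\<close>, \<open>l_sesq\<close> and \<open>t_incl\<close> are given by the
  identity function.  Applying the functor \<open>J1\<close> to an inclusion does change elements, since
  classes are then formed with respect to the larger module.
\<close>

definition l_hol :: "nat \<Rightarrow> ('w, ('w, 'e) jet) module \<Rightarrow> ('w, 'e) jet \<Rightarrow> ('w, 'e) jet"
  where "l_hol n E x = x"

definition l_sesq :: "nat \<Rightarrow> ('w, ('w, 'e) jet) module \<Rightarrow> ('w, 'e) jet \<Rightarrow> ('w, 'e) jet"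
  where "l_sesq n E x = x"

definition t_incl :: "nat \<Rightarrow> ('w, ('w, 'e) jet) module \<Rightarrow> ('w, 'e) jet \<Rightarrow> ('w, 'e) jet"
  where "t_incl n E x = x"

fun J :: "('k, 'i) ring_scheme \<Rightarrow> ('k, 'w) dga \<Rightarrow> nat \<Rightarrow> ('w, ('w, 'e) jet) module \<Rightarrow>
    ('w, ('w, 'e) jet) module"
where
  "J K \<Omega> 0 E = E"
| "J K \<Omega> (Suc 0) E = J1 K \<Omega> E"
| "J K \<Omega> (Suc (Suc n)) E = (J1 K \<Omega> (J K \<Omega> (Suc n) E))
     \<lparr>carrier := {x \<in> carrier (J1 K \<Omega> (J K \<Omega> (Suc n) E)).
        D_I \<Omega> (J K \<Omega> n E) (J1_map K \<Omega> (J1 K \<Omega> (J K \<Omega> n E)) (l_hol (Suc n) E) x)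
          = \<zero>\<^bsub>Omod \<Omega> 1 (J K \<Omega> n E)\<^esub> \<and>
        D_II \<Omega> (J K \<Omega> n E) (J1_map K \<Omega> (J1 K \<Omega> (J K \<Omega> n E)) (l_hol (Suc n) E) x)
          = \<zero>\<^bsub>Omod \<Omega> 2 (J K \<Omega> n E)\<^esub>}\<rparr>"

fun SJ :: "('k, 'i) ring_scheme \<Rightarrow> ('k, 'w) dga \<Rightarrow> nat \<Rightarrow> ('w, ('w, 'e) jet) module \<Rightarrow>
    ('w, ('w, 'e) jet) module"
where
  "SJ K \<Omega> 0 E = E"
| "SJ K \<Omega> (Suc 0) E = J1 K \<Omega> E"
| "SJ K \<Omega> (Suc (Suc n)) E = (J1 K \<Omega> (J K \<Omega> (Suc n) E))
     \<lparr>carrier := {x \<in> carrier (J1 K \<Omega> (J K \<Omega> (Suc n) E)).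
        D_I \<Omega> (J K \<Omega> n E) (J1_map K \<Omega> (J1 K \<Omega> (J K \<Omega> n E)) (l_hol (Suc n) E) x)
          = \<zero>\<^bsub>Omod \<Omega> 1 (J K \<Omega> n E)\<^esub>}\<rparr>"

text \<open>Both actions on a linear map \<open>f\<close> with codomain \<open>F\<close> are restrictions of
  \<open>J1_map K \<Omega> (J K \<Omega> n F) (J_map K \<Omega> n F f)\<close>.\<close>

primrec J_map :: "('k, 'i) ring_scheme \<Rightarrow> ('k, 'w) dga \<Rightarrow> nat \<Rightarrow> ('w, ('w, 'e) jet) module \<Rightarrow>
    (('w, 'e) jet \<Rightarrow> ('w, 'e) jet) \<Rightarrow> ('w, 'e) jet \<Rightarrow> ('w, 'e) jet"
where
  "J_map K \<Omega> 0 F f = f"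
| "J_map K \<Omega> (Suc n) F f = J1_map K \<Omega> (J K \<Omega> n F) (J_map K \<Omega> n F f)"

primrec SJ_map :: "('k, 'i) ring_scheme \<Rightarrow> ('k, 'w) dga \<Rightarrow> nat \<Rightarrow> ('w, ('w, 'e) jet) module \<Rightarrow>
    (('w, 'e) jet \<Rightarrow> ('w, 'e) jet) \<Rightarrow> ('w, 'e) jet \<Rightarrow> ('w, 'e) jet"
where
  "SJ_map K \<Omega> 0 F f = f"
| "SJ_map K \<Omega> (Suc n) F f = J1_map K \<Omega> (J K \<Omega> n F) (J_map K \<Omega> n F f)"


section \<open>Spencer operators\<close>

definition Spencer1 :: "('k, 'w) dga \<Rightarrow> nat \<Rightarrow> ('w, ('w, 'e) jet) module \<Rightarrow>
    ('w \<times> ('w, 'e) jet) list set \<Rightarrow> ('w \<times> ('w, 'e) jet) list set"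
  where "Spencer1 \<Omega> m E X = Oclass \<Omega> (m + 1) E (concat (map (\<lambda>(w, y).
    map (\<lambda>(a, e). (diff \<Omega> (w \<otimes>\<^bsub>\<Omega>\<^esub> a), e)) (summands y)) (rep X)))"

text \<open>The following three operators are meant for \<open>n \<ge> 1\<close>.\<close>

definition Spencer :: "('k, 'i) ring_scheme \<Rightarrow> ('k, 'w) dga \<Rightarrow> nat \<Rightarrow> nat \<Rightarrow>
    ('w, ('w, 'e) jet) module \<Rightarrow> ('w \<times> ('w, 'e) jet) list set \<Rightarrow> ('w \<times> ('w, 'e) jet) list set"
  where "Spencer K \<Omega> n m E = Spencer1 \<Omega> m (J K \<Omega> (n - 1) E) \<circ>
    Omap \<Omega> m (J1 K \<Omega> (J K \<Omega> (n - 1) E)) (l_hol n E)"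

definition Spencer_bar :: "('k, 'i) ring_scheme \<Rightarrow> ('k, 'w) dga \<Rightarrow> nat \<Rightarrow> nat \<Rightarrow>
    ('w, ('w, 'e) jet) module \<Rightarrow> ('w \<times> ('w, 'e) jet) list set \<Rightarrow> ('w \<times> ('w, 'e) jet) list set"
  where "Spencer_bar K \<Omega> n m E = Spencer1 \<Omega> m (J K \<Omega> (n - 1) E) \<circ>
    Omap \<Omega> m (J1 K \<Omega> (J K \<Omega> (n - 1) E)) (l_sesq n E)"

definition Spencer_sesq :: "('k, 'i) ring_scheme \<Rightarrow> ('k, 'w) dga \<Rightarrow> nat \<Rightarrow> nat \<Rightarrow>
    ('w, ('w, 'e) jet) module \<Rightarrow> ('w \<times> ('w, 'e) jet) list set \<Rightarrow> ('w \<times> ('w, 'e) jet) list set"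
  where "Spencer_sesq K \<Omega> n m E = Spencer1 \<Omega> m (SJ K \<Omega> (n - 1) E) \<circ>
    Omap \<Omega> m (J1 K \<Omega> (SJ K \<Omega> (n - 1) E))
      (J1_map K \<Omega> (SJ K \<Omega> (n - 1) E) (t_incl (n - 1) E) \<circ> l_sesq n E)"


section \<open>Functors and natural transformations\<close>

text \<open>
  Functors from left \<open>A\<close>-modules, with elements in a fixed type, to \<open>K\<close>-modules.  The action on
  morphisms receives the codomain and the underlying function of a morphism, and must depend only
  on the values of the function on the carrier of the domain.
\<close>

definition kmod_functor ::
  "('k, 'i) ring_scheme \<Rightarrow> ('k, 'w) module \<Rightarrow> (('w, 'x) module \<Rightarrow> ('k, 'y) module) \<Rightarrow>
   (('w, 'x) module \<Rightarrow> ('x \<Rightarrow> 'x) \<Rightarrow> 'y \<Rightarrow> 'y) \<Rightarrow> bool"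
  where "kmod_functor K A Fo Fm \<longleftrightarrow>
    (\<forall>E. left_module A E \<longrightarrow> module K (Fo E) \<and>
      (\<forall>x\<in>carrier (Fo E). Fm E (\<lambda>e. e) x = x)) \<and>
    (\<forall>E F f. left_module A E \<and> left_module A F \<and> f \<in> mod_hom A E F \<longrightarrow>
      Fm F f \<in> mod_hom K (Fo E) (Fo F) \<and>
      (\<forall>g\<in>mod_hom A E F. (\<forall>e\<in>carrier E. f e = g e) \<longrightarrow>
        (\<forall>x\<in>carrier (Fo E). Fm F f x = Fm F g x))) \<and>
    (\<forall>E F G f g. left_module A E \<and> left_module A F \<and> left_module A G \<and>
      f \<in> mod_hom A E F \<and> g \<in> mod_hom A F G \<longrightarrow>
      (\<forall>x\<in>carrier (Fo E). Fm G (g \<circ> f) x = Fm G g (Fm F f x)))"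

definition nat_trans ::
  "('k, 'i) ring_scheme \<Rightarrow> ('k, 'w) module \<Rightarrow>
   (('w, 'x) module \<Rightarrow> ('k, 'y) module) \<Rightarrow> (('w, 'x) module \<Rightarrow> ('x \<Rightarrow> 'x) \<Rightarrow> 'y \<Rightarrow> 'y) \<Rightarrow>
   (('w, 'x) module \<Rightarrow> ('k, 'z) module) \<Rightarrow> (('w, 'x) module \<Rightarrow> ('x \<Rightarrow> 'x) \<Rightarrow> 'z \<Rightarrow> 'z) \<Rightarrow>
   (('w, 'x) module \<Rightarrow> 'y \<Rightarrow> 'z) \<Rightarrow> bool"
  where "nat_trans K A Fo Fm Go Gm \<eta> \<longleftrightarrow>
    kmod_functor K A Fo Fm \<and> kmod_functor K A Go Gm \<and>
    (\<forall>E. left_module A E \<longrightarrow> \<eta> E \<in> mod_hom K (Fo E) (Go E)) \<and>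
    (\<forall>E F f. left_module A E \<and> left_module A F \<and> f \<in> mod_hom A E F \<longrightarrow>
      (\<forall>x\<in>carrier (Fo E). \<eta> F (Fm F f x) = Gm F f (\<eta> E x)))"

text \<open>Equality of natural transformations between two given functors.\<close>

definition nat_trans_eq ::
  "('k, 'i) ring_scheme \<Rightarrow> ('k, 'w) module \<Rightarrow>
   (('w, 'x) module \<Rightarrow> ('k, 'y) module) \<Rightarrow> (('w, 'x) module \<Rightarrow> ('x \<Rightarrow> 'x) \<Rightarrow> 'y \<Rightarrow> 'y) \<Rightarrow>
   (('w, 'x) module \<Rightarrow> ('k, 'z) module) \<Rightarrow> (('w, 'x) module \<Rightarrow> ('x \<Rightarrow> 'x) \<Rightarrow> 'z \<Rightarrow> 'z) \<Rightarrow>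
   (('w, 'x) module \<Rightarrow> 'y \<Rightarrow> 'z) \<Rightarrow> (('w, 'x) module \<Rightarrow> 'y \<Rightarrow> 'z) \<Rightarrow> bool"
  where "nat_trans_eq K A Fo Fm Go Gm \<eta> \<theta> \<longleftrightarrow>
    nat_trans K A Fo Fm Go Gm \<eta> \<and> nat_trans K A Fo Fm Go Gm \<theta> \<and>
    (\<forall>E. left_module A E \<longrightarrow> (\<forall>x\<in>carrier (Fo E). \<eta> E x = \<theta> E x))"

end

(*
  A first jet x of E is determined by its value v(x) in E and its derivative d(x) in Omega^1 E,
  where [a \<otimes> e] has value a e and derivative da \<otimes> e.  In these terms the Spencer operator is
  w \<otimes> y |-> dw \<otimes> v(y) + (-1)^m w d(y), so that S^{1,0}(1 \<otimes> x) = d(x), and for x in J^1 J^1 E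
    S^{1,1}(d(x)) = - D^II(x)   and   d(v(x)) = (Omega^1 v)(d(x)) + D^I(x).
  Since d is natural, the first identity applied to the image of a sesquiholonomic jet in
  J^1 J^1 J^{n-2} is statement (1), and (2) follows.  The composite in (3) is the one in (1) followed
  by Omega^2 applied to the inclusion of J^{n-2} in J^{{n-2}}, which is injective by flatness.

  By the second identity D^I(x) = 0 says that the two linear projections of x to J^1 E coincide, so
  D^I cuts out a natural submodule; on that submodule D^II is linear up to terms which vanish there.
*)
theory Submission
  imports Defs
begin

section \<open>Additive maps and sums over lists\<close>

text \<open>The obstacle is that jets exist only through choices: \<open>J1\<close> stores one
  formal sum per class, and \<open>D_I\<close>, \<open>D_II\<close>, \<open>Spencer1\<close> are
  computed on it. Value and derivative make the choices harmless, because the relations defining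
  \<open>J1_null\<close> are exactly the vanishing of these two sums. Hence x |-> (v(x), d(x))
  embeds J^1 E into E x Omega^1 E, and identities between jets are checked on components. Under this
  embedding \<open>A\<close> acts by a (v, d) = (a v, da \<otimes> v + a d). The twist da \<otimes>
  v is the source of all failures of linearity: v is linear over \<open>A\<close>, d only over
  \<open>K\<close>. Linearity over \<open>A\<close> cannot be ignored, since J^n must be an
  \<open>A\<close>-module before J^1 is applied to it again. The two identities for D^I and D^II
  also show that these operators do not depend on representatives, which their definitions leave
  open. J^1 of an inclusion M -> J^1 N need not be injective, so conditions on J^1 M are always
  tested after passing to J^1 J^1 N. Treating such a pair M, N abstractly covers all levels of the
  recursion at once.\<close>

definition lsum :: "('a, 'b) ring_scheme \<Rightarrow> ('p \<Rightarrow> 'a) \<Rightarrow> 'p list \<Rightarrow> 'a"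
  where "lsum G f xs = foldr (add G) (map f xs) \<zero>\<^bsub>G\<^esub>"

text \<open>Only addition is asked for, since \<open>jet_der\<close> and the Spencer operators are
  not linear over \<open>A\<close>, and their values lie in modules over another ring than their
  arguments may do.\<close>

definition additive_map :: "('a, 'b) ring_scheme \<Rightarrow> ('c, 'd) ring_scheme \<Rightarrow> ('a \<Rightarrow> 'c) \<Rightarrow> bool"
  where "additive_map G H f \<longleftrightarrow> f \<in> carrier G \<rightarrow> carrier H \<and>
    (\<forall>x\<in>carrier G. \<forall>y\<in>carrier G. f (x \<oplus>\<^bsub>G\<^esub> y) = f x \<oplus>\<^bsub>H\<^esub> f y)"

lemma additive_mapI:
  assumes "\<And>x. x \<in> carrier G \<Longrightarrow> f x \<in> carrier H"
    and "\<And>x y. \<lbrakk>x \<in> carrier G; y \<in> carrier G\<rbrakk> \<Longrightarrow> f (x \<oplus>\<^bsub>G\<^esub> y) = f x \<oplus>\<^bsub>H\<^esub> f y"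
  shows "additive_map G H f"
  using assms by (auto simp: additive_map_def)

lemma additive_map_closed: "\<lbrakk>additive_map G H f; x \<in> carrier G\<rbrakk> \<Longrightarrow> f x \<in> carrier H"
  by (auto simp: additive_map_def)

lemma additive_map_add:
  "\<lbrakk>additive_map G H f; x \<in> carrier G; y \<in> carrier G\<rbrakk> \<Longrightarrow> f (x \<oplus>\<^bsub>G\<^esub> y) = f x \<oplus>\<^bsub>H\<^esub> f y"
  by (auto simp: additive_map_def)

text \<open>Operators are functions on a whole type, and formulas for them hold only on carriers.
  The group axioms of the domain supply the closure under addition that the transfer
  requires.\<close>

lemma additive_map_cong:
  assumes "additive_map G H f" "abelian_group G" "\<And>x. x \<in> carrier G \<Longrightarrow> f x = g x"
  shows "additive_map G H g"
proof -
  interpret G: abelian_group G by fact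
  show ?thesis
    using assms(1) by (intro additive_mapI)
      (simp_all flip: assms(3) add: additive_map_closed additive_map_add)
qed

lemma additive_map_comp:
  "\<lbrakk>additive_map G H f; additive_map H L g\<rbrakk> \<Longrightarrow> additive_map G L (\<lambda>x. g (f x))"
  by (auto simp: additive_map_def Pi_def)

lemma additive_map_zero:
  assumes "abelian_group G" "abelian_group H" "additive_map G H f"
  shows "f \<zero>\<^bsub>G\<^esub> = \<zero>\<^bsub>H\<^esub>"
proof -
  interpret G: abelian_group G by fact
  interpret H: abelian_group H by fact
  have "f \<zero>\<^bsub>G\<^esub> \<oplus>\<^bsub>H\<^esub> f \<zero>\<^bsub>G\<^esub> = f \<zero>\<^bsub>G\<^esub> \<oplus>\<^bsub>H\<^esub> \<zero>\<^bsub>H\<^esub>"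
    using additive_map_add[OF assms(3), of "\<zero>\<^bsub>G\<^esub>" "\<zero>\<^bsub>G\<^esub>"] additive_map_closed[OF assms(3)] by simp
  then show ?thesis
    using additive_map_closed[OF assms(3), of "\<zero>\<^bsub>G\<^esub>"]
    by (simp add: H.add.l_cancel_one additive_map_closed[OF assms(3)])
qed

lemma additive_map_minus:
  assumes "abelian_group G" "abelian_group H" "additive_map G H f" "x \<in> carrier G"
  shows "f (\<ominus>\<^bsub>G\<^esub> x) = \<ominus>\<^bsub>H\<^esub> f x"
proof -
  interpret G: abelian_group G by fact
  interpret H: abelian_group H by fact
  have "f (\<ominus>\<^bsub>G\<^esub> x) \<oplus>\<^bsub>H\<^esub> f x = \<zero>\<^bsub>H\<^esub>"
    using additive_map_add[OF assms(3), of "\<ominus>\<^bsub>G\<^esub> x" x] assms(4) additive_map_zero[OF assms(1-3)]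
    by (simp add: G.l_neg)
  then show ?thesis
    using H.minus_equality additive_map_closed[OF assms(3)] assms(4) by simp
qed

lemma mod_hom_additive: "f \<in> mod_hom R M N \<Longrightarrow> additive_map M N f"
  by (auto simp: mod_hom_def additive_map_def)

lemma mod_hom_smult:
  "\<lbrakk>f \<in> mod_hom R M N; r \<in> carrier R; x \<in> carrier M\<rbrakk> \<Longrightarrow> f (r \<odot>\<^bsub>M\<^esub> x) = r \<odot>\<^bsub>N\<^esub> f x"
  by (auto simp: mod_hom_def)

lemma mod_homI:
  assumes "additive_map M N f"
    and "\<And>r x. \<lbrakk>r \<in> carrier R; x \<in> carrier M\<rbrakk> \<Longrightarrow> f (r \<odot>\<^bsub>M\<^esub> x) = r \<odot>\<^bsub>N\<^esub> f x"
  shows "f \<in> mod_hom R M N"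
  using assms by (auto simp: mod_hom_def additive_map_def)

lemma mod_hom_comp:
  "\<lbrakk>f \<in> mod_hom R M N; g \<in> mod_hom R N L\<rbrakk> \<Longrightarrow> (\<lambda>x. g (f x)) \<in> mod_hom R M L"
  by (auto simp: mod_hom_def Pi_def)

lemma lsum_simps [simp]:
  "lsum G f [] = \<zero>\<^bsub>G\<^esub>"
  "lsum G f (x # xs) = f x \<oplus>\<^bsub>G\<^esub> lsum G f xs"
  by (simp_all add: lsum_def)

lemma lsum_map [simp]: "lsum G f (map g xs) = lsum G (\<lambda>x. f (g x)) xs"
  by (induction xs) simp_all

lemma lsum_cong: "(\<And>x. x \<in> set xs \<Longrightarrow> f x = g x) \<Longrightarrow> lsum G f xs = lsum G g xs"
  by (induction xs) simp_all

lemma (in abelian_monoid) lsum_closed: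
  "(\<And>x. x \<in> set xs \<Longrightarrow> f x \<in> carrier G) \<Longrightarrow> lsum G f xs \<in> carrier G"
  by (induction xs) simp_all

lemma (in abelian_monoid) lsum_append:
  "(\<And>x. x \<in> set xs \<union> set ys \<Longrightarrow> f x \<in> carrier G) \<Longrightarrow>
    lsum G f (xs @ ys) = lsum G f xs \<oplus> lsum G f ys"
  by (induction xs) (simp_all add: lsum_closed a_assoc)

lemma (in abelian_monoid) lsum_add:
  "\<lbrakk>\<And>x. x \<in> set xs \<Longrightarrow> f x \<in> carrier G; \<And>x. x \<in> set xs \<Longrightarrow> g x \<in> carrier G\<rbrakk> \<Longrightarrow>
    lsum G (\<lambda>x. f x \<oplus> g x) xs = lsum G f xs \<oplus> lsum G g xs"
  by (induction xs) (simp_all add: lsum_closed a_ac)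

lemma additive_map_lsum:
  assumes "abelian_group G" "abelian_group H" "additive_map G H f"
    and "\<And>x. x \<in> set xs \<Longrightarrow> h x \<in> carrier G"
  shows "f (lsum G h xs) = lsum H (\<lambda>x. f (h x)) xs"
proof -
  interpret G: abelian_group G by fact
  show ?thesis
    using assms(4) additive_map_zero[OF assms(1-3)]
    by (induction xs) (simp_all add: additive_map_add[OF assms(3)] G.lsum_closed)
qed

section \<open>The universal property of tensor products\<close>

definition balanced_map ::
  "('r, 'i) ring_scheme \<Rightarrow> ('k, 'm, 'j) module_scheme \<Rightarrow> ('m \<Rightarrow> 'r \<Rightarrow> 'm) \<Rightarrow>
   ('s, 'n, 'l) module_scheme \<Rightarrow> ('r \<Rightarrow> 'n \<Rightarrow> 'n) \<Rightarrow> ('g, 'q) ring_scheme \<Rightarrow> ('m \<Rightarrow> 'n \<Rightarrow> 'g) \<Rightarrow> bool"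
  where "balanced_map R M rho N lam G h \<longleftrightarrow>
    (\<forall>m\<in>carrier M. additive_map N G (h m)) \<and>
    (\<forall>n\<in>carrier N. additive_map M G (\<lambda>m. h m n)) \<and>
    (\<forall>m\<in>carrier M. \<forall>r\<in>carrier R. \<forall>n\<in>carrier N. h (rho m r) n = h m (lam r n))"

lemma balanced_mapI:
  assumes "\<And>m. m \<in> carrier M \<Longrightarrow> additive_map N G (h m)"
    and "\<And>n. n \<in> carrier N \<Longrightarrow> additive_map M G (\<lambda>m. h m n)"
    and "\<And>m r n. \<lbrakk>m \<in> carrier M; r \<in> carrier R; n \<in> carrier N\<rbrakk> \<Longrightarrow> h (rho m r) n = h m (lam r n)"
  shows "balanced_map R M rho N lam G h"
  using assms by (auto simp: balanced_map_def)

text \<open>One setting for both tensor products that occur: forms with values in a module, over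
  \<open>A\<close>, and the product A \<otimes> E over \<open>K\<close> of which 1-jets are a
  quotient.\<close>

locale balanced_tensor = M: abelian_group M + N: abelian_group N
  for R :: "('r, 'i) ring_scheme" and M :: "('k, 'm, 'j) module_scheme" and rho
    and N :: "('s, 'n, 'l) module_scheme" and lam +
  assumes rho_closed: "\<lbrakk>m \<in> carrier M; r \<in> carrier R\<rbrakk> \<Longrightarrow> rho m r \<in> carrier M"
    and lam_closed: "\<lbrakk>r \<in> carrier R; n \<in> carrier N\<rbrakk> \<Longrightarrow> lam r n \<in> carrier N"
begin

abbreviation "pairs \<equiv> carrier M \<times> carrier N"
abbreviation "teq \<equiv> tensor_eq R M rho N lam"
abbreviation "cls \<equiv> tclass R M rho N lam"
abbreviation "ten m n \<equiv> cls [(m, n)]"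
abbreviation "T \<equiv> tensor R M rho N lam"

lemma teq_pairs: "teq xs ys \<Longrightarrow> set xs \<subseteq> pairs \<and> set ys \<subseteq> pairs"
  by (induction rule: tensor_eq.induct) (auto simp: rho_closed lam_closed)

lemma cls_eq_iff: "set xs \<subseteq> pairs \<Longrightarrow> cls xs = cls ys \<longleftrightarrow> teq xs ys"
  unfolding tclass_def set_eq_iff mem_Collect_eq
  by (metis tensor_eq.refl tensor_eq.sym tensor_eq.trans teq_pairs)

lemma teq_rep: "set xs \<subseteq> pairs \<Longrightarrow> teq xs (rep (cls xs))"
  unfolding rep_def by (rule someI2[of _ xs]) (auto simp: tclass_def intro: tensor_eq.refl)

lemma rep_pairs: "X \<in> carrier T \<Longrightarrow> set (rep X) \<subseteq> pairs"
  using teq_rep teq_pairs by (fastforce simp: tensor_def)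

lemma cls_rep: "X \<in> carrier T \<Longrightarrow> cls (rep X) = X"
  using teq_rep cls_eq_iff by (fastforce simp: tensor_def)

lemma cls_closed: "set xs \<subseteq> pairs \<Longrightarrow> cls xs \<in> carrier T"
  by (auto simp: tensor_def)

lemma T_zero: "\<zero>\<^bsub>T\<^esub> = cls []"
  by (simp add: tensor_def)

lemma T_add:
  assumes "set xs \<subseteq> pairs" "set ys \<subseteq> pairs"
  shows "cls xs \<oplus>\<^bsub>T\<^esub> cls ys = cls (xs @ ys)"
proof -
  have "teq (xs @ ys) (rep (cls xs) @ rep (cls ys))"
    using assms by (intro tensor_eq.append teq_rep)
  then have "cls (xs @ ys) = cls (rep (cls xs) @ rep (cls ys))"
    using assms by (subst cls_eq_iff) auto
  then show ?thesis by (simp add: tensor_def)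
qed

lemma T_cases:
  assumes "X \<in> carrier T" obtains xs where "set xs \<subseteq> pairs" "X = cls xs"
  using assms cls_rep rep_pairs by metis

lemma ten_closed: "\<lbrakk>m \<in> carrier M; n \<in> carrier N\<rbrakk> \<Longrightarrow> ten m n \<in> carrier T"
  by (simp add: cls_closed)

lemma ten_add_left:
  "\<lbrakk>m \<in> carrier M; m' \<in> carrier M; n \<in> carrier N\<rbrakk> \<Longrightarrow>
    ten (m \<oplus>\<^bsub>M\<^esub> m') n = ten m n \<oplus>\<^bsub>T\<^esub> ten m' n"
  by (simp add: T_add cls_eq_iff tensor_eq.add_left)

lemma ten_add_right:
  "\<lbrakk>m \<in> carrier M; n \<in> carrier N; n' \<in> carrier N\<rbrakk> \<Longrightarrow>
    ten m (n \<oplus>\<^bsub>N\<^esub> n') = ten m n \<oplus>\<^bsub>T\<^esub> ten m n'"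
  by (simp add: T_add cls_eq_iff tensor_eq.add_right)

lemma ten_balanced:
  "\<lbrakk>m \<in> carrier M; r \<in> carrier R; n \<in> carrier N\<rbrakk> \<Longrightarrow> ten (rho m r) n = ten m (lam r n)"
  by (simp add: cls_eq_iff tensor_eq.balanced rho_closed)

lemma ten_zero_left: "n \<in> carrier N \<Longrightarrow> ten \<zero>\<^bsub>M\<^esub> n = \<zero>\<^bsub>T\<^esub>"
  by (simp add: T_zero cls_eq_iff tensor_eq.zero_left)

lemma abelian_monoid_T: "abelian_monoid T"
proof (rule abelian_monoidI)
  fix X Y assume "X \<in> carrier T" "Y \<in> carrier T"
  then obtain xs ys where xy: "set xs \<subseteq> pairs" "X = cls xs" "set ys \<subseteq> pairs" "Y = cls ys"
    by (metis T_cases)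
  then show "X \<oplus>\<^bsub>T\<^esub> Y \<in> carrier T" by (simp add: T_add cls_closed)
  show "X \<oplus>\<^bsub>T\<^esub> Y = Y \<oplus>\<^bsub>T\<^esub> X"
    using xy by (simp add: T_add cls_eq_iff tensor_eq.commute)
  show "\<zero>\<^bsub>T\<^esub> \<oplus>\<^bsub>T\<^esub> X = X"
    using xy by (simp add: T_add T_zero)
  fix Z assume "Z \<in> carrier T"
  then obtain zs where "set zs \<subseteq> pairs" "Z = cls zs" by (metis T_cases)
  then show "X \<oplus>\<^bsub>T\<^esub> Y \<oplus>\<^bsub>T\<^esub> Z = X \<oplus>\<^bsub>T\<^esub> (Y \<oplus>\<^bsub>T\<^esub> Z)"
    using xy by (simp add: T_add)
qed (simp add: T_zero cls_closed)

sublocale T: abelian_group T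
proof -
  interpret abelian_monoid T by (rule abelian_monoid_T)
  \<comment> \<open>Formal sums have no subtraction, so an inverse is assembled summand by summand,
    with -m \<otimes> n opposite to m \<otimes> n.\<close>
  have inv: "\<exists>Y\<in>carrier T. Y \<oplus>\<^bsub>T\<^esub> cls xs = \<zero>\<^bsub>T\<^esub>" if "set xs \<subseteq> pairs" for xs
    using that
  proof (induction xs)
    case Nil
    then show ?case using T_zero zero_closed l_zero by metis
  next
    case (Cons p xs)
    obtain m n where p: "p = (m, n)" "m \<in> carrier M" "n \<in> carrier N" using Cons.prems by auto
    obtain Y where Y: "Y \<in> carrier T" "Y \<oplus>\<^bsub>T\<^esub> cls xs = \<zero>\<^bsub>T\<^esub>" using Cons by auto
    have xs: "cls xs \<in> carrier T" using Cons.prems by (simp add: cls_closed)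
    have "ten (\<ominus>\<^bsub>M\<^esub> m) n \<oplus>\<^bsub>T\<^esub> ten m n = \<zero>\<^bsub>T\<^esub>"
      using p by (simp add: ten_add_left[symmetric] M.l_neg ten_zero_left)
    moreover have "cls (p # xs) = ten m n \<oplus>\<^bsub>T\<^esub> cls xs"
      using p Cons.prems by (simp add: T_add)
    ultimately have "(ten (\<ominus>\<^bsub>M\<^esub> m) n \<oplus>\<^bsub>T\<^esub> Y) \<oplus>\<^bsub>T\<^esub> cls (p # xs) = \<zero>\<^bsub>T\<^esub>"
      using a_assoc a_comm a_closed Y p xs ten_closed M.a_inv_closed r_zero by (metis zero_closed)
    then show ?case
      using Y p ten_closed by (metis a_closed M.a_inv_closed)
  qed
  show "abelian_group T"
  proof (rule abelian_groupI)
    fix X assume "X \<in> carrier T"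
    then show "\<exists>Y\<in>carrier T. Y \<oplus>\<^bsub>T\<^esub> X = \<zero>\<^bsub>T\<^esub>" by (metis T_cases inv)
  qed (simp_all add: a_ac)
qed

lemma cls_eq_lsum: "set xs \<subseteq> pairs \<Longrightarrow> cls xs = lsum T (\<lambda>(m, n). ten m n) xs"
proof (induction xs)
  case (Cons p xs)
  then show ?case using T_add[of "[p]" xs] by (cases p) simp
qed (simp add: T_zero)

text \<open>The universal property: every rule generating \<open>tensor_eq\<close> becomes an
  identity in an abelian group under a balanced map, so induction on the rules suffices.\<close>

lemma lsum_teq:
  assumes "abelian_group G" "balanced_map R M rho N lam G h" "teq xs ys"
  shows "lsum G (\<lambda>(m, n). h m n) xs = lsum G (\<lambda>(m, n). h m n) ys"
proof -
  interpret G: abelian_group G by fact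
  note h = assms(2)[unfolded balanced_map_def]
  have h0: "h \<zero>\<^bsub>M\<^esub> n = \<zero>\<^bsub>G\<^esub>" if "n \<in> carrier N" for n
    using additive_map_zero[OF M.abelian_group_axioms assms(1), of "\<lambda>m. h m n"] h that by simp
  have hc: "h m n \<in> carrier G" if "m \<in> carrier M" "n \<in> carrier N" for m n
    using h that by (auto dest: additive_map_closed)
  have hl: "(case p of (m, n) \<Rightarrow> h m n) \<in> carrier G" if "set xs \<subseteq> pairs" "p \<in> set xs" for p xs
    using hc that by auto
  show ?thesis
    using assms(3)
  proof (induction rule: tensor_eq.induct)
    case (append xs ys us vs)
    show ?case
      using append.IH teq_pairs[OF append.hyps(1)] teq_pairs[OF append.hyps(2)] hl
      by (subst (1 2) G.lsum_append) auto
  next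
    case (commute xs ys)
    then show ?case
      using hl by (subst (1 2) G.lsum_append) (auto intro!: G.a_comm G.lsum_closed hc)
  next
    case (add_left m m' n)
    then show ?case using h hc additive_map_add[of M G "\<lambda>m. h m n" m m'] by simp
  next
    case (add_right m n n')
    then show ?case using h hc additive_map_add[of N G "h m" n n'] by simp
  qed (use h h0 hc in simp_all)
qed

text \<open>Evaluated on the list picked by \<open>rep\<close>, because \<open>tensor_map\<close>
  and \<open>Spencer1\<close> are computed that way; \<open>lift_cls\<close> frees the value from
  the choice.\<close>

definition lift :: "('g, 'q) ring_scheme \<Rightarrow> ('m \<Rightarrow> 'n \<Rightarrow> 'g) \<Rightarrow> ('m \<times> 'n) list set \<Rightarrow> 'g"
  where "lift G h X = lsum G (\<lambda>(m, n). h m n) (rep X)"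

lemma lift_cls:
  assumes "abelian_group G" "balanced_map R M rho N lam G h" "set xs \<subseteq> pairs"
  shows "lift G h (cls xs) = lsum G (\<lambda>(m, n). h m n) xs"
  using lsum_teq[OF assms(1,2) teq_rep[OF assms(3)]] by (simp add: lift_def)

lemma balanced_map_closed:
  "\<lbrakk>balanced_map R M rho N lam G h; m \<in> carrier M; n \<in> carrier N\<rbrakk> \<Longrightarrow> h m n \<in> carrier G"
  by (auto simp: balanced_map_def dest: additive_map_closed)

lemma lift_ten:
  assumes "abelian_group G" "balanced_map R M rho N lam G h" "m \<in> carrier M" "n \<in> carrier N"
  shows "lift G h (ten m n) = h m n"
proof -
  interpret G: abelian_group G by fact
  show ?thesis
    using assms lift_cls[OF assms(1,2), of "[(m, n)]"] balanced_map_closed[OF assms(2)] by simp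
qed

lemma lift_additive:
  assumes "abelian_group G" "balanced_map R M rho N lam G h"
  shows "additive_map T G (lift G h)"
proof -
  interpret G: abelian_group G by fact
  have hl: "(case p of (m, n) \<Rightarrow> h m n) \<in> carrier G" if "set xs \<subseteq> pairs" "p \<in> set xs" for p xs
    using that balanced_map_closed[OF assms(2)] by auto
  show ?thesis
  proof (rule additive_mapI)
    fix X Y assume "X \<in> carrier T" "Y \<in> carrier T"
    then obtain xs ys where xy: "set xs \<subseteq> pairs" "X = cls xs" "set ys \<subseteq> pairs" "Y = cls ys"
      by (metis T_cases)
    then show "lift G h X \<in> carrier G"
      using hl by (auto simp: lift_cls[OF assms] intro!: G.lsum_closed balanced_map_closed[OF assms(2)])
    show "lift G h (X \<oplus>\<^bsub>T\<^esub> Y) = lift G h X \<oplus>\<^bsub>G\<^esub> lift G h Y"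
      using xy hl by (simp add: T_add lift_cls[OF assms]) (rule G.lsum_append, blast)
  qed
qed

text \<open>Every class is a sum of elementary tensors by \<open>cls_eq_lsum\<close>. Identities
  between operators on forms are proved in this way throughout.\<close>

lemma additive_map_ext:
  assumes "abelian_group G" "additive_map T G f" "additive_map T G g"
    and "\<And>m n. \<lbrakk>m \<in> carrier M; n \<in> carrier N\<rbrakk> \<Longrightarrow> f (ten m n) = g (ten m n)"
    and "X \<in> carrier T"
  shows "f X = g X"
proof -
  obtain xs where X: "set xs \<subseteq> pairs" "X = cls xs" using assms(5) by (metis T_cases)
  have c: "(case p of (m, n) \<Rightarrow> ten m n) \<in> carrier T" if "p \<in> set xs" for p
    using X that by (auto intro: ten_closed)
  have "f X = lsum G (\<lambda>p. f (case p of (m, n) \<Rightarrow> ten m n)) xs"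
    unfolding X(2) cls_eq_lsum[OF X(1)]
    by (rule additive_map_lsum[OF T.abelian_group_axioms assms(1,2) c])
  also have "\<dots> = lsum G (\<lambda>p. g (case p of (m, n) \<Rightarrow> ten m n)) xs"
    using X(1) assms(4) by (intro lsum_cong) auto
  also have "\<dots> = g X"
    unfolding X(2) cls_eq_lsum[OF X(1)]
    by (rule additive_map_lsum[OF T.abelian_group_axioms assms(1,3) c, symmetric])
  finally show ?thesis .
qed

end

locale module_tensor = balanced_tensor R M rho N lam + MM: module K M
  for K :: "('k, 'q) ring_scheme" and R :: "('r, 'i) ring_scheme"
    and M :: "('k, 'm, 'j) module_scheme" and rho and N :: "('s, 'n, 'l) module_scheme" and lam +
  assumes rho_smult: "\<lbrakk>k \<in> carrier K; m \<in> carrier M; r \<in> carrier R\<rbrakk> \<Longrightarrow>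
    rho (k \<odot>\<^bsub>M\<^esub> m) r = k \<odot>\<^bsub>M\<^esub> rho m r"
begin

lemma balanced_smult:
  assumes "k \<in> carrier K"
  shows "balanced_map R M rho N lam T (\<lambda>m n. ten (k \<odot>\<^bsub>M\<^esub> m) n)"
  using assms
  by (auto intro!: balanced_mapI additive_mapI
      simp: ten_closed ten_add_right ten_add_left MM.smult_r_distr rho_smult ten_balanced
      simp flip: rho_smult)

text \<open>In \<open>tensor\<close> a scalar acts on a chosen representative. Recognised as a lift,
  this action becomes additive and independent of the choice.\<close>

lemma smult_eq_lift:
  assumes "k \<in> carrier K" "X \<in> carrier T"
  shows "k \<odot>\<^bsub>T\<^esub> X = lift T (\<lambda>m n. ten (k \<odot>\<^bsub>M\<^esub> m) n) X"
proof -
  have "k \<odot>\<^bsub>T\<^esub> X = cls (map (\<lambda>(m, n). (k \<odot>\<^bsub>M\<^esub> m, n)) (rep X))"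
    by (simp add: tensor_def)
  also have "\<dots> = lsum T (\<lambda>(m, n). ten (k \<odot>\<^bsub>M\<^esub> m) n) (rep X)"
    using rep_pairs[OF assms(2)] assms(1)
    by (subst cls_eq_lsum) (auto intro!: lsum_cong MM.smult_closed)
  finally show ?thesis by (simp add: lift_def)
qed

lemma smult_ten:
  "\<lbrakk>k \<in> carrier K; m \<in> carrier M; n \<in> carrier N\<rbrakk> \<Longrightarrow> k \<odot>\<^bsub>T\<^esub> ten m n = ten (k \<odot>\<^bsub>M\<^esub> m) n"
  by (simp add: smult_eq_lift ten_closed lift_ten T.abelian_group_axioms balanced_smult)

lemma smult_additive: "k \<in> carrier K \<Longrightarrow> additive_map T T (\<lambda>X. k \<odot>\<^bsub>T\<^esub> X)"
  by (rule additive_map_cong[OF lift_additive[OF T.abelian_group_axioms balanced_smult]])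
    (auto simp: smult_eq_lift T.abelian_group_axioms)

lemma module_T: "module K T"
proof (rule moduleI)
  fix a b X Y assume ab: "a \<in> carrier K" "b \<in> carrier K" and X: "X \<in> carrier T"
  show "a \<odot>\<^bsub>T\<^esub> X \<in> carrier T" by (rule additive_map_closed[OF smult_additive[OF ab(1)] X])
  have sc: "c \<odot>\<^bsub>T\<^esub> Z \<in> carrier T" if "c \<in> carrier K" "Z \<in> carrier T" for c Z
    by (rule additive_map_closed[OF smult_additive[OF that(1)] that(2)])
  have sd: "c \<odot>\<^bsub>T\<^esub> (Z \<oplus>\<^bsub>T\<^esub> W) = c \<odot>\<^bsub>T\<^esub> Z \<oplus>\<^bsub>T\<^esub> c \<odot>\<^bsub>T\<^esub> W"
    if "c \<in> carrier K" "Z \<in> carrier T" "W \<in> carrier T" for c Z W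
    by (rule additive_map_add[OF smult_additive[OF that(1)] that(2,3)])
  show "a \<odot>\<^bsub>T\<^esub> (X \<oplus>\<^bsub>T\<^esub> Y) = a \<odot>\<^bsub>T\<^esub> X \<oplus>\<^bsub>T\<^esub> a \<odot>\<^bsub>T\<^esub> Y" if "Y \<in> carrier T"
    using ab X that by (simp add: sd)
  show "(a \<oplus>\<^bsub>K\<^esub> b) \<odot>\<^bsub>T\<^esub> X = a \<odot>\<^bsub>T\<^esub> X \<oplus>\<^bsub>T\<^esub> b \<odot>\<^bsub>T\<^esub> X"
  proof (rule additive_map_ext[OF T.abelian_group_axioms smult_additive _ _ X])
    show "additive_map T T (\<lambda>X. a \<odot>\<^bsub>T\<^esub> X \<oplus>\<^bsub>T\<^esub> b \<odot>\<^bsub>T\<^esub> X)"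
      using ab by (intro additive_mapI) (simp_all add: sc sd T.a_ac)
  qed (use ab in \<open>simp_all add: smult_ten MM.smult_l_distr ten_add_left\<close>)
  show "(a \<otimes>\<^bsub>K\<^esub> b) \<odot>\<^bsub>T\<^esub> X = a \<odot>\<^bsub>T\<^esub> (b \<odot>\<^bsub>T\<^esub> X)"
  proof (rule additive_map_ext[OF T.abelian_group_axioms smult_additive _ _ X])
    show "additive_map T T (\<lambda>X. a \<odot>\<^bsub>T\<^esub> (b \<odot>\<^bsub>T\<^esub> X))"
      by (rule additive_map_comp[OF smult_additive smult_additive]) (use ab in simp_all)
  qed (use ab in \<open>simp_all add: smult_ten MM.smult_assoc1\<close>)
next
  fix X assume X: "X \<in> carrier T"
  show "\<one>\<^bsub>K\<^esub> \<odot>\<^bsub>T\<^esub> X = X"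
    by (rule additive_map_ext[OF T.abelian_group_axioms smult_additive _ _ X])
      (auto simp: smult_ten intro!: additive_mapI)
qed (simp_all add: MM.R.is_cring T.abelian_group_axioms)

end

section \<open>Modules of differential forms\<close>

text \<open>Degrees stay in the forms \<open>1\<close>, \<open>2\<close> and \<open>m + 1\<close>,
  so that 1 + 1 simplifies to 2 and facts about different degrees match.\<close>

declare One_nat_def [simp del]

context exterior_algebra
begin

section \<open>Homogeneous components and the differential\<close>

lemma grade_0: "grade \<Omega> 0 = carrier A"
  using arg_cong[OF deg_0, of carrier] by (simp add: deg_def)

lemma deg_simps:
  "carrier (deg \<Omega> m) = grade \<Omega> m" "add (deg \<Omega> m) = add \<Omega>" "zero (deg \<Omega> m) = \<zero>"
  "smult (deg \<Omega> m) = smult \<Omega>"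
  by (simp_all add: deg_def)

lemma A_simps:
  "mult A = mult \<Omega>" "one A = \<one>" "add A = add \<Omega>" "zero A = \<zero>" "smult A = smult \<Omega>"
  by (simp_all add: deg_0[symmetric] deg_def)

lemma grade_carrier: "x \<in> grade \<Omega> m \<Longrightarrow> x \<in> carrier \<Omega>"
  using grade_submodule[of m] by (auto simp: submodule_def subgroup_def)

lemma grade_add: "\<lbrakk>x \<in> grade \<Omega> m; y \<in> grade \<Omega> m\<rbrakk> \<Longrightarrow> x \<oplus> y \<in> grade \<Omega> m"
  using grade_submodule[of m] by (auto simp: submodule_def subgroup_def)

lemma grade_zero: "\<zero> \<in> grade \<Omega> m"
  using grade_submodule[of m] by (auto simp: submodule_def subgroup_def)

lemma grade_minus: "x \<in> grade \<Omega> m \<Longrightarrow> \<ominus> x \<in> grade \<Omega> m"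
  using grade_submodule[of m] by (auto simp: submodule_def subgroup_def a_inv_def)

lemma grade_smult: "\<lbrakk>k \<in> carrier K; x \<in> grade \<Omega> m\<rbrakk> \<Longrightarrow> k \<odot>\<^bsub>\<Omega>\<^esub> x \<in> grade \<Omega> m"
  using grade_submodule[of m] by (auto simp: submodule_def submodule_axioms_def)

lemma grade_mult_0: "\<lbrakk>x \<in> grade \<Omega> m; a \<in> carrier A\<rbrakk> \<Longrightarrow> x \<otimes> a \<in> grade \<Omega> m"
  using mult_grade[of x m a 0] by (simp add: grade_0)

lemma grade_0_mult: "\<lbrakk>a \<in> carrier A; x \<in> grade \<Omega> m\<rbrakk> \<Longrightarrow> a \<otimes> x \<in> grade \<Omega> m"
  using mult_grade[of a 0 x m] by (simp add: grade_0)

lemma A_carrier: "a \<in> carrier A \<Longrightarrow> a \<in> carrier \<Omega>"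
  using grade_carrier[of a 0] by (simp add: grade_0)

lemma one_A: "\<one> \<in> carrier A"
  using one_grade by (simp add: grade_0)

lemma diff_A: "a \<in> carrier A \<Longrightarrow> diff \<Omega> a \<in> grade \<Omega> 1"
  using diff_grade[of a 0] by (simp add: grade_0)

lemma diff_add: "\<lbrakk>x \<in> carrier \<Omega>; y \<in> carrier \<Omega>\<rbrakk> \<Longrightarrow> diff \<Omega> (x \<oplus> y) = diff \<Omega> x \<oplus> diff \<Omega> y"
  using diff_linear by (simp add: mod_hom_def)

lemma diff_smult: "\<lbrakk>k \<in> carrier K; x \<in> carrier \<Omega>\<rbrakk> \<Longrightarrow> diff \<Omega> (k \<odot>\<^bsub>\<Omega>\<^esub> x) = k \<odot>\<^bsub>\<Omega>\<^esub> diff \<Omega> x"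
  using diff_linear by (simp add: mod_hom_def)

lemma diff_closed: "x \<in> carrier \<Omega> \<Longrightarrow> diff \<Omega> x \<in> carrier \<Omega>"
  using diff_linear by (auto simp: mod_hom_def)

lemma diff_mult_A:
  assumes "a \<in> carrier A" "x \<in> carrier \<Omega>"
  shows "diff \<Omega> (a \<otimes> x) = diff \<Omega> a \<otimes> x \<oplus> a \<otimes> diff \<Omega> x"
  using leibniz[of a 0 x] assms by (simp add: grade_0 A_carrier diff_closed)

text \<open>The Leibniz rule for 1 = 1 1 reads d1 = d1 + d1.\<close>

lemma diff_one: "diff \<Omega> \<one> = \<zero>"
  using diff_mult_A[OF one_A, of \<one>] diff_closed[of \<one>] by (simp add: add.l_cancel_one')

text \<open>The sign is the degree-zero element (-1)^m of the algebra. Sign and form together are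
  again a homogeneous form of the same degree, by which one can multiply from the left.\<close>

definition sgn_mult :: "nat \<Rightarrow> 'w \<Rightarrow> 'w"
  where "sgn_mult m w = (\<ominus> \<one>) [^] m \<otimes> w"

lemma sgn_pow_grade: "(\<ominus> \<one>) [^] (m :: nat) \<in> carrier A"
proof (induction m)
  case (Suc m)
  then show ?case using grade_0_mult[of "(\<ominus> \<one>) [^] m" "\<ominus> \<one>" 0] grade_minus[of \<one> 0] one_grade
    by (simp add: grade_0)
qed (simp add: one_A)

lemma sgn_mult_grade: "w \<in> grade \<Omega> p \<Longrightarrow> sgn_mult m w \<in> grade \<Omega> p"
  by (simp add: sgn_mult_def grade_0_mult sgn_pow_grade)

text \<open>With the sign moved onto the left factor, the second term is left multiplication by a
  single form, the shape in which the Spencer operator is written below.\<close>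

lemma diff_mult:
  assumes "w \<in> grade \<Omega> m" "a \<in> carrier \<Omega>"
  shows "diff \<Omega> (w \<otimes> a) = diff \<Omega> w \<otimes> a \<oplus> sgn_mult m w \<otimes> diff \<Omega> a"
  using leibniz[OF assms] assms
  by (simp add: sgn_mult_def m_assoc A_carrier sgn_pow_grade grade_carrier diff_closed)

lemma deg_abelian_group: "abelian_group (deg \<Omega> m)"
  by (rule abelian_groupI)
    (auto simp: deg_simps grade_add grade_zero grade_carrier a_ac r_neg intro!: bexI[OF _ grade_minus])

lemma deg_module: "module K (deg \<Omega> m)"
  by (rule moduleI)
    (auto simp: deg_simps deg_abelian_group grade_smult grade_carrier smult_l_distr smult_r_distr
      smult_assoc1 R.is_cring)

section \<open>Elementary tensors of forms with values in a module\<close>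

abbreviation "OM m E \<equiv> Omod \<Omega> m E"
abbreviation "ot m E w e \<equiv> Oclass \<Omega> m E [(w, e)]"
abbreviation "bal m E \<equiv> balanced_map (deg \<Omega> 0) (deg \<Omega> m) (mult \<Omega>) E (smult E)"

text \<open>The wedge product is \<open>K\<close>-linear in its left factor, so right multiplication
  by \<open>A\<close> respects scalars and the general construction applies. The lemmas that follow
  restate it for \<open>Omod\<close> and \<open>Oclass\<close>.\<close>

lemma O_tensor:
  assumes "left_module A E"
  shows "module_tensor K (deg \<Omega> 0) (deg \<Omega> m) (mult \<Omega>) E (smult E)"
proof -
  interpret E: left_module A E by fact
  interpret D: module K "deg \<Omega> m" by (rule deg_module)
  show ?thesis
    by unfold_locales
      (auto simp: deg_simps grade_0 grade_mult_0 E.lsmult_closed smult_mult_left grade_carrier A_carrier)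
qed

context
  fixes E :: "('w, 'x) module"
  assumes E: "left_module A E"
begin

interpretation E: left_module A E by (rule E)

lemma O_abelian_group: "abelian_group (OM m E)"
proof -
  interpret module_tensor K "deg \<Omega> 0" "deg \<Omega> m" "mult \<Omega>" E "smult E" by (rule O_tensor[OF E])
  show ?thesis unfolding Omod_def by (rule T.abelian_group_axioms)
qed

lemma O_module: "module K (OM m E)"
proof -
  interpret module_tensor K "deg \<Omega> 0" "deg \<Omega> m" "mult \<Omega>" E "smult E" by (rule O_tensor[OF E])
  show ?thesis unfolding Omod_def by (rule module_T)
qed

lemma ot_closed: "\<lbrakk>w \<in> grade \<Omega> m; e \<in> carrier E\<rbrakk> \<Longrightarrow> ot m E w e \<in> carrier (OM m E)"
proof -
  interpret module_tensor K "deg \<Omega> 0" "deg \<Omega> m" "mult \<Omega>" E "smult E" by (rule O_tensor[OF E])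
  show "\<lbrakk>w \<in> grade \<Omega> m; e \<in> carrier E\<rbrakk> \<Longrightarrow> ot m E w e \<in> carrier (OM m E)"
    unfolding Omod_def Oclass_def using ten_closed by (simp add: deg_simps)
qed

lemma ot_add_left:
  "\<lbrakk>w \<in> grade \<Omega> m; w' \<in> grade \<Omega> m; e \<in> carrier E\<rbrakk> \<Longrightarrow>
    ot m E (w \<oplus> w') e = ot m E w e \<oplus>\<^bsub>OM m E\<^esub> ot m E w' e"
proof -
  interpret module_tensor K "deg \<Omega> 0" "deg \<Omega> m" "mult \<Omega>" E "smult E" by (rule O_tensor[OF E])
  assume "w \<in> grade \<Omega> m" "w' \<in> grade \<Omega> m" "e \<in> carrier E"
  then show ?thesis
    unfolding Omod_def Oclass_def using ten_add_left by (simp add: deg_simps)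
qed

lemma ot_add_right:
  "\<lbrakk>w \<in> grade \<Omega> m; e \<in> carrier E; e' \<in> carrier E\<rbrakk> \<Longrightarrow>
    ot m E w (e \<oplus>\<^bsub>E\<^esub> e') = ot m E w e \<oplus>\<^bsub>OM m E\<^esub> ot m E w e'"
proof -
  interpret module_tensor K "deg \<Omega> 0" "deg \<Omega> m" "mult \<Omega>" E "smult E" by (rule O_tensor[OF E])
  assume "w \<in> grade \<Omega> m" "e \<in> carrier E" "e' \<in> carrier E"
  then show ?thesis
    unfolding Omod_def Oclass_def using ten_add_right by (simp add: deg_simps)
qed

lemma ot_balanced:
  "\<lbrakk>w \<in> grade \<Omega> m; a \<in> carrier A; e \<in> carrier E\<rbrakk> \<Longrightarrow> ot m E (w \<otimes> a) e = ot m E w (a \<odot>\<^bsub>E\<^esub> e)"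
proof -
  interpret module_tensor K "deg \<Omega> 0" "deg \<Omega> m" "mult \<Omega>" E "smult E" by (rule O_tensor[OF E])
  assume "w \<in> grade \<Omega> m" "a \<in> carrier A" "e \<in> carrier E"
  then show ?thesis
    unfolding Oclass_def using ten_balanced by (simp add: deg_simps grade_0)
qed

lemma ot_smult:
  "\<lbrakk>k \<in> carrier K; w \<in> grade \<Omega> m; e \<in> carrier E\<rbrakk> \<Longrightarrow>
    k \<odot>\<^bsub>OM m E\<^esub> ot m E w e = ot m E (k \<odot>\<^bsub>\<Omega>\<^esub> w) e"
proof -
  interpret module_tensor K "deg \<Omega> 0" "deg \<Omega> m" "mult \<Omega>" E "smult E" by (rule O_tensor[OF E])
  assume "k \<in> carrier K" "w \<in> grade \<Omega> m" "e \<in> carrier E"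
  then show ?thesis
    unfolding Omod_def Oclass_def using smult_ten by (simp add: deg_simps)
qed

lemma Oclass_eq_lsum:
  assumes "set xs \<subseteq> grade \<Omega> m \<times> carrier E"
  shows "Oclass \<Omega> m E xs = lsum (OM m E) (\<lambda>(w, e). ot m E w e) xs"
proof -
  interpret module_tensor K "deg \<Omega> 0" "deg \<Omega> m" "mult \<Omega>" E "smult E" by (rule O_tensor[OF E])
  show ?thesis unfolding Omod_def Oclass_def using cls_eq_lsum assms by (simp add: deg_simps)
qed

lemma O_rep:
  assumes "X \<in> carrier (OM m E)"
  shows "set (rep X) \<subseteq> grade \<Omega> m \<times> carrier E"
proof -
  interpret module_tensor K "deg \<Omega> 0" "deg \<Omega> m" "mult \<Omega>" E "smult E" by (rule O_tensor[OF E])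
  show ?thesis using rep_pairs assms by (simp add: Omod_def deg_simps)
qed

lemma O_smult_additive:
  assumes "k \<in> carrier K"
  shows "additive_map (OM m E) (OM m E) (\<lambda>X. k \<odot>\<^bsub>OM m E\<^esub> X)"
proof -
  interpret module K "OM m E" by (rule O_module)
  show ?thesis by (rule additive_mapI) (use assms in \<open>auto simp: smult_r_distr\<close>)
qed

lemma O_ext:
  assumes "abelian_group G" "additive_map (OM m E) G f" "additive_map (OM m E) G g"
    and "\<And>w e. \<lbrakk>w \<in> grade \<Omega> m; e \<in> carrier E\<rbrakk> \<Longrightarrow> f (ot m E w e) = g (ot m E w e)"
    and "X \<in> carrier (OM m E)"
  shows "f X = g X"
proof -
  interpret module_tensor K "deg \<Omega> 0" "deg \<Omega> m" "mult \<Omega>" E "smult E" by (rule O_tensor[OF E])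
  show ?thesis
    using additive_map_ext[of G f g X] assms unfolding Omod_def Oclass_def by (simp add: deg_simps)
qed

lemma balI:
  assumes "\<And>w e. \<lbrakk>w \<in> grade \<Omega> m; e \<in> carrier E\<rbrakk> \<Longrightarrow> h w e \<in> carrier G"
    and "\<And>w e e'. \<lbrakk>w \<in> grade \<Omega> m; e \<in> carrier E; e' \<in> carrier E\<rbrakk> \<Longrightarrow>
      h w (e \<oplus>\<^bsub>E\<^esub> e') = h w e \<oplus>\<^bsub>G\<^esub> h w e'"
    and "\<And>w w' e. \<lbrakk>w \<in> grade \<Omega> m; w' \<in> grade \<Omega> m; e \<in> carrier E\<rbrakk> \<Longrightarrow>
      h (w \<oplus> w') e = h w e \<oplus>\<^bsub>G\<^esub> h w' e"
    and "\<And>w a e. \<lbrakk>w \<in> grade \<Omega> m; a \<in> carrier A; e \<in> carrier E\<rbrakk> \<Longrightarrow>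
      h (w \<otimes> a) e = h w (a \<odot>\<^bsub>E\<^esub> e)"
  shows "bal m E G h"
  using assms by (auto intro!: balanced_mapI additive_mapI simp: deg_simps grade_0)

text \<open>\<open>Omap\<close>, \<open>lmul\<close> and \<open>Spencer1\<close> are all sums over
  the chosen \<open>rep X\<close>. Once the summand is known to be balanced, additivity and the
  value on elementary tensors come together from here.\<close>

lemma
  assumes "abelian_group G" "bal m E G h"
  shows rep_additive: "additive_map (OM m E) G (\<lambda>X. lsum G (\<lambda>(w, e). h w e) (rep X))"
    and rep_ot: "\<lbrakk>w \<in> grade \<Omega> m; e \<in> carrier E\<rbrakk> \<Longrightarrow>
      lsum G (\<lambda>(w, e). h w e) (rep (ot m E w e)) = h w e"
proof -
  interpret module_tensor K "deg \<Omega> 0" "deg \<Omega> m" "mult \<Omega>" E "smult E" by (rule O_tensor[OF E])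
  show "additive_map (OM m E) G (\<lambda>X. lsum G (\<lambda>(w, e). h w e) (rep X))"
    using lift_additive[OF assms] unfolding Omod_def lift_def[abs_def] .
  show "\<lbrakk>w \<in> grade \<Omega> m; e \<in> carrier E\<rbrakk> \<Longrightarrow> lsum G (\<lambda>(w, e). h w e) (rep (ot m E w e)) = h w e"
    using lift_ten[OF assms] by (simp add: deg_simps Oclass_def lift_def)
qed

end

section \<open>Functoriality of forms with values in a module, and left multiplication by
  forms\<close>

lemma bal_ot_map:
  fixes E :: "('w, 'x) module" and F :: "('w, 'y) module"
  assumes "left_module A E" "left_module A F" "f \<in> mod_hom A E F"
  shows "bal m E (OM m F) (\<lambda>w e. ot m F w (f e))"
proof -
  note fc = additive_map_closed[OF mod_hom_additive[OF assms(3)]]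
  note fa = additive_map_add[OF mod_hom_additive[OF assms(3)]]
  show ?thesis
    by (rule balI[OF assms(1)])
      (simp_all add: assms fc fa ot_closed ot_add_left ot_add_right ot_balanced mod_hom_smult[OF assms(3)])
qed

lemma Omap_eq:
  assumes "left_module A E" "left_module A F" "f \<in> mod_hom A E F" "X \<in> carrier (OM m E)"
  shows "Omap \<Omega> m F f X = lsum (OM m F) (\<lambda>(w, e). ot m F w (f e)) (rep X)"
proof -
  have "Omap \<Omega> m F f X = Oclass \<Omega> m F (map (\<lambda>(w, e). (w, f e)) (rep X))"
    by (simp add: Omap_def tensor_map_def Oclass_def)
  also have "\<dots> = lsum (OM m F) (\<lambda>(w, e). ot m F w (f e)) (rep X)"
    using O_rep[OF assms(1,4)] additive_map_closed[OF mod_hom_additive[OF assms(3)]]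
    by (subst Oclass_eq_lsum[OF assms(2)]) (auto intro!: lsum_cong)
  finally show ?thesis .
qed

lemma Omap_ot:
  assumes "left_module A E" "left_module A F" "f \<in> mod_hom A E F" "w \<in> grade \<Omega> m" "e \<in> carrier E"
  shows "Omap \<Omega> m F f (ot m E w e) = ot m F w (f e)"
  using rep_ot[OF assms(1) O_abelian_group[OF assms(2)] bal_ot_map[OF assms(1-3)] assms(4,5)]
  by (simp add: Omap_eq[OF assms(1-3)] ot_closed assms)

lemma Omap_additive:
  assumes "left_module A E" "left_module A F" "f \<in> mod_hom A E F"
  shows "additive_map (OM m E) (OM m F) (Omap \<Omega> m F f)"
  by (rule additive_map_cong[OF rep_additive[OF assms(1) O_abelian_group[OF assms(2)] bal_ot_map[OF assms]]])
    (simp_all add: Omap_eq[OF assms] O_abelian_group assms)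

lemmas Omap_closed = additive_map_closed[OF Omap_additive]

lemma Omap_mod_hom:
  assumes "left_module A E" "left_module A F" "f \<in> mod_hom A E F"
  shows "Omap \<Omega> m F f \<in> mod_hom K (OM m E) (OM m F)"
proof (rule mod_homI[OF Omap_additive[OF assms]])
  fix k X assume k: "k \<in> carrier K" and X: "X \<in> carrier (OM m E)"
  note fc = additive_map_closed[OF mod_hom_additive[OF assms(3)]]
  show "Omap \<Omega> m F f (k \<odot>\<^bsub>OM m E\<^esub> X) = k \<odot>\<^bsub>OM m F\<^esub> Omap \<Omega> m F f X"
    by (rule O_ext[OF assms(1) O_abelian_group[OF assms(2)]
          additive_map_comp[OF O_smult_additive[OF assms(1) k] Omap_additive[OF assms]]
          additive_map_comp[OF Omap_additive[OF assms] O_smult_additive[OF assms(2) k]] _ X])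
      (simp add: k assms fc Omap_ot[OF assms] ot_smult grade_smult)
qed

lemma Omap_comp:
  assumes "left_module A E" "left_module A F" "left_module A G" "f \<in> mod_hom A E F" "g \<in> mod_hom A F G"
    "X \<in> carrier (OM m E)"
  shows "Omap \<Omega> m G g (Omap \<Omega> m F f X) = Omap \<Omega> m G (\<lambda>e. g (f e)) X"
proof -
  note fc = additive_map_closed[OF mod_hom_additive[OF assms(4)]]
  note gf = mod_hom_comp[OF assms(4,5)]
  show ?thesis
    by (rule O_ext[OF assms(1) O_abelian_group[OF assms(3)]
          additive_map_comp[OF Omap_additive[OF assms(1,2,4)] Omap_additive[OF assms(2,3,5)]]
          Omap_additive[OF assms(1,3) gf] _ assms(6)])
      (simp add: fc Omap_ot[OF assms(1,2,4)] Omap_ot[OF assms(2,3,5)] Omap_ot[OF assms(1,3) gf])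
qed

lemma Omap_cong:
  assumes "left_module A E" "X \<in> carrier (OM m E)" "\<And>e. e \<in> carrier E \<Longrightarrow> f e = g e"
  shows "Omap \<Omega> m F f X = Omap \<Omega> m F g X"
proof -
  have "map (\<lambda>(w, e). (w, f e)) (rep X) = map (\<lambda>(w, e). (w, g e)) (rep X)"
    using O_rep[OF assms(1,2)] assms(3) by auto
  then show ?thesis unfolding Omap_def tensor_map_def by (rule arg_cong)
qed

lemma Omap_id:
  assumes "left_module A E" "X \<in> carrier (OM m E)"
  shows "Omap \<Omega> m E (\<lambda>e. e) X = X"
proof -
  have id: "(\<lambda>e. e) \<in> mod_hom A E E" by (simp add: mod_hom_def)
  show ?thesis
    by (rule O_ext[OF assms(1) O_abelian_group[OF assms(1)] Omap_additive[OF assms(1) assms(1) id] _ _ assms(2)])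
      (auto simp: Omap_ot[OF assms(1) assms(1) id] intro!: additive_mapI)
qed

text \<open>\<open>Omod\<close> records only scalars from \<open>K\<close>; this supplies left
  multiplication by a homogeneous form, and for forms of degree 0 the left \<open>A\<close>-action.
  The index \<open>q\<close> is the degree of the product. The lemmas link degrees by an equation
  \<open>q = p + r\<close>, so that 1 + 1 can be read as 2.\<close>

definition lmul :: "nat \<Rightarrow> ('w, 'x) module \<Rightarrow> 'w \<Rightarrow> ('w \<times> 'x) list set \<Rightarrow> ('w \<times> 'x) list set"
  where "lmul q E v X = lsum (OM q E) (\<lambda>(w, e). ot q E (v \<otimes> w) e) (rep X)"

context
  fixes E :: "('w, 'x) module" and p q r :: nat
  assumes E: "left_module A E" and q: "q = p + r"
begin

interpretation E: left_module A E by (rule E)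

lemma grade_mult_r: "\<lbrakk>v \<in> grade \<Omega> p; w \<in> grade \<Omega> r\<rbrakk> \<Longrightarrow> v \<otimes> w \<in> grade \<Omega> q"
  unfolding q by (rule mult_grade)

lemma bal_lmul:
  assumes "v \<in> grade \<Omega> p"
  shows "bal r E (OM q E) (\<lambda>w e. ot q E (v \<otimes> w) e)"
  by (rule balI[OF E])
    (simp_all add: assms grade_mult_r ot_closed[OF E] ot_add_left[OF E] ot_add_right[OF E] r_distr
      ot_balanced[OF E] grade_carrier[OF assms] grade_carrier A_carrier flip: m_assoc)

lemma lmul_ot:
  "\<lbrakk>v \<in> grade \<Omega> p; w \<in> grade \<Omega> r; e \<in> carrier E\<rbrakk> \<Longrightarrow> lmul q E v (ot r E w e) = ot q E (v \<otimes> w) e"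
  unfolding lmul_def by (rule rep_ot[OF E O_abelian_group[OF E] bal_lmul])

lemma lmul_additive: "v \<in> grade \<Omega> p \<Longrightarrow> additive_map (OM r E) (OM q E) (lmul q E v)"
  unfolding lmul_def by (rule rep_additive[OF E O_abelian_group[OF E] bal_lmul])

lemma lmul_closed: "\<lbrakk>v \<in> grade \<Omega> p; X \<in> carrier (OM r E)\<rbrakk> \<Longrightarrow> lmul q E v X \<in> carrier (OM q E)"
  by (rule additive_map_closed[OF lmul_additive])

lemma lmul_add_right:
  "\<lbrakk>v \<in> grade \<Omega> p; X \<in> carrier (OM r E); Y \<in> carrier (OM r E)\<rbrakk> \<Longrightarrow>
    lmul q E v (X \<oplus>\<^bsub>OM r E\<^esub> Y) = lmul q E v X \<oplus>\<^bsub>OM q E\<^esub> lmul q E v Y"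
  by (rule additive_map_add[OF lmul_additive])

lemma lmul_add_left:
  assumes "v \<in> grade \<Omega> p" "v' \<in> grade \<Omega> p" "X \<in> carrier (OM r E)"
  shows "lmul q E (v \<oplus> v') X = lmul q E v X \<oplus>\<^bsub>OM q E\<^esub> lmul q E v' X"
proof -
  interpret O: abelian_group "OM q E" by (rule O_abelian_group[OF E])
  show ?thesis
  proof (rule O_ext[OF E O_abelian_group[OF E] lmul_additive _ _ assms(3)])
    show "additive_map (OM r E) (OM q E) (\<lambda>X. lmul q E v X \<oplus>\<^bsub>OM q E\<^esub> lmul q E v' X)"
      using assms by (intro additive_mapI) (simp_all add: lmul_closed lmul_add_right O.a_ac)
  qed (use assms in \<open>simp_all add: grade_add lmul_ot l_distr grade_carrier grade_mult_r ot_add_left[OF E]\<close>)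
qed

lemma lmul_smult:
  assumes "k \<in> carrier K" "v \<in> grade \<Omega> p" "X \<in> carrier (OM r E)"
  shows "lmul q E (k \<odot>\<^bsub>\<Omega>\<^esub> v) X = k \<odot>\<^bsub>OM q E\<^esub> lmul q E v X"
  by (rule O_ext[OF E O_abelian_group[OF E] lmul_additive
        additive_map_comp[OF lmul_additive O_smult_additive[OF E]] _ assms(3)])
    (use assms in \<open>simp_all add: grade_smult lmul_ot ot_smult[OF E] grade_mult_r smult_mult_left grade_carrier\<close>)

end

lemma lmul_0: 
  assumes "left_module A E" "a \<in> carrier A"
  shows "X \<in> carrier (OM r E) \<Longrightarrow> lmul r E a X \<in> carrier (OM r E)"
    and "additive_map (OM r E) (OM r E) (lmul r E a)"
    and "\<lbrakk>w \<in> grade \<Omega> r; e \<in> carrier E\<rbrakk> \<Longrightarrow> lmul r E a (ot r E w e) = ot r E (a \<otimes> w) e"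
  using lmul_closed[of E r 0 r a X] lmul_additive[of E r 0 r a] lmul_ot[of E r 0 r a w e] assms
  by (simp_all add: grade_0)

lemma lmul_mult:
  assumes "left_module A E" "v \<in> grade \<Omega> p" "a \<in> carrier A" "X \<in> carrier (OM r E)" "q = p + r"
  shows "lmul q E (v \<otimes> a) X = lmul q E v (lmul r E a X)"
  by (rule O_ext[OF assms(1) O_abelian_group[OF assms(1)] lmul_additive[OF assms(1,5) grade_mult_0[OF assms(2,3)]]
        additive_map_comp[OF lmul_0(2)[OF assms(1,3)] lmul_additive[OF assms(1,5,2)]] _ assms(4)])
    (use assms in \<open>simp add: lmul_ot[where p = p] grade_mult_0 lmul_0 grade_0_mult m_assoc grade_carrier A_carrier\<close>)

lemma lmul_one:
  assumes "left_module A E" "X \<in> carrier (OM r E)"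
  shows "lmul r E \<one> X = X"
  by (rule O_ext[OF assms(1) O_abelian_group[OF assms(1)] lmul_0(2)[OF assms(1) one_A] _ _ assms(2)])
    (auto simp: lmul_0[OF assms(1) one_A] grade_carrier intro!: additive_mapI)

lemma Omap_lmul:
  assumes "left_module A E" "left_module A F" "f \<in> mod_hom A E F"
    and "v \<in> grade \<Omega> p" "X \<in> carrier (OM r E)" "q = p + r"
  shows "Omap \<Omega> q F f (lmul q E v X) = lmul q F v (Omap \<Omega> r F f X)"
  by (rule O_ext[OF assms(1) O_abelian_group[OF assms(2)]
        additive_map_comp[OF lmul_additive[OF assms(1,6,4)] Omap_additive[OF assms(1-3)]]
        additive_map_comp[OF Omap_additive[OF assms(1-3)] lmul_additive[OF assms(2,6,4)]] _ assms(5)])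
    (use assms grade_mult_r[OF assms(1,6)] in \<open>simp add: lmul_ot[where p = p] Omap_ot[OF assms(1-3)]
       additive_map_closed[OF mod_hom_additive[OF assms(3)]]\<close>)

end

section \<open>First jets\<close>

lemma (in abelian_group) minus_eq_zero_iff:
  assumes "x \<in> carrier G" "y \<in> carrier G"
  shows "x \<ominus> y = \<zero> \<longleftrightarrow> x = y"
  using assms minus_equality[of x "\<ominus> y"] by (auto simp: a_minus_def r_neg)

context exterior_algebra
begin

lemma left_module_zero:
  assumes "left_module A E"
  shows "e \<in> carrier E \<Longrightarrow> \<zero> \<odot>\<^bsub>E\<^esub> e = \<zero>\<^bsub>E\<^esub>" and "a \<in> carrier A \<Longrightarrow> a \<odot>\<^bsub>E\<^esub> \<zero>\<^bsub>E\<^esub> = \<zero>\<^bsub>E\<^esub>"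
proof -
  interpret E: left_module A E by fact
  show "\<zero> \<odot>\<^bsub>E\<^esub> e = \<zero>\<^bsub>E\<^esub>" if "e \<in> carrier E"
  proof -
    have "additive_map A E (\<lambda>a. a \<odot>\<^bsub>E\<^esub> e)"
      using that by (intro additive_mapI) (simp_all add: E.lsmult_closed E.lsmult_l_distr)
    from additive_map_zero[OF A.abelian_group_axioms E.E.abelian_group_axioms this]
    show ?thesis by (simp add: A_simps)
  qed
  show "a \<odot>\<^bsub>E\<^esub> \<zero>\<^bsub>E\<^esub> = \<zero>\<^bsub>E\<^esub>" if "a \<in> carrier A"
  proof -
    have "additive_map E E (\<lambda>e. a \<odot>\<^bsub>E\<^esub> e)"
      using that by (intro additive_mapI) (simp_all add: E.lsmult_closed E.lsmult_r_distr)
    from additive_map_zero[OF E.E.abelian_group_axioms E.E.abelian_group_axioms this]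
    show ?thesis .
  qed
qed

lemma A_smult_one: "k \<in> carrier K \<Longrightarrow> k \<odot>\<^bsub>\<Omega>\<^esub> \<one> \<in> carrier A"
  using grade_smult[OF _ one_grade] by (simp add: grade_0)

lemma mult_smult_one: "\<lbrakk>k \<in> carrier K; x \<in> carrier \<Omega>\<rbrakk> \<Longrightarrow> x \<otimes> (k \<odot>\<^bsub>\<Omega>\<^esub> \<one>) = k \<odot>\<^bsub>\<Omega>\<^esub> x"
  by (simp add: smult_mult_right)

lemma smult_one_mult: "\<lbrakk>k \<in> carrier K; x \<in> carrier \<Omega>\<rbrakk> \<Longrightarrow> (k \<odot>\<^bsub>\<Omega>\<^esub> \<one>) \<otimes> x = k \<odot>\<^bsub>\<Omega>\<^esub> x"
  by (simp add: smult_mult_left)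

lemma module_restrict_scalars:
  assumes "left_module A E"
  shows "module K (restrict_scalars A E)"
proof -
  interpret E: left_module A E by fact
  have "abelian_group (restrict_scalars A E)"
    by (rule abelian_groupI)
      (auto simp: restrict_scalars_def E.E.a_ac E.E.r_neg intro!: bexI[OF _ E.E.a_inv_closed])
  then show ?thesis
    by (intro moduleI)
      (auto simp: restrict_scalars_def A_simps A_smult_one E.lsmult_closed E.lsmult_r_distr
        E.lsmult_one[simplified A_simps] E.lsmult_l_distr[simplified A_simps] smult_l_distr smult_assoc1 R.is_cring
        smult_one_mult simp flip: E.lsmult_assoc[simplified A_simps])
qed

lemma lmul_zero:
  assumes "left_module A E" "X \<in> carrier (OM r E)" "q = p + r"
  shows "lmul q E \<zero> X = \<zero>\<^bsub>OM q E\<^esub>"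
proof -
  have "additive_map (deg \<Omega> p) (OM q E) (\<lambda>v. lmul q E v X)"
    by (rule additive_mapI)
      (simp_all add: deg_simps lmul_closed[OF assms(1,3)] lmul_add_left[OF assms(1,3)] assms(2))
  from additive_map_zero[OF deg_abelian_group O_abelian_group[OF assms(1)] this]
  show ?thesis by (simp add: deg_simps)
qed

lemma ot_zero:
  assumes "left_module A E" "e \<in> carrier E"
  shows "ot m E \<zero> e = \<zero>\<^bsub>OM m E\<^esub>"
proof -
  have "additive_map (deg \<Omega> m) (OM m E) (\<lambda>w. ot m E w e)"
    by (rule additive_mapI) (simp_all add: deg_simps assms ot_closed ot_add_left)
  from additive_map_zero[OF deg_abelian_group O_abelian_group[OF assms(1)] this]
  show ?thesis by (simp add: deg_simps)
qed

section \<open>Value and derivative of formal sums and of jets\<close>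

definition sum_val :: "('w, 'x) module \<Rightarrow> ('w \<times> 'x) list \<Rightarrow> 'x"
  where "sum_val E = lsum E (\<lambda>(a, e). a \<odot>\<^bsub>E\<^esub> e)"

definition sum_der :: "('w, 'x) module \<Rightarrow> ('w \<times> 'x) list \<Rightarrow> ('w \<times> 'x) list set"
  where "sum_der E = lsum (OM 1 E) (\<lambda>(a, e). ot 1 E (diff \<Omega> a) e)"

text \<open>Read off from the stored formal sum; by \<open>J1_class_props\<close> the result is the
  one given by any formal sum defining the same jet.\<close>

definition jet_val :: "('w, ('w, 'e) jet) module \<Rightarrow> ('w, 'e) jet \<Rightarrow> ('w, 'e) jet"
  where "jet_val E x = sum_val E (summands x)"

definition jet_der ::
    "('w, ('w, 'e) jet) module \<Rightarrow> ('w, 'e) jet \<Rightarrow> ('w \<times> ('w, 'e) jet) list set"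
  where "jet_der E x = sum_der E (summands x)"

context
  fixes E :: "('w, 'x) module"
  assumes E: "left_module A E"
begin

interpretation E: left_module A E by (rule E)
interpretation O: abelian_group "OM 1 E" by (rule O_abelian_group[OF E])

lemma sum_val_Cons: "sum_val E ((a, e) # xs) = a \<odot>\<^bsub>E\<^esub> e \<oplus>\<^bsub>E\<^esub> sum_val E xs"
  by (simp add: sum_val_def)

lemma sum_der_Cons: "sum_der E ((a, e) # xs) = ot 1 E (diff \<Omega> a) e \<oplus>\<^bsub>OM 1 E\<^esub> sum_der E xs"
  by (simp add: sum_der_def)

lemma sum_val_append:
  assumes "set xs \<subseteq> carrier A \<times> carrier E" "set ys \<subseteq> carrier A \<times> carrier E"
  shows "sum_val E (xs @ ys) = sum_val E xs \<oplus>\<^bsub>E\<^esub> sum_val E ys"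
  unfolding sum_val_def
  by (rule E.E.lsum_append) (use assms in \<open>auto intro!: E.lsmult_closed\<close>)

lemma sum_der_append:
  assumes "set xs \<subseteq> carrier A \<times> carrier E" "set ys \<subseteq> carrier A \<times> carrier E"
  shows "sum_der E (xs @ ys) = sum_der E xs \<oplus>\<^bsub>OM 1 E\<^esub> sum_der E ys"
  unfolding sum_der_def
  by (rule O.lsum_append) (use assms in \<open>auto intro!: ot_closed[OF E] diff_A\<close>)

lemma sum_val_closed: "set xs \<subseteq> carrier A \<times> carrier E \<Longrightarrow> sum_val E xs \<in> carrier E"
  unfolding sum_val_def by (rule E.E.lsum_closed) (auto intro!: E.lsmult_closed)

lemma sum_der_closed: "set xs \<subseteq> carrier A \<times> carrier E \<Longrightarrow> sum_der E xs \<in> carrier (OM 1 E)"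
  unfolding sum_der_def by (rule O.lsum_closed) (auto intro!: ot_closed[OF E] diff_A)

lemma sum_val_mult:
  assumes "a \<in> carrier A" "set xs \<subseteq> carrier A \<times> carrier E"
  shows "sum_val E (map (\<lambda>(b, e). (a \<otimes> b, e)) xs) = a \<odot>\<^bsub>E\<^esub> sum_val E xs"
  using assms(2)
proof (induction xs)
  case Nil
  then show ?case by (simp add: sum_val_def left_module_zero[OF E] assms(1))
next
  case (Cons p xs)
  obtain b e where p: "p = (b, e)" "b \<in> carrier A" "e \<in> carrier E" using Cons.prems by auto
  show ?case
    using Cons p sum_val_closed[of xs] E.lsmult_assoc[of a b e] E.lsmult_r_distr[of a "b \<odot>\<^bsub>E\<^esub> e" "sum_val E xs"]
    by (simp add: sum_val_def assms(1) A_simps E.lsmult_closed)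
qed

text \<open>Split d(a b) as da b + a db. In the first part b crosses the tensor sign and the
  summands collect to the value. This produces the twist in the action of \<open>A\<close> on
  jets.\<close>

lemma sum_der_mult:
  assumes "a \<in> carrier A" "set xs \<subseteq> carrier A \<times> carrier E"
  shows "sum_der E (map (\<lambda>(b, e). (a \<otimes> b, e)) xs) =
    ot 1 E (diff \<Omega> a) (sum_val E xs) \<oplus>\<^bsub>OM 1 E\<^esub> lmul 1 E a (sum_der E xs)"
  using assms(2)
proof (induction xs)
  case Nil
  \<comment> \<open>The zero of \<open>E\<close> is 0 times itself, and this scalar 0 is moved
    across to da.\<close>
  have "ot 1 E (diff \<Omega> a) \<zero>\<^bsub>E\<^esub> = ot 1 E (diff \<Omega> a \<otimes> \<zero>) \<zero>\<^bsub>E\<^esub>"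
    using ot_balanced[OF E, of "diff \<Omega> a" 1 \<zero> "\<zero>\<^bsub>E\<^esub>"] grade_zero[of 0]
    by (simp add: diff_A assms(1) grade_0 left_module_zero[OF E])
  moreover have "lmul 1 E a \<zero>\<^bsub>OM 1 E\<^esub> = \<zero>\<^bsub>OM 1 E\<^esub>"
    by (rule additive_map_zero[OF O.abelian_group_axioms O.abelian_group_axioms lmul_0(2)[where r = 1, OF E assms(1)]])
  ultimately show ?case
    by (simp add: sum_der_def sum_val_def ot_zero[OF E] assms(1) diff_closed A_carrier)
next
  case (Cons p xs)
  obtain b e where p: "p = (b, e)" "b \<in> carrier A" "e \<in> carrier E" using Cons.prems by auto
  have xs: "set xs \<subseteq> carrier A \<times> carrier E" using Cons.prems by simp
  note [simp] = assms(1) p diff_A E.lsmult_closed sum_val_closed[OF xs] sum_der_closed[OF xs]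
    lmul_0[OF E assms(1)] ot_closed[OF E] grade_mult_0 grade_0_mult
  have "ot 1 E (diff \<Omega> (a \<otimes> b)) e = ot 1 E (diff \<Omega> a) (b \<odot>\<^bsub>E\<^esub> e) \<oplus>\<^bsub>OM 1 E\<^esub> lmul 1 E a (ot 1 E (diff \<Omega> b) e)"
    by (simp add: diff_mult_A A_carrier ot_add_left[OF E] ot_balanced[OF E])
  moreover have "lmul 1 E a (sum_der E (p # xs)) =
      lmul 1 E a (ot 1 E (diff \<Omega> b) e) \<oplus>\<^bsub>OM 1 E\<^esub> lmul 1 E a (sum_der E xs)"
    using additive_map_add[OF lmul_0(2)[where r = 1, OF E assms(1)], of "ot 1 E (diff \<Omega> b) e" "sum_der E xs"]
    by (simp add: sum_der_Cons)
  moreover have "ot 1 E (diff \<Omega> a) (sum_val E (p # xs)) =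
      ot 1 E (diff \<Omega> a) (b \<odot>\<^bsub>E\<^esub> e) \<oplus>\<^bsub>OM 1 E\<^esub> ot 1 E (diff \<Omega> a) (sum_val E xs)"
    using ot_add_right[OF E, of "diff \<Omega> a" 1 "b \<odot>\<^bsub>E\<^esub> e" "sum_val E xs"] by (simp add: sum_val_Cons)
  moreover have "sum_der E (map (\<lambda>(b, e). (a \<otimes> b, e)) (p # xs)) =
      ot 1 E (diff \<Omega> (a \<otimes> b)) e \<oplus>\<^bsub>OM 1 E\<^esub> sum_der E (map (\<lambda>(b, e). (a \<otimes> b, e)) xs)"
    by (simp add: sum_der_Cons)
  ultimately show ?case
    using Cons.IH[OF xs] by (simp add: O.a_ac)
qed

lemma AE_tensor:
  "balanced_tensor K (deg \<Omega> 0) (\<lambda>a k. k \<odot>\<^bsub>\<Omega>\<^esub> a) E (smult (restrict_scalars (deg \<Omega> 0) E))"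
proof -
  interpret D: abelian_group "deg \<Omega> 0" by (rule deg_abelian_group)
  show ?thesis
    by unfold_locales
      (auto simp: deg_0 A_simps restrict_scalars_def E.lsmult_closed A_smult_one grade_smult
        intro: grade_smult[where m = 0, simplified grade_0])
qed

text \<open>Both sums respect balancing over \<open>K\<close>: the value because scalars act on
  \<open>E\<close> through multiples of 1, the derivative because d is
  \<open>K\<close>-linear.\<close>

lemma
  shows AE_balanced_val: "balanced_map K (deg \<Omega> 0) (\<lambda>a k. k \<odot>\<^bsub>\<Omega>\<^esub> a) E
      (smult (restrict_scalars (deg \<Omega> 0) E)) E (\<lambda>a e. a \<odot>\<^bsub>E\<^esub> e)"
    and AE_balanced_der: "balanced_map K (deg \<Omega> 0) (\<lambda>a k. k \<odot>\<^bsub>\<Omega>\<^esub> a) E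
      (smult (restrict_scalars (deg \<Omega> 0) E)) (OM 1 E) (\<lambda>a e. ot 1 E (diff \<Omega> a) e)"
proof -
  show "balanced_map K (deg \<Omega> 0) (\<lambda>a k. k \<odot>\<^bsub>\<Omega>\<^esub> a) E
      (smult (restrict_scalars (deg \<Omega> 0) E)) E (\<lambda>a e. a \<odot>\<^bsub>E\<^esub> e)"
  proof (intro balanced_mapI additive_mapI)
    fix a k e assume "a \<in> carrier (deg \<Omega> 0)" and k: "k \<in> carrier K" and e: "e \<in> carrier E"
    then have a: "a \<in> carrier A" by (simp add: deg_0)
    show "(k \<odot>\<^bsub>\<Omega>\<^esub> a) \<odot>\<^bsub>E\<^esub> e = a \<odot>\<^bsub>E\<^esub> (k \<odot>\<^bsub>restrict_scalars (deg \<Omega> 0) E\<^esub> e)"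
      using E.lsmult_assoc[OF a A_smult_one[OF k] e] a k
      by (simp add: restrict_scalars_def deg_0 A_simps mult_smult_one A_carrier)
  qed (simp_all add: deg_0 A_simps E.lsmult_closed E.lsmult_r_distr E.lsmult_l_distr[simplified A_simps])
  show "balanced_map K (deg \<Omega> 0) (\<lambda>a k. k \<odot>\<^bsub>\<Omega>\<^esub> a) E
      (smult (restrict_scalars (deg \<Omega> 0) E)) (OM 1 E) (\<lambda>a e. ot 1 E (diff \<Omega> a) e)"
  proof (intro balanced_mapI additive_mapI)
    fix a k e assume "a \<in> carrier (deg \<Omega> 0)" and k: "k \<in> carrier K" and e: "e \<in> carrier E"
    then have a: "a \<in> carrier A" by (simp add: deg_0)
    show "ot 1 E (diff \<Omega> (k \<odot>\<^bsub>\<Omega>\<^esub> a)) e = ot 1 E (diff \<Omega> a) (k \<odot>\<^bsub>restrict_scalars (deg \<Omega> 0) E\<^esub> e)"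
      using ot_balanced[OF E diff_A[OF a] A_smult_one[OF k] e] a k
      by (simp add: restrict_scalars_def deg_0 A_simps diff_smult mult_smult_one A_carrier diff_closed)
  qed (simp_all add: deg_0 A_simps diff_A diff_add A_carrier ot_closed[OF E] ot_add_left[OF E] ot_add_right[OF E])
qed

text \<open>\<open>J1_null\<close> is the common kernel of the lifts of value and derivative to A
  \<otimes> E. This is the last point at which the quotient defining 1-jets has to be
  handled.\<close>

lemma AEclass_minus_null_iff:
  assumes xs: "set xs \<subseteq> carrier A \<times> carrier E" and ys: "set ys \<subseteq> carrier A \<times> carrier E"
  shows "AEclass K \<Omega> E ys \<ominus>\<^bsub>AE K \<Omega> E\<^esub> AEclass K \<Omega> E xs \<in> J1_null K \<Omega> E \<longleftrightarrow>
    sum_val E ys = sum_val E xs \<and> sum_der E ys = sum_der E xs"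
proof -
  interpret balanced_tensor K "deg \<Omega> 0" "\<lambda>a k. k \<odot>\<^bsub>\<Omega>\<^esub> a" E "smult (restrict_scalars (deg \<Omega> 0) E)"
    by (rule AE_tensor)
  let ?V = "lift E (\<lambda>a e. a \<odot>\<^bsub>E\<^esub> e)" and ?D = "lift (OM 1 E) (\<lambda>a e. ot 1 E (diff \<Omega> a) e)"
  note V = E.E.abelian_group_axioms AE_balanced_val and D = O.abelian_group_axioms AE_balanced_der
  have Vc: "?V (cls zs) = sum_val E zs" and Dc: "?D (cls zs) = sum_der E zs"
    if "set zs \<subseteq> carrier A \<times> carrier E" for zs
    using lift_cls[OF V, of zs] lift_cls[OF D, of zs] that by (simp_all add: sum_val_def sum_der_def deg_0)
  have null: "J1_null K \<Omega> E = {cls zs | zs. set zs \<subseteq> carrier A \<times> carrier E \<and>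
      sum_val E zs = \<zero>\<^bsub>E\<^esub> \<and> sum_der E zs = \<zero>\<^bsub>OM 1 E\<^esub>}"
  proof -
    have "Oclass \<Omega> 1 E (map (\<lambda>(a, e). (diff \<Omega> a, e)) zs) = sum_der E zs"
      if "set zs \<subseteq> carrier A \<times> carrier E" for zs
      using that by (subst Oclass_eq_lsum[OF E])
        (auto simp: sum_der_def diff_A intro!: lsum_cong)
    then show ?thesis
      unfolding J1_null_def AEclass_def grade_0
      by (intro Collect_cong ex_cong1) (auto simp: sum_val_def lsum_def in_lists_conv_set subset_iff)
  qed
  \<comment> \<open>\<open>J1_null\<close> asks for some representing list with vanishing sums.
    Since the lifts do not depend on the list, this is a condition on the class itself.\<close>
  have iff: "X \<in> J1_null K \<Omega> E \<longleftrightarrow> ?V X = \<zero>\<^bsub>E\<^esub> \<and> ?D X = \<zero>\<^bsub>OM 1 E\<^esub>" if XT: "X \<in> carrier T" for X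
  proof -
    obtain zs where zs: "set zs \<subseteq> carrier A \<times> carrier E" "X = cls zs"
      using T_cases[OF XT] unfolding deg_0 by metis
    then show ?thesis unfolding null mem_Collect_eq by (metis Vc Dc)
  qed
  have c: "cls xs \<in> carrier T" "cls ys \<in> carrier T"
    using cls_closed[of xs] cls_closed[of ys] xs ys unfolding deg_0 by simp_all
  have "?V (cls ys \<ominus>\<^bsub>T\<^esub> cls xs) = sum_val E ys \<ominus>\<^bsub>E\<^esub> sum_val E xs"
    using c additive_map_add[OF lift_additive[OF V]] additive_map_minus[OF T.abelian_group_axioms V(1) lift_additive[OF V]]
    by (simp add: a_minus_def Vc xs ys)
  moreover have "?D (cls ys \<ominus>\<^bsub>T\<^esub> cls xs) = sum_der E ys \<ominus>\<^bsub>OM 1 E\<^esub> sum_der E xs"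
    using c additive_map_add[OF lift_additive[OF D]] additive_map_minus[OF T.abelian_group_axioms D(1) lift_additive[OF D]]
    by (simp add: a_minus_def Dc xs ys)
  ultimately show ?thesis
    using iff[of "cls ys \<ominus>\<^bsub>T\<^esub> cls xs"] c
    by (simp add: AEclass_def AE_def E.E.minus_eq_zero_iff O.minus_eq_zero_iff
        sum_val_closed sum_der_closed xs ys)
qed

end

context
  fixes E :: "('w, ('w, 'e) jet) module"
  assumes E: "left_module A E"
begin

interpretation E: left_module A E by (rule E)
interpretation O: abelian_group "OM 1 E" by (rule O_abelian_group[OF E])

text \<open>The predicate under the choice operator depends on \<open>xs\<close> only through value
  and derivative. Equal data therefore give the same chosen list and literally equal jets, which is
  \<open>J1_eqI\<close>.\<close>

lemma J1_class_eq:
  assumes "set xs \<subseteq> carrier A \<times> carrier E"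
  shows "J1_class K \<Omega> E xs = FSum (SOME ys. set ys \<subseteq> carrier A \<times> carrier E \<and>
    sum_val E ys = sum_val E xs \<and> sum_der E ys = sum_der E xs)"
proof -
  have "(\<lambda>ys. ys \<in> lists (carrier A \<times> carrier E) \<and>
      AEclass K \<Omega> E ys \<ominus>\<^bsub>AE K \<Omega> E\<^esub> AEclass K \<Omega> E xs \<in> J1_null K \<Omega> E) =
    (\<lambda>ys. set ys \<subseteq> carrier A \<times> carrier E \<and> sum_val E ys = sum_val E xs \<and> sum_der E ys = sum_der E xs)"
    by (rule ext) (metis AEclass_minus_null_iff[OF E assms] lists_eq_set mem_Collect_eq)
  then show ?thesis by (simp add: J1_class_def grade_0)
qed

lemma J1_class_props:
  assumes "set xs \<subseteq> carrier A \<times> carrier E"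
  shows "set (summands (J1_class K \<Omega> E xs)) \<subseteq> carrier A \<times> carrier E"
    and "jet_val E (J1_class K \<Omega> E xs) = sum_val E xs"
    and "jet_der E (J1_class K \<Omega> E xs) = sum_der E xs"
proof -
  let ?P = "\<lambda>ys. set ys \<subseteq> carrier A \<times> carrier E \<and> sum_val E ys = sum_val E xs \<and> sum_der E ys = sum_der E xs"
  have "?P (SOME ys. ?P ys)" by (rule someI[of ?P xs]) (simp add: assms)
  then show "set (summands (J1_class K \<Omega> E xs)) \<subseteq> carrier A \<times> carrier E"
    "jet_val E (J1_class K \<Omega> E xs) = sum_val E xs" "jet_der E (J1_class K \<Omega> E xs) = sum_der E xs"
    unfolding jet_val_def jet_der_def J1_class_eq[OF assms] summands.simps by blast+
qed

lemma J1_class_closed: "set xs \<subseteq> carrier A \<times> carrier E \<Longrightarrow> J1_class K \<Omega> E xs \<in> carrier (J1 K \<Omega> E)"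
  by (auto simp: J1_def grade_0 in_lists_conv_set subset_iff)

lemma J1_cases:
  assumes "x \<in> carrier (J1 K \<Omega> E)"
  obtains xs where "set xs \<subseteq> carrier A \<times> carrier E" "x = J1_class K \<Omega> E xs"
  using assms by (auto simp: J1_def grade_0)

lemma J1_summands: "x \<in> carrier (J1 K \<Omega> E) \<Longrightarrow> set (summands x) \<subseteq> carrier A \<times> carrier E"
  using J1_class_props(1) by (auto elim!: J1_cases)

lemma J1_eqI:
  assumes "x \<in> carrier (J1 K \<Omega> E)" "y \<in> carrier (J1 K \<Omega> E)"
    "jet_val E x = jet_val E y" "jet_der E x = jet_der E y"
  shows "x = y"
proof -
  obtain xs ys where "set xs \<subseteq> carrier A \<times> carrier E" "x = J1_class K \<Omega> E xs"
    "set ys \<subseteq> carrier A \<times> carrier E" "y = J1_class K \<Omega> E ys"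
    using assms(1,2) by (metis J1_cases)
  moreover from this have "sum_val E xs = sum_val E ys" "sum_der E xs = sum_der E ys"
    using assms(3,4) by (simp_all add: J1_class_props)
  ultimately show ?thesis by (simp add: J1_class_eq)
qed

lemma jet_val_closed: "x \<in> carrier (J1 K \<Omega> E) \<Longrightarrow> jet_val E x \<in> carrier E"
  unfolding jet_val_def by (rule sum_val_closed[OF E J1_summands])

lemma jet_der_closed: "x \<in> carrier (J1 K \<Omega> E) \<Longrightarrow> jet_der E x \<in> carrier (OM 1 E)"
  unfolding jet_der_def by (rule sum_der_closed[OF E J1_summands])

lemma J1_zero:
  "\<zero>\<^bsub>J1 K \<Omega> E\<^esub> \<in> carrier (J1 K \<Omega> E)"
  "jet_val E \<zero>\<^bsub>J1 K \<Omega> E\<^esub> = \<zero>\<^bsub>E\<^esub>"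
  "jet_der E \<zero>\<^bsub>J1 K \<Omega> E\<^esub> = \<zero>\<^bsub>OM 1 E\<^esub>"
  using J1_class_props[of "[]"] J1_class_closed[of "[]"]
  by (simp_all add: J1_def sum_val_def sum_der_def)

lemma J1_add:
  assumes "x \<in> carrier (J1 K \<Omega> E)" "y \<in> carrier (J1 K \<Omega> E)"
  shows "x \<oplus>\<^bsub>J1 K \<Omega> E\<^esub> y \<in> carrier (J1 K \<Omega> E)"
    and "jet_val E (x \<oplus>\<^bsub>J1 K \<Omega> E\<^esub> y) = jet_val E x \<oplus>\<^bsub>E\<^esub> jet_val E y"
    and "jet_der E (x \<oplus>\<^bsub>J1 K \<Omega> E\<^esub> y) = jet_der E x \<oplus>\<^bsub>OM 1 E\<^esub> jet_der E y"
proof -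
  have s: "set (summands x @ summands y) \<subseteq> carrier A \<times> carrier E"
    using J1_summands[OF assms(1)] J1_summands[OF assms(2)] by simp
  have "x \<oplus>\<^bsub>J1 K \<Omega> E\<^esub> y = J1_class K \<Omega> E (summands x @ summands y)" by (simp add: J1_def)
  then show "x \<oplus>\<^bsub>J1 K \<Omega> E\<^esub> y \<in> carrier (J1 K \<Omega> E)"
    "jet_val E (x \<oplus>\<^bsub>J1 K \<Omega> E\<^esub> y) = jet_val E x \<oplus>\<^bsub>E\<^esub> jet_val E y"
    "jet_der E (x \<oplus>\<^bsub>J1 K \<Omega> E\<^esub> y) = jet_der E x \<oplus>\<^bsub>OM 1 E\<^esub> jet_der E y"
    using J1_class_props[OF s] J1_class_closed[OF s] J1_summands[OF assms(1)] J1_summands[OF assms(2)]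
    by (simp_all add: sum_val_append[OF E] sum_der_append[OF E] jet_val_def[of E x] jet_val_def[of E y]
        jet_der_def[of E x] jet_der_def[of E y])
qed

lemma J1_smult:
  assumes "a \<in> carrier A" "x \<in> carrier (J1 K \<Omega> E)"
  shows "a \<odot>\<^bsub>J1 K \<Omega> E\<^esub> x \<in> carrier (J1 K \<Omega> E)"
    and "jet_val E (a \<odot>\<^bsub>J1 K \<Omega> E\<^esub> x) = a \<odot>\<^bsub>E\<^esub> jet_val E x"
    and "jet_der E (a \<odot>\<^bsub>J1 K \<Omega> E\<^esub> x) =
      ot 1 E (diff \<Omega> a) (jet_val E x) \<oplus>\<^bsub>OM 1 E\<^esub> lmul 1 E a (jet_der E x)"
proof -
  have s: "set (map (\<lambda>(b, e). (a \<otimes> b, e)) (summands x)) \<subseteq> carrier A \<times> carrier E"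
    using J1_summands[OF assms(2)] assms(1) A.m_closed by (auto simp: A_simps)
  have "a \<odot>\<^bsub>J1 K \<Omega> E\<^esub> x = J1_class K \<Omega> E (map (\<lambda>(b, e). (a \<otimes> b, e)) (summands x))"
    by (simp add: J1_def)
  then show "a \<odot>\<^bsub>J1 K \<Omega> E\<^esub> x \<in> carrier (J1 K \<Omega> E)"
    "jet_val E (a \<odot>\<^bsub>J1 K \<Omega> E\<^esub> x) = a \<odot>\<^bsub>E\<^esub> jet_val E x"
    "jet_der E (a \<odot>\<^bsub>J1 K \<Omega> E\<^esub> x) =
      ot 1 E (diff \<Omega> a) (jet_val E x) \<oplus>\<^bsub>OM 1 E\<^esub> lmul 1 E a (jet_der E x)"
    using J1_class_props[OF s] J1_class_closed[OF s] J1_summands[OF assms(2)] assms(1)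
    by (simp_all add: sum_val_mult[OF E] sum_der_mult[OF E] jet_val_def[of E x] jet_der_def[of E x])
qed

text \<open>Each axiom is checked on value and derivative separately. Associativity of the action,
  for instance, amounts to the Leibniz rule for d(a b) together with balancing.\<close>

lemma left_module_J1: "left_module A (J1 K \<Omega> E)"
proof -
  note [simp] = J1_add J1_smult J1_zero jet_val_closed jet_der_closed E.lsmult_closed ot_closed[OF E]
    diff_A lmul_0[OF E] A_carrier diff_add diff_mult_A grade_mult_0 grade_0_mult diff_closed
  have ring: "a \<oplus> b \<in> carrier A" "a \<otimes> b \<in> carrier A" if "a \<in> carrier A" "b \<in> carrier A" for a b
    using that A.m_closed A.add.m_closed by (simp_all add: A_simps)
  have "abelian_group (J1 K \<Omega> E)"
  proof (rule abelian_groupI)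
    fix x assume x: "x \<in> carrier (J1 K \<Omega> E)"
    show "\<zero>\<^bsub>J1 K \<Omega> E\<^esub> \<oplus>\<^bsub>J1 K \<Omega> E\<^esub> x = x"
      by (rule J1_eqI) (simp_all add: x)
    \<comment> \<open>The negative of x is (-1) x: the twist in its derivative disappears because
      d(-1) = 0.\<close>
    have m1: "\<ominus> \<one> \<in> carrier A" using grade_minus[OF one_grade] by (simp add: grade_0)
    have d: "diff \<Omega> (\<ominus> \<one>) = \<zero>"
      using additive_map_minus[OF abelian_group_axioms abelian_group_axioms mod_hom_additive[OF diff_linear], of \<one>]
      by (simp add: diff_one)
    have "(\<ominus> \<one>) \<odot>\<^bsub>E\<^esub> jet_val E x \<oplus>\<^bsub>E\<^esub> jet_val E x = (\<ominus> \<one> \<oplus> \<one>) \<odot>\<^bsub>E\<^esub> jet_val E x"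
      using E.lsmult_l_distr[OF m1 one_A, of "jet_val E x"] E.lsmult_one[of "jet_val E x"] x
      by (simp add: A_simps)
    moreover have "lmul 1 E (\<ominus> \<one>) (jet_der E x) \<oplus>\<^bsub>OM 1 E\<^esub> jet_der E x = lmul 1 E (\<ominus> \<one> \<oplus> \<one>) (jet_der E x)"
      using lmul_add_left[OF E, of 1 0 1 "\<ominus> \<one>" \<one> "jet_der E x"] x m1
      by (simp add: grade_0 one_A lmul_one[OF E])
    ultimately have "(\<ominus> \<one>) \<odot>\<^bsub>J1 K \<Omega> E\<^esub> x \<oplus>\<^bsub>J1 K \<Omega> E\<^esub> x = \<zero>\<^bsub>J1 K \<Omega> E\<^esub>"
      using x m1
      by - (rule J1_eqI, simp_all add: l_neg left_module_zero[OF E] lmul_zero[OF E, of _ 1 1 0] d ot_zero[OF E])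
    then show "\<exists>y\<in>carrier (J1 K \<Omega> E). y \<oplus>\<^bsub>J1 K \<Omega> E\<^esub> x = \<zero>\<^bsub>J1 K \<Omega> E\<^esub>"
      using x m1 J1_smult(1) by blast
    fix y assume y: "y \<in> carrier (J1 K \<Omega> E)"
    show "x \<oplus>\<^bsub>J1 K \<Omega> E\<^esub> y = y \<oplus>\<^bsub>J1 K \<Omega> E\<^esub> x"
      by (rule J1_eqI) (simp_all add: x y E.E.a_ac O.a_ac)
    fix z assume z: "z \<in> carrier (J1 K \<Omega> E)"
    show "x \<oplus>\<^bsub>J1 K \<Omega> E\<^esub> y \<oplus>\<^bsub>J1 K \<Omega> E\<^esub> z = x \<oplus>\<^bsub>J1 K \<Omega> E\<^esub> (y \<oplus>\<^bsub>J1 K \<Omega> E\<^esub> z)"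
      by (rule J1_eqI) (simp_all add: x y z E.E.a_ac O.a_ac)
  qed simp_all
  then show ?thesis
  proof (intro left_module.intro left_module_axioms.intro A.ring_axioms)
    fix a b x y assume a: "a \<in> carrier A" and b: "b \<in> carrier A" and x: "x \<in> carrier (J1 K \<Omega> E)"
    note l = lmul_add_left[OF E, of 1 0 1, simplified grade_0]
    show "a \<odot>\<^bsub>J1 K \<Omega> E\<^esub> x \<in> carrier (J1 K \<Omega> E)" using a x by simp
    show "(a \<oplus>\<^bsub>A\<^esub> b) \<odot>\<^bsub>J1 K \<Omega> E\<^esub> x = a \<odot>\<^bsub>J1 K \<Omega> E\<^esub> x \<oplus>\<^bsub>J1 K \<Omega> E\<^esub> b \<odot>\<^bsub>J1 K \<Omega> E\<^esub> x"
      using a b x by - (rule J1_eqI, simp_all add: A_simps ring E.lsmult_l_distr[simplified A_simps] ot_add_left[OF E] l O.a_ac)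
    show "(a \<otimes>\<^bsub>A\<^esub> b) \<odot>\<^bsub>J1 K \<Omega> E\<^esub> x = a \<odot>\<^bsub>J1 K \<Omega> E\<^esub> (b \<odot>\<^bsub>J1 K \<Omega> E\<^esub> x)"
      using a b x additive_map_add[OF lmul_0(2)[where r = 1, OF E a], of "ot 1 E (diff \<Omega> b) (jet_val E x)" "lmul 1 E b (jet_der E x)"]
      by - (rule J1_eqI, simp_all add: A_simps ring E.lsmult_assoc[simplified A_simps] ot_add_left[OF E]
          lmul_mult[OF E, of _ 0 _ _ 1 1, simplified grade_0] ot_balanced[OF E] O.a_ac)
    show "a \<odot>\<^bsub>J1 K \<Omega> E\<^esub> (x \<oplus>\<^bsub>J1 K \<Omega> E\<^esub> y) = a \<odot>\<^bsub>J1 K \<Omega> E\<^esub> x \<oplus>\<^bsub>J1 K \<Omega> E\<^esub> a \<odot>\<^bsub>J1 K \<Omega> E\<^esub> y"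
      if y: "y \<in> carrier (J1 K \<Omega> E)"
      using a x y additive_map_add[OF lmul_0(2)[where r = 1, OF E a], of "jet_der E x" "jet_der E y"]
      by - (rule J1_eqI, simp_all add: E.lsmult_r_distr ot_add_right[OF E] O.a_ac)
  next
    fix x assume x: "x \<in> carrier (J1 K \<Omega> E)"
    show "\<one>\<^bsub>A\<^esub> \<odot>\<^bsub>J1 K \<Omega> E\<^esub> x = x"
      using x one_A E.lsmult_one[of "jet_val E x"]
      by - (rule J1_eqI, simp_all add: A_simps diff_one ot_zero[OF E] lmul_one[OF E])
  qed
qed

end

end

section \<open>The operators on iterated first jets\<close>

context exterior_algebra
begin

lemma jet_val_hom: "left_module A E \<Longrightarrow> jet_val E \<in> mod_hom A (J1 K \<Omega> E) E"
  by (intro mod_homI additive_mapI) (simp_all add: jet_val_closed J1_add J1_smult)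

lemma jet_der_additive: "left_module A E \<Longrightarrow> additive_map (J1 K \<Omega> E) (OM 1 E) (jet_der E)"
  by (intro additive_mapI) (simp_all add: jet_der_closed J1_add)

lemma lmul_smult_one:
  assumes "left_module A E" "k \<in> carrier K" "X \<in> carrier (OM r E)"
  shows "lmul r E (k \<odot>\<^bsub>\<Omega>\<^esub> \<one>) X = k \<odot>\<^bsub>OM r E\<^esub> X"
  using lmul_smult[OF assms(1) _ assms(2), of r 0 r \<one> X] assms one_grade by (simp add: lmul_one)

text \<open>A scalar k acts as the element k 1 of \<open>A\<close>, and d(k 1) = k d1 = 0 removes
  the twist.\<close>

lemma jet_der_hom:
  assumes "left_module A E"
  shows "jet_der E \<in> mod_hom K (restrict_scalars A (J1 K \<Omega> E)) (OM 1 E)"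
proof (rule mod_homI)
  interpret O: abelian_group "OM 1 E" by (rule O_abelian_group[OF assms])
  show "additive_map (restrict_scalars A (J1 K \<Omega> E)) (OM 1 E) (jet_der E)"
    using jet_der_additive[OF assms] by (simp add: additive_map_def restrict_scalars_def)
  fix k x assume "k \<in> carrier K" "x \<in> carrier (restrict_scalars A (J1 K \<Omega> E))"
  then have k: "k \<in> carrier K" and x: "x \<in> carrier (J1 K \<Omega> E)" by (simp_all add: restrict_scalars_def)
  have d: "diff \<Omega> (k \<odot>\<^bsub>\<Omega>\<^esub> \<one>) = \<zero>"
    using k by (simp add: diff_smult diff_one)
  show "jet_der E (k \<odot>\<^bsub>restrict_scalars A (J1 K \<Omega> E)\<^esub> x) = k \<odot>\<^bsub>OM 1 E\<^esub> jet_der E x"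
    using k x O_smult_additive[OF assms k, of 1]
    by (simp add: restrict_scalars_def A_simps J1_smult assms A_smult_one d ot_zero jet_val_closed
        lmul_smult_one jet_der_closed additive_map_closed)
qed

section \<open>Functoriality of 1-jets\<close>

context
  fixes E :: "('w, ('w, 'e) jet) module" and F :: "('w, ('w, 'e) jet) module" and f
  assumes E: "left_module A E" and F: "left_module A F" and f: "f \<in> mod_hom A E F"
begin

interpretation E: left_module A E by (rule E)
interpretation F: left_module A F by (rule F)

lemma map_pairs:
  assumes "set xs \<subseteq> carrier A \<times> carrier E"
  shows "set (map (\<lambda>(a, e). (a, f e)) xs) \<subseteq> carrier A \<times> carrier F"
  using assms additive_map_closed[OF mod_hom_additive[OF f]] by auto

lemma sum_val_map:
  assumes "set xs \<subseteq> carrier A \<times> carrier E"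
  shows "sum_val F (map (\<lambda>(a, e). (a, f e)) xs) = f (sum_val E xs)"
proof -
  have "f (sum_val E xs) = lsum F (\<lambda>p. f (case p of (a, e) \<Rightarrow> a \<odot>\<^bsub>E\<^esub> e)) xs"
    unfolding sum_val_def
    by (rule additive_map_lsum[OF E.E.abelian_group_axioms F.E.abelian_group_axioms mod_hom_additive[OF f]])
      (use assms in \<open>auto intro: E.lsmult_closed\<close>)
  also have "\<dots> = sum_val F (map (\<lambda>(a, e). (a, f e)) xs)"
    unfolding sum_val_def lsum_map
    by (rule lsum_cong) (use assms in \<open>auto simp: mod_hom_smult[OF f]\<close>)
  finally show ?thesis by simp
qed

lemma sum_der_map:
  assumes "set xs \<subseteq> carrier A \<times> carrier E"
  shows "sum_der F (map (\<lambda>(a, e). (a, f e)) xs) = Omap \<Omega> 1 F f (sum_der E xs)"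
proof -
  have "Omap \<Omega> 1 F f (sum_der E xs) = lsum (OM 1 F) (\<lambda>p. Omap \<Omega> 1 F f (case p of (a, e) \<Rightarrow> ot 1 E (diff \<Omega> a) e)) xs"
    unfolding sum_der_def
    by (rule additive_map_lsum[OF O_abelian_group[OF E] O_abelian_group[OF F] Omap_additive[OF E F f]])
      (use assms in \<open>auto intro!: ot_closed[OF E] diff_A\<close>)
  also have "\<dots> = sum_der F (map (\<lambda>(a, e). (a, f e)) xs)"
    unfolding sum_der_def lsum_map
    by (rule lsum_cong) (use assms in \<open>auto simp: Omap_ot[OF E F f] diff_A\<close>)
  finally show ?thesis by simp
qed

text \<open>The map changes only the right factor of each summand, where both sums are natural.
  Linearity and the functor laws of J^1 are reduced through these formulas to those of
  \<open>Omap\<close>.\<close>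

lemma J1_map_props:
  assumes "x \<in> carrier (J1 K \<Omega> E)"
  shows "J1_map K \<Omega> F f x \<in> carrier (J1 K \<Omega> F)"
    and "jet_val F (J1_map K \<Omega> F f x) = f (jet_val E x)"
    and "jet_der F (J1_map K \<Omega> F f x) = Omap \<Omega> 1 F f (jet_der E x)"
  using J1_class_props[OF F map_pairs[OF J1_summands[OF E assms]]]
    J1_class_closed[OF F map_pairs[OF J1_summands[OF E assms]]]
    sum_val_map[OF J1_summands[OF E assms]] sum_der_map[OF J1_summands[OF E assms]]
  by (simp_all add: J1_map_def jet_val_def[of E] jet_der_def[of E])

lemma J1_map_hom: "J1_map K \<Omega> F f \<in> mod_hom A (J1 K \<Omega> E) (J1 K \<Omega> F)"
proof (intro mod_homI additive_mapI)
  note [simp] = J1_map_props J1_add[OF E] J1_add[OF F] J1_smult[OF E] J1_smult[OF F] jet_val_closed[OF E]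
    jet_der_closed[OF E]
  fix x assume x: "x \<in> carrier (J1 K \<Omega> E)"
  then show "J1_map K \<Omega> F f x \<in> carrier (J1 K \<Omega> F)" by simp
  show "J1_map K \<Omega> F f (x \<oplus>\<^bsub>J1 K \<Omega> E\<^esub> y) = J1_map K \<Omega> F f x \<oplus>\<^bsub>J1 K \<Omega> F\<^esub> J1_map K \<Omega> F f y"
    if y: "y \<in> carrier (J1 K \<Omega> E)" for y
    by (rule J1_eqI[OF F])
      (simp_all add: x y additive_map_add[OF mod_hom_additive[OF f]] additive_map_add[OF Omap_additive[OF E F f]])
  show "J1_map K \<Omega> F f (a \<odot>\<^bsub>J1 K \<Omega> E\<^esub> x) = a \<odot>\<^bsub>J1 K \<Omega> F\<^esub> J1_map K \<Omega> F f x"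
    if a: "a \<in> carrier A" for a
    by (rule J1_eqI[OF F])
      (use a in \<open>simp_all add: x mod_hom_smult[OF f] additive_map_add[OF Omap_additive[OF E F f]] ot_closed[OF E]
        diff_A lmul_0[OF E] Omap_ot[OF E F f] Omap_lmul[OF E F f, of _ 0 _ 1] grade_0\<close>)
qed

end

lemma mod_hom_id: "(\<lambda>e. e) \<in> mod_hom R E E"
  by (simp add: mod_hom_def)

lemma J1_map_cong:
  assumes "left_module A E" "x \<in> carrier (J1 K \<Omega> E)" "\<And>e. e \<in> carrier E \<Longrightarrow> f e = g e"
  shows "J1_map K \<Omega> F f x = J1_map K \<Omega> F g x"
proof -
  have "map (\<lambda>(w, e). (w, f e)) (summands x) = map (\<lambda>(w, e). (w, g e)) (summands x)"
    using J1_summands[OF assms(1,2)] assms(3) by auto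
  then show ?thesis unfolding J1_map_def by (rule arg_cong)
qed

lemma J1_map_id:
  assumes "left_module A E" "x \<in> carrier (J1 K \<Omega> E)"
  shows "J1_map K \<Omega> E (\<lambda>e. e) x = x"
  by (rule J1_eqI[OF assms(1)])
    (simp_all add: J1_map_props[OF assms(1) assms(1) mod_hom_id] assms Omap_id jet_der_closed)

lemma J1_map_comp:
  assumes "left_module A E" "left_module A F" "left_module A G" "f \<in> mod_hom A E F" "g \<in> mod_hom A F G"
    "x \<in> carrier (J1 K \<Omega> E)"
  shows "J1_map K \<Omega> G g (J1_map K \<Omega> F f x) = J1_map K \<Omega> G (\<lambda>e. g (f e)) x"
  by (rule J1_eqI[OF assms(3)])
    (simp_all add: J1_map_props[OF assms(1,2,4)] J1_map_props[OF assms(2,3,5)]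
      J1_map_props[OF assms(1,3) mod_hom_comp[OF assms(4,5)]] assms(6) Omap_comp[OF assms(1-5)]
      jet_der_closed[OF assms(1)])

text \<open>\<open>D_I\<close>, \<open>D_II\<close> and \<open>Spencer1\<close> concatenate inner
  formal sums over an outer one. Separating the two levels lets the inner one be expressed by value
  and derivative.\<close>

lemma Oclass_concat:
  assumes E: "left_module A E" and "\<And>p. p \<in> set xs \<Longrightarrow> set (g p) \<subseteq> grade \<Omega> m \<times> carrier E"
  shows "Oclass \<Omega> m E (concat (map g xs)) = lsum (OM m E) (\<lambda>p. Oclass \<Omega> m E (g p)) xs"
proof -
  interpret O: abelian_group "OM m E" by (rule O_abelian_group[OF E])
  have c: "(case p of (w, e) \<Rightarrow> ot m E w e) \<in> carrier (OM m E)" if "p \<in> grade \<Omega> m \<times> carrier E" for p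
    using that ot_closed[OF E] by auto
  show ?thesis
    using assms(2)
  proof (induction xs)
    case Nil
    then show ?case by (simp add: Oclass_eq_lsum[OF E])
  next
    case (Cons p xs)
    have s: "set (g p) \<subseteq> grade \<Omega> m \<times> carrier E" "set (concat (map g xs)) \<subseteq> grade \<Omega> m \<times> carrier E"
      using Cons.prems by auto
    have "Oclass \<Omega> m E (g p @ concat (map g xs)) =
        Oclass \<Omega> m E (g p) \<oplus>\<^bsub>OM m E\<^esub> Oclass \<Omega> m E (concat (map g xs))"
      using s unfolding Oclass_eq_lsum[OF E s(1)] Oclass_eq_lsum[OF E s(2)]
      by (subst Oclass_eq_lsum[OF E], simp) (rule O.lsum_append, rule c, auto)
    then show ?case using Cons by simp
  qed
qed

text \<open>Pulling out the common factor leaves the derivative of the inner sum. The case v = a in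
  degree 0 serves \<open>D_I\<close>, the case v = da in degree 1 serves
  \<open>D_II\<close>.\<close>

lemma Oclass_diff:
  assumes E: "left_module A E" and v: "v \<in> grade \<Omega> p" and q: "q = p + 1"
    and ys: "set ys \<subseteq> carrier A \<times> carrier E"
  shows "Oclass \<Omega> q E (map (\<lambda>(c, e). (v \<otimes> diff \<Omega> c, e)) ys) = lmul q E v (sum_der E ys)"
proof -
  have "lmul q E v (sum_der E ys) =
      lsum (OM q E) (\<lambda>p. lmul q E v (case p of (c, e) \<Rightarrow> ot 1 E (diff \<Omega> c) e)) ys"
    unfolding sum_der_def
    by (rule additive_map_lsum[OF O_abelian_group[OF E] O_abelian_group[OF E] lmul_additive[OF E q v]])
      (use ys in \<open>auto intro!: ot_closed[OF E] diff_A\<close>)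
  also have "\<dots> = Oclass \<Omega> q E (map (\<lambda>(c, e). (v \<otimes> diff \<Omega> c, e)) ys)"
    using ys by (subst Oclass_eq_lsum[OF E])
      (auto intro!: lsum_cong simp: lmul_ot[OF E q v] diff_A grade_mult_r[OF E q v])
  finally show ?thesis by simp
qed

lemma lsum_pair_cong:
  "(\<And>a b. (a, b) \<in> set xs \<Longrightarrow> f a b = g a b) \<Longrightarrow>
    lsum G (\<lambda>(a, b). f a b) xs = lsum G (\<lambda>(a, b). g a b) xs"
  by (rule lsum_cong) auto

lemma D_I_eq:
  assumes E: "left_module A E" and x: "x \<in> carrier (J1 K \<Omega> (J1 K \<Omega> E))"
  shows "D_I \<Omega> E x = lsum (OM 1 E) (\<lambda>(a, y). lmul 1 E a (jet_der E y)) (summands x)"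
proof -
  note s = J1_summands[OF left_module_J1[OF E] x]
  have "D_I \<Omega> E x = lsum (OM 1 E) (\<lambda>(a, y). Oclass \<Omega> 1 E (map (\<lambda>(c, e). (a \<otimes> diff \<Omega> c, e)) (summands y))) (summands x)"
    unfolding D_I_def
    by (subst Oclass_concat[OF E])
      (use s J1_summands[OF E] in \<open>fastforce intro!: lsum_cong grade_0_mult diff_A\<close>)+
  also have "\<dots> = lsum (OM 1 E) (\<lambda>(a, y). lmul 1 E a (jet_der E y)) (summands x)"
  proof (rule lsum_pair_cong)
    fix a y assume "(a, y) \<in> set (summands x)"
    then have "a \<in> carrier A" "y \<in> carrier (J1 K \<Omega> E)" using s by auto
    then show "Oclass \<Omega> 1 E (map (\<lambda>(c, e). (a \<otimes> diff \<Omega> c, e)) (summands y)) = lmul 1 E a (jet_der E y)"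
      unfolding jet_der_def by (intro Oclass_diff[OF E, of _ 0] J1_summands[OF E]) (simp_all add: grade_0)
  qed
  finally show ?thesis .
qed

lemma D_II_eq:
  assumes E: "left_module A E" and x: "x \<in> carrier (J1 K \<Omega> (J1 K \<Omega> E))"
  shows "D_II \<Omega> E x = lsum (OM 2 E) (\<lambda>(a, y). lmul 2 E (diff \<Omega> a) (jet_der E y)) (summands x)"
proof -
  note s = J1_summands[OF left_module_J1[OF E] x]
  have m: "v \<otimes> w \<in> grade \<Omega> 2" if "v \<in> grade \<Omega> 1" "w \<in> grade \<Omega> 1" for v w
    using mult_grade[OF that] by simp
  have "D_II \<Omega> E x = lsum (OM 2 E) (\<lambda>(a, y). Oclass \<Omega> 2 E (map (\<lambda>(c, e). (diff \<Omega> a \<otimes> diff \<Omega> c, e)) (summands y))) (summands x)"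
    unfolding D_II_def
    by (subst Oclass_concat[OF E])
      (use s J1_summands[OF E] in \<open>fastforce intro!: lsum_cong m diff_A\<close>)+
  also have "\<dots> = lsum (OM 2 E) (\<lambda>(a, y). lmul 2 E (diff \<Omega> a) (jet_der E y)) (summands x)"
  proof (rule lsum_pair_cong)
    fix a y assume "(a, y) \<in> set (summands x)"
    then have "a \<in> carrier A" "y \<in> carrier (J1 K \<Omega> E)" using s by auto
    then show "Oclass \<Omega> 2 E (map (\<lambda>(c, e). (diff \<Omega> a \<otimes> diff \<Omega> c, e)) (summands y)) =
        lmul 2 E (diff \<Omega> a) (jet_der E y)"
      unfolding jet_der_def by (intro Oclass_diff[OF E, of _ 1] J1_summands[OF E] diff_A) simp_all
  qed
  finally show ?thesis .
qed

lemma D_I_D_II_closed: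
  assumes E: "left_module A E" and x: "x \<in> carrier (J1 K \<Omega> (J1 K \<Omega> E))"
  shows "D_I \<Omega> E x \<in> carrier (OM 1 E)" "D_II \<Omega> E x \<in> carrier (OM 2 E)"
proof -
  interpret O1: abelian_group "OM 1 E" by (rule O_abelian_group[OF E])
  interpret O2: abelian_group "OM 2 E" by (rule O_abelian_group[OF E])
  note s = J1_summands[OF left_module_J1[OF E] x]
  show "D_I \<Omega> E x \<in> carrier (OM 1 E)"
    unfolding D_I_eq[OF E x]
    by (rule O1.lsum_closed) (use s in \<open>auto intro!: lmul_0[OF E] jet_der_closed[OF E]\<close>)
  show "D_II \<Omega> E x \<in> carrier (OM 2 E)"
    unfolding D_II_eq[OF E x]
    by (rule O2.lsum_closed) (use s in \<open>auto intro!: lmul_closed[OF E, of 2 1 1] jet_der_closed[OF E] diff_A\<close>)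
qed

text \<open>The value of x is the sum of a y over its summands, and the twisted action gives d(a y)
  = da \<otimes> v(y) + a d(y). The two parts add up to the two terms on the right. Only the second
  is defined by the stored representatives, so the identity also shows that \<open>D_I\<close> is
  independent of them.\<close>

lemma jet_der_jet_val:
  assumes E: "left_module A E" and x: "x \<in> carrier (J1 K \<Omega> (J1 K \<Omega> E))"
  shows "jet_der E (jet_val (J1 K \<Omega> E) x) =
    Omap \<Omega> 1 E (jet_val E) (jet_der (J1 K \<Omega> E) x) \<oplus>\<^bsub>OM 1 E\<^esub> D_I \<Omega> E x"
proof -
  let ?J = "J1 K \<Omega> E" and ?xs = "summands x"
  note J = left_module_J1[OF E]
  interpret J: left_module A ?J by (rule J)
  interpret O: abelian_group "OM 1 E" by (rule O_abelian_group[OF E])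
  note s = J1_summands[OF J x]
  let ?u = "\<lambda>(a, y). ot 1 E (diff \<Omega> a) (jet_val E y)" and ?v = "\<lambda>(a, y). lmul 1 E a (jet_der E y)"
  have "jet_der E (jet_val ?J x) = lsum (OM 1 E) (\<lambda>p. jet_der E (case p of (a, y) \<Rightarrow> a \<odot>\<^bsub>?J\<^esub> y)) ?xs"
    unfolding jet_val_def[of ?J] sum_val_def
    by (rule additive_map_lsum[OF J.E.abelian_group_axioms O.abelian_group_axioms jet_der_additive[OF E]])
      (use s in \<open>auto intro!: J.lsmult_closed\<close>)
  also have "\<dots> = lsum (OM 1 E) (\<lambda>p. ?u p \<oplus>\<^bsub>OM 1 E\<^esub> ?v p) ?xs"
    by (rule lsum_cong) (use s in \<open>auto simp: J1_smult[OF E]\<close>)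
  also have "\<dots> = lsum (OM 1 E) ?u ?xs \<oplus>\<^bsub>OM 1 E\<^esub> lsum (OM 1 E) ?v ?xs"
    by (rule O.lsum_add)
      (use s in \<open>auto intro!: lmul_0[OF E] jet_der_closed[OF E] jet_val_closed[OF E] ot_closed[OF E] diff_A\<close>)
  also have "lsum (OM 1 E) ?v ?xs = D_I \<Omega> E x" by (rule D_I_eq[OF E x, symmetric])
  also have "lsum (OM 1 E) ?u ?xs = Omap \<Omega> 1 E (jet_val E) (jet_der ?J x)"
  proof -
    note h = jet_val_hom[OF E]
    have "Omap \<Omega> 1 E (jet_val E) (jet_der ?J x) =
        lsum (OM 1 E) (\<lambda>p. Omap \<Omega> 1 E (jet_val E) (case p of (a, y) \<Rightarrow> ot 1 ?J (diff \<Omega> a) y)) ?xs"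
      unfolding jet_der_def[of ?J] sum_der_def
      by (rule additive_map_lsum[OF O_abelian_group[OF J] O.abelian_group_axioms Omap_additive[OF J E h]])
        (use s in \<open>auto intro!: ot_closed[OF J] diff_A\<close>)
    also have "\<dots> = lsum (OM 1 E) ?u ?xs"
      by (rule lsum_cong) (use s in \<open>auto simp: Omap_ot[OF J E h] diff_A\<close>)
    finally show ?thesis by simp
  qed
  finally show ?thesis .
qed

text \<open>The semiholonomic condition compares the two projections from iterated first jets to first
  jets, both of which are linear.\<close>

lemma D_I_zero_iff:
  assumes E: "left_module A E" and x: "x \<in> carrier (J1 K \<Omega> (J1 K \<Omega> E))"
  shows "D_I \<Omega> E x = \<zero>\<^bsub>OM 1 E\<^esub> \<longleftrightarrow> jet_val (J1 K \<Omega> E) x = J1_map K \<Omega> E (jet_val E) x"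
proof -
  let ?J = "J1 K \<Omega> E"
  note J = left_module_J1[OF E] and h = jet_val_hom[OF E]
  interpret O: abelian_group "OM 1 E" by (rule O_abelian_group[OF E])
  note m = J1_map_props[OF J E h x]
  let ?d = "Omap \<Omega> 1 E (jet_val E) (jet_der ?J x)"
  have d: "?d \<in> carrier (OM 1 E)"
    by (rule Omap_closed[OF J E h jet_der_closed[OF J x]])
  \<comment> \<open>Both jets have the same value v(v(x)), so only their derivatives have to be
    compared.\<close>
  have "jet_val ?J x = J1_map K \<Omega> E (jet_val E) x \<longleftrightarrow> jet_der E (jet_val ?J x) = ?d"
    by (metis J1_eqI[OF E jet_val_closed[OF J x] m(1)] m(2,3))
  also have "\<dots> \<longleftrightarrow> ?d \<oplus>\<^bsub>OM 1 E\<^esub> D_I \<Omega> E x = ?d"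
    by (simp add: jet_der_jet_val[OF E x])
  also have "\<dots> \<longleftrightarrow> D_I \<Omega> E x = \<zero>\<^bsub>OM 1 E\<^esub>"
    using d D_I_D_II_closed(1)[OF E x] by (simp add: O.add.l_cancel_one)
  finally show ?thesis ..
qed

text \<open>The contribution of w \<otimes> y, written by value and derivative of y in place of the
  sum of d(w a) \<otimes> e over its stored formal sum. In this form additivity and balancing can be
  verified.\<close>

definition spencer_term :: "nat \<Rightarrow> ('w, ('w, 'e) jet) module \<Rightarrow> 'w \<Rightarrow> ('w, 'e) jet \<Rightarrow> ('w \<times> ('w, 'e) jet) list set"
  where "spencer_term m E w y = ot (m + 1) E (diff \<Omega> w) (jet_val E y)
    \<oplus>\<^bsub>OM (m + 1) E\<^esub> lmul (m + 1) E (sgn_mult m w) (jet_der E y)"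

lemma spencer_term_closed:
  assumes "left_module A E" "w \<in> grade \<Omega> m" "y \<in> carrier (J1 K \<Omega> E)"
  shows "spencer_term m E w y \<in> carrier (OM (m + 1) E)"
proof -
  interpret O: abelian_group "OM (m + 1) E" by (rule O_abelian_group[OF assms(1)])
  show ?thesis
    unfolding spencer_term_def
    using assms by (intro O.a_closed ot_closed lmul_closed[OF _ HOL.refl] sgn_mult_grade diff_grade
      jet_val_closed jet_der_closed)
qed

text \<open>Apply the Leibniz rule to each d(w a) and let a cross the tensor sign in the first part:
  dw then collects the value and the signed w the derivative.\<close>

lemma Oclass_leibniz:
  assumes E: "left_module A E" and w: "w \<in> grade \<Omega> m" and ys: "set ys \<subseteq> carrier A \<times> carrier E"
  shows "Oclass \<Omega> (m + 1) E (map (\<lambda>(a, e). (diff \<Omega> (w \<otimes> a), e)) ys) =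
    ot (m + 1) E (diff \<Omega> w) (sum_val E ys) \<oplus>\<^bsub>OM (m + 1) E\<^esub> lmul (m + 1) E (sgn_mult m w) (sum_der E ys)"
  using ys
proof (induction ys)
  interpret E: left_module A E by (rule E)
  interpret O: abelian_group "OM (m + 1) E" by (rule O_abelian_group[OF E])
  note s = sgn_mult_grade[OF w, of m]
  note l = lmul_additive[OF E HOL.refl s, of 1]
  case Nil
  have "additive_map E (OM (m + 1) E) (ot (m + 1) E (diff \<Omega> w))"
    by (rule additive_mapI) (simp_all add: ot_closed[OF E] ot_add_right[OF E] diff_grade w)
  from additive_map_zero[OF E.E.abelian_group_axioms O.abelian_group_axioms this]
    additive_map_zero[OF O_abelian_group[OF E] O.abelian_group_axioms l]
  show ?case by (simp add: Oclass_eq_lsum[OF E] sum_val_def sum_der_def)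
next
  interpret E: left_module A E by (rule E)
  interpret O: abelian_group "OM (m + 1) E" by (rule O_abelian_group[OF E])
  note s = sgn_mult_grade[OF w, of m]
  note l = lmul_additive[OF E HOL.refl s, of 1]
  case (Cons p ys)
  obtain a e where p: "p = (a, e)" "a \<in> carrier A" "e \<in> carrier E" using Cons.prems by auto
  have ys: "set ys \<subseteq> carrier A \<times> carrier E" using Cons.prems by simp
  have dw: "diff \<Omega> w \<in> grade \<Omega> (m + 1)" by (rule diff_grade[OF w])
  have sda: "sgn_mult m w \<otimes> diff \<Omega> a \<in> grade \<Omega> (m + 1)"
    by (rule mult_grade[OF s diff_A[OF p(2)]])
  have g: "diff \<Omega> (w \<otimes> b) \<in> grade \<Omega> (m + 1)" if "b \<in> carrier A" for b
    by (rule diff_grade[OF grade_mult_0[OF w that]])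
  have "Oclass \<Omega> (m + 1) E (map (\<lambda>(a, e). (diff \<Omega> (w \<otimes> a), e)) (p # ys)) =
      ot (m + 1) E (diff \<Omega> (w \<otimes> a)) e \<oplus>\<^bsub>OM (m + 1) E\<^esub>
      Oclass \<Omega> (m + 1) E (map (\<lambda>(a, e). (diff \<Omega> (w \<otimes> a), e)) ys)"
    using p ys g by (subst (1 3) Oclass_eq_lsum[OF E]) auto
  moreover have "ot (m + 1) E (diff \<Omega> (w \<otimes> a)) e =
      ot (m + 1) E (diff \<Omega> w) (a \<odot>\<^bsub>E\<^esub> e) \<oplus>\<^bsub>OM (m + 1) E\<^esub>
      lmul (m + 1) E (sgn_mult m w) (ot 1 E (diff \<Omega> a) e)"
    using p dw sda
    by (simp add: diff_mult[OF w] A_carrier ot_add_left[OF E] grade_mult_0 ot_balanced[OF E]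
        lmul_ot[OF E HOL.refl s] diff_A)
  moreover have "lmul (m + 1) E (sgn_mult m w) (sum_der E (p # ys)) =
      lmul (m + 1) E (sgn_mult m w) (ot 1 E (diff \<Omega> a) e) \<oplus>\<^bsub>OM (m + 1) E\<^esub>
      lmul (m + 1) E (sgn_mult m w) (sum_der E ys)"
    using p by (simp add: sum_der_Cons[OF E] additive_map_add[OF l] ot_closed[OF E] diff_A sum_der_closed[OF E ys])
  moreover have "ot (m + 1) E (diff \<Omega> w) (sum_val E (p # ys)) =
      ot (m + 1) E (diff \<Omega> w) (a \<odot>\<^bsub>E\<^esub> e) \<oplus>\<^bsub>OM (m + 1) E\<^esub> ot (m + 1) E (diff \<Omega> w) (sum_val E ys)"
    using p by (simp add: sum_val_Cons[OF E] ot_add_right[OF E dw] E.lsmult_closed sum_val_closed[OF E ys])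
  ultimately show ?case
    using Cons.IH[OF ys] p dw
    by (simp add: O.a_ac ot_closed[OF E] E.lsmult_closed sum_val_closed[OF E ys] diff_A
        additive_map_closed[OF l] sum_der_closed[OF E ys])
qed

lemma Spencer1_eq:
  assumes E: "left_module A E" and X: "X \<in> carrier (OM m (J1 K \<Omega> E))"
  shows "Spencer1 \<Omega> m E X = lsum (OM (m + 1) E) (\<lambda>(w, y). spencer_term m E w y) (rep X)"
proof -
  note r = O_rep[OF left_module_J1[OF E] X]
  have "Spencer1 \<Omega> m E X = lsum (OM (m + 1) E)
      (\<lambda>(w, y). Oclass \<Omega> (m + 1) E (map (\<lambda>(a, e). (diff \<Omega> (w \<otimes> a), e)) (summands y))) (rep X)"
    unfolding Spencer1_def
    by (subst Oclass_concat[OF E])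
      (use r J1_summands[OF E] in \<open>fastforce intro!: lsum_cong diff_grade grade_mult_0\<close>)+
  also have "\<dots> = lsum (OM (m + 1) E) (\<lambda>(w, y). spencer_term m E w y) (rep X)"
    by (rule lsum_cong)
      (use r J1_summands[OF E] in \<open>auto simp: Oclass_leibniz[OF E] spencer_term_def jet_val_def jet_der_def\<close>)
  finally show ?thesis .
qed

end

section \<open>Properties of the Spencer operators\<close>

context exterior_algebra
begin

lemma lmul_lmul:
  assumes E: "left_module A E" and "v \<in> grade \<Omega> p" "v' \<in> grade \<Omega> p'" "X \<in> carrier (OM r E)"
    "s = p' + r" "q = p + s"
  shows "lmul q E (v \<otimes> v') X = lmul q E v (lmul s E v' X)"
proof -
  have q: "q = (p + p') + r" using assms by simp
  have vv: "v \<otimes> v' \<in> grade \<Omega> (p + p')" using assms by (simp add: mult_grade)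
  show ?thesis
    by (rule O_ext[OF E O_abelian_group[OF E] lmul_additive[OF E q vv]
          additive_map_comp[OF lmul_additive[OF E assms(5,3)] lmul_additive[OF E assms(6,2)]] _ assms(4)])
      (simp add: lmul_ot[OF E q vv] lmul_ot[OF E assms(5,3)] lmul_ot[OF E assms(6,2)]
        grade_mult_r[OF E assms(5,3)] m_assoc grade_carrier[OF assms(2)] grade_carrier[OF assms(3)] grade_carrier)
qed

lemma lmul_minus:
  assumes E: "left_module A E" and "v \<in> grade \<Omega> p" "X \<in> carrier (OM r E)" "q = p + r"
  shows "lmul q E (\<ominus> v) X = \<ominus>\<^bsub>OM q E\<^esub> lmul q E v X"
proof -
  interpret O: abelian_group "OM q E" by (rule O_abelian_group[OF E])
  have "lmul q E (\<ominus> v) X \<oplus>\<^bsub>OM q E\<^esub> lmul q E v X = \<zero>\<^bsub>OM q E\<^esub>"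
    using lmul_add_left[OF E assms(4) grade_minus[OF assms(2)] assms(2,3)] lmul_zero[OF E assms(3,4)]
    by (simp add: l_neg grade_carrier[OF assms(2)])
  then show ?thesis
    using O.minus_equality lmul_closed[OF E assms(4) _ assms(3)] assms(2) grade_minus by simp
qed

lemma sgn_mult_1: "w \<in> carrier \<Omega> \<Longrightarrow> sgn_mult 1 w = \<ominus> w"
  by (simp add: sgn_mult_def One_nat_def l_minus)

context
  fixes E :: "('w, ('w, 'e) jet) module"
  assumes E: "left_module A E"
begin

interpretation E: left_module A E by (rule E)

text \<open>Balancing is the delicate point. On one side d(w b) yields the extra term (-1)^m w db
  \<otimes> v(y); on the other side the same term comes from the twist in the derivative of b
  y.\<close>

lemma bal_spencer_term: "bal m (J1 K \<Omega> E) (OM (m + 1) E) (spencer_term m E)"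
proof (rule balI[OF left_module_J1[OF E]])
  interpret O: abelian_group "OM (m + 1) E" by (rule O_abelian_group[OF E])
  note [simp] = J1_add[OF E] J1_smult[OF E] jet_val_closed[OF E] jet_der_closed[OF E] ot_closed[OF E]
    diff_grade sgn_mult_grade lmul_closed[OF E HOL.refl, where r = 1]
  fix w y assume w: "w \<in> grade \<Omega> m" and y: "y \<in> carrier (J1 K \<Omega> E)"
  show "spencer_term m E w y \<in> carrier (OM (m + 1) E)"
    by (rule spencer_term_closed[OF E w y])
  show "spencer_term m E w (y \<oplus>\<^bsub>J1 K \<Omega> E\<^esub> z) = spencer_term m E w y \<oplus>\<^bsub>OM (m + 1) E\<^esub> spencer_term m E w z"
    if z: "z \<in> carrier (J1 K \<Omega> E)" for z
    using w y z
    by (simp add: spencer_term_def ot_add_right[OF E] lmul_add_right[OF E HOL.refl] O.a_ac)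
  show "spencer_term m E (w \<oplus> v) y = spencer_term m E w y \<oplus>\<^bsub>OM (m + 1) E\<^esub> spencer_term m E v y"
    if v: "v \<in> grade \<Omega> m" for v
  proof -
    have "sgn_mult m (w \<oplus> v) = sgn_mult m w \<oplus> sgn_mult m v"
      using w v by (simp add: sgn_mult_def r_distr A_carrier[OF sgn_pow_grade] grade_carrier)
    then show ?thesis
      using w y v
      by (simp add: spencer_term_def diff_add grade_carrier ot_add_left[OF E]
          lmul_add_left[OF E HOL.refl sgn_mult_grade sgn_mult_grade] O.a_ac)
  qed
  show "spencer_term m E (w \<otimes> b) y = spencer_term m E w (b \<odot>\<^bsub>J1 K \<Omega> E\<^esub> y)" if b: "b \<in> carrier A" for b
  proof -
    note s = sgn_mult_grade[OF w, of m]
    have sb: "sgn_mult m (w \<otimes> b) = sgn_mult m w \<otimes> b"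
      using w b by (simp add: sgn_mult_def m_assoc A_carrier[OF sgn_pow_grade] A_carrier grade_carrier)
    have g: "sgn_mult m w \<otimes> diff \<Omega> b \<in> grade \<Omega> (m + 1)" by (rule mult_grade[OF s diff_A[OF b]])
    have "ot (m + 1) E (diff \<Omega> (w \<otimes> b)) (jet_val E y) =
        ot (m + 1) E (diff \<Omega> w) (b \<odot>\<^bsub>E\<^esub> jet_val E y) \<oplus>\<^bsub>OM (m + 1) E\<^esub>
        lmul (m + 1) E (sgn_mult m w) (ot 1 E (diff \<Omega> b) (jet_val E y))"
      using w b y g
      by (simp add: diff_mult[OF w] A_carrier ot_add_left[OF E] grade_mult_0 ot_balanced[OF E]
          lmul_ot[OF E HOL.refl s] diff_A)
    moreover have "lmul (m + 1) E (sgn_mult m (w \<otimes> b)) (jet_der E y) =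
        lmul (m + 1) E (sgn_mult m w) (lmul 1 E b (jet_der E y))"
      unfolding sb by (rule lmul_mult[OF E s b]) (simp_all add: y)
    moreover have "lmul (m + 1) E (sgn_mult m w) (ot 1 E (diff \<Omega> b) (jet_val E y) \<oplus>\<^bsub>OM 1 E\<^esub> lmul 1 E b (jet_der E y)) =
       lmul (m + 1) E (sgn_mult m w) (ot 1 E (diff \<Omega> b) (jet_val E y)) \<oplus>\<^bsub>OM (m + 1) E\<^esub>
       lmul (m + 1) E (sgn_mult m w) (lmul 1 E b (jet_der E y))"
      by (rule lmul_add_right[OF E HOL.refl s]) (simp_all add: b y diff_A lmul_0[OF E b])
    ultimately show ?thesis
      using w b y s
      by (simp add: spencer_term_def O.a_ac E.lsmult_closed diff_A lmul_0[OF E b])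
  qed
qed

lemma Spencer1_additive: "additive_map (OM m (J1 K \<Omega> E)) (OM (m + 1) E) (Spencer1 \<Omega> m E)"
  by (rule additive_map_cong[OF rep_additive[OF left_module_J1[OF E] O_abelian_group[OF E] bal_spencer_term]])
    (simp_all add: Spencer1_eq[OF E] O_abelian_group left_module_J1[OF E])

lemma Spencer1_ot:
  assumes "w \<in> grade \<Omega> m" "y \<in> carrier (J1 K \<Omega> E)"
  shows "Spencer1 \<Omega> m E (ot m (J1 K \<Omega> E) w y) = spencer_term m E w y"
  unfolding Spencer1_eq[OF E ot_closed[OF left_module_J1[OF E] assms]]
  by (rule rep_ot[OF left_module_J1[OF E] O_abelian_group[OF E] bal_spencer_term assms])

lemma Spencer1_hom: "Spencer1 \<Omega> m E \<in> mod_hom K (OM m (J1 K \<Omega> E)) (OM (m + 1) E)"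
proof (rule mod_homI[OF Spencer1_additive])
  fix k X assume k: "k \<in> carrier K" and X: "X \<in> carrier (OM m (J1 K \<Omega> E))"
  note J = left_module_J1[OF E]
  interpret M: module K "OM (m + 1) E" by (rule O_module[OF E])
  show "Spencer1 \<Omega> m E (k \<odot>\<^bsub>OM m (J1 K \<Omega> E)\<^esub> X) = k \<odot>\<^bsub>OM (m + 1) E\<^esub> Spencer1 \<Omega> m E X"
  proof (rule O_ext[OF J O_abelian_group[OF E] additive_map_comp[OF O_smult_additive[OF J k] Spencer1_additive]
        additive_map_comp[OF Spencer1_additive O_smult_additive[OF E k]] _ X])
    fix w y assume w: "w \<in> grade \<Omega> m" and y: "y \<in> carrier (J1 K \<Omega> E)"
    have "sgn_mult m (k \<odot>\<^bsub>\<Omega>\<^esub> w) = k \<odot>\<^bsub>\<Omega>\<^esub> sgn_mult m w"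
      using w k by (simp add: sgn_mult_def smult_mult_right A_carrier[OF sgn_pow_grade] grade_carrier)
    then show "Spencer1 \<Omega> m E (k \<odot>\<^bsub>OM m (J1 K \<Omega> E)\<^esub> ot m (J1 K \<Omega> E) w y) =
        k \<odot>\<^bsub>OM (m + 1) E\<^esub> Spencer1 \<Omega> m E (ot m (J1 K \<Omega> E) w y)"
      using w y k
      by (simp add: Spencer1_ot ot_smult[OF J] grade_smult spencer_term_def diff_smult grade_carrier
          M.smult_r_distr ot_closed[OF E] diff_grade jet_val_closed[OF E] jet_der_closed[OF E]
          lmul_closed[OF E HOL.refl] sgn_mult_grade ot_smult[OF E] lmul_smult[OF E HOL.refl])
  qed
qed

text \<open>The first term vanishes since d1 = 0, and the sign in degree 0 is 1.\<close>

lemma Spencer1_0_one: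
  assumes x: "x \<in> carrier (J1 K \<Omega> E)"
  shows "Spencer1 \<Omega> 0 E (ot 0 (J1 K \<Omega> E) \<one> x) = jet_der E x"
proof -
  interpret O: abelian_group "OM 1 E" by (rule O_abelian_group[OF E])
  show ?thesis
    using x by (simp add: Spencer1_ot one_grade spencer_term_def diff_one ot_zero[OF E] jet_val_closed[OF E]
        sgn_mult_def lmul_one[OF E] jet_der_closed[OF E])
qed

text \<open>On da \<otimes> y the term with d(da) vanishes and the sign in degree 1 leaves the
  negative of da d(y), which is a summand of D^II.\<close>

lemma Spencer1_jet_der:
  assumes x: "x \<in> carrier (J1 K \<Omega> (J1 K \<Omega> E))"
  shows "Spencer1 \<Omega> 1 E (jet_der (J1 K \<Omega> E) x) = \<ominus>\<^bsub>OM 2 E\<^esub> D_II \<Omega> E x"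
proof -
  note J = left_module_J1[OF E]
  interpret O: abelian_group "OM 2 E" by (rule O_abelian_group[OF E])
  note s = J1_summands[OF J x]
  note add = Spencer1_additive[of 1, simplified one_add_one]
  have m: "additive_map (OM 2 E) (OM 2 E) (\<lambda>X. \<ominus>\<^bsub>OM 2 E\<^esub> X)"
    by (rule additive_mapI) (simp_all add: O.minus_add)
  have c: "lmul 2 E (diff \<Omega> a) (jet_der E y) \<in> carrier (OM 2 E)"
    if "a \<in> carrier A" "y \<in> carrier (J1 K \<Omega> E)" for a y
    by (rule lmul_closed[OF E, of 2 1 1]) (use that in \<open>simp_all add: diff_A jet_der_closed[OF E]\<close>)
  have "Spencer1 \<Omega> 1 E (jet_der (J1 K \<Omega> E) x) =
      lsum (OM 2 E) (\<lambda>p. Spencer1 \<Omega> 1 E (case p of (a, y) \<Rightarrow> ot 1 (J1 K \<Omega> E) (diff \<Omega> a) y)) (summands x)"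
    unfolding jet_der_def sum_der_def
    by (rule additive_map_lsum[OF O_abelian_group[OF J] O.abelian_group_axioms add])
      (use s in \<open>auto intro!: ot_closed[OF J] diff_A\<close>)
  also have "\<dots> = lsum (OM 2 E) (\<lambda>p. \<ominus>\<^bsub>OM 2 E\<^esub> (case p of (a, y) \<Rightarrow> lmul 2 E (diff \<Omega> a) (jet_der E y))) (summands x)"
  proof (rule lsum_cong)
    fix p assume p: "p \<in> set (summands x)"
    obtain a y where ay: "p = (a, y)" by fastforce
    with p have a: "a \<in> carrier A" and y: "y \<in> carrier (J1 K \<Omega> E)" using s by auto
    have "Spencer1 \<Omega> 1 E (ot 1 (J1 K \<Omega> E) (diff \<Omega> a) y) = \<ominus>\<^bsub>OM 2 E\<^esub> lmul 2 E (diff \<Omega> a) (jet_der E y)"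
      using a y c[OF a y] lmul_minus[OF E diff_A[OF a] jet_der_closed[OF E y], of 2]
      by (simp add: Spencer1_ot diff_A spencer_term_def diff_diff A_carrier ot_zero[OF E] jet_val_closed[OF E]
          sgn_mult_1 diff_closed)
    then show "Spencer1 \<Omega> 1 E (case p of (a, y) \<Rightarrow> ot 1 (J1 K \<Omega> E) (diff \<Omega> a) y) =
        \<ominus>\<^bsub>OM 2 E\<^esub> (case p of (a, y) \<Rightarrow> lmul 2 E (diff \<Omega> a) (jet_der E y))"
      by (simp add: ay)
  qed
  also have "\<dots> = \<ominus>\<^bsub>OM 2 E\<^esub> D_II \<Omega> E x"
    unfolding D_II_eq[OF E x]
    by (rule additive_map_lsum[OF O.abelian_group_axioms O.abelian_group_axioms m, symmetric])
      (use s c in auto)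
  finally show ?thesis .
qed

text \<open>It replaces a condition stated on representatives by one on a composite of additive
  natural maps, through which submodule and naturality properties of holonomic jets are
  proved.\<close>

lemma D_II_zero_iff:
  assumes "x \<in> carrier (J1 K \<Omega> (J1 K \<Omega> E))"
  shows "D_II \<Omega> E x = \<zero>\<^bsub>OM 2 E\<^esub> \<longleftrightarrow> Spencer1 \<Omega> 1 E (jet_der (J1 K \<Omega> E) x) = \<zero>\<^bsub>OM 2 E\<^esub>"
proof -
  interpret O: abelian_group "OM 2 E" by (rule O_abelian_group[OF E])
  have "\<ominus>\<^bsub>OM 2 E\<^esub> \<zero>\<^bsub>OM 2 E\<^esub> = \<zero>\<^bsub>OM 2 E\<^esub>"
    by (rule O.minus_equality) simp_all
  then show ?thesis
    using D_I_D_II_closed(2)[OF E assms] O.minus_minus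
    by (metis Spencer1_jet_der[OF assms])
qed

text \<open>On elementary tensors this is d(a w) = da w + a dw. The first term on the right measures
  the failure of \<open>A\<close>-linearity, to be compensated in
  \<open>Spencer1_jet_der_smult\<close>.\<close>

lemma Spencer1_lmul:
  assumes a: "a \<in> carrier A" and X: "X \<in> carrier (OM 1 (J1 K \<Omega> E))"
  shows "Spencer1 \<Omega> 1 E (lmul 1 (J1 K \<Omega> E) a X) =
    lmul 2 E (diff \<Omega> a) (Omap \<Omega> 1 E (jet_val E) X) \<oplus>\<^bsub>OM 2 E\<^esub> lmul 2 E a (Spencer1 \<Omega> 1 E X)"
proof -
  note J = left_module_J1[OF E] and h = jet_val_hom[OF E]
  interpret O: abelian_group "OM 2 E" by (rule O_abelian_group[OF E])
  note add = Spencer1_additive[of 1, simplified one_add_one]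
  have l1: "additive_map (OM 1 E) (OM 2 E) (lmul 2 E (diff \<Omega> a))"
    by (rule lmul_additive[OF E, of _ 1]) (simp_all add: diff_A a)
  have l2: "additive_map (OM 2 E) (OM 2 E) (lmul 2 E a)"
    by (rule lmul_0(2)[OF E a])
  note f1 = additive_map_comp[OF Omap_additive[OF J E h] l1] and f2 = additive_map_comp[OF add l2]
  have f: "additive_map (OM 1 (J1 K \<Omega> E)) (OM 2 E)
      (\<lambda>X. lmul 2 E (diff \<Omega> a) (Omap \<Omega> 1 E (jet_val E) X) \<oplus>\<^bsub>OM 2 E\<^esub> lmul 2 E a (Spencer1 \<Omega> 1 E X))"
    by (rule additive_mapI)
      (simp_all add: additive_map_closed[OF f1] additive_map_closed[OF f2] additive_map_add[OF f1]
        additive_map_add[OF f2] O.a_ac)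
  show ?thesis
  proof (rule O_ext[OF J O.abelian_group_axioms additive_map_comp[OF lmul_0(2)[OF J a] add] f _ X])
    fix w y assume w: "w \<in> grade \<Omega> 1" and y: "y \<in> carrier (J1 K \<Omega> E)"
    have dw: "diff \<Omega> w \<in> grade \<Omega> 2" using diff_grade[OF w] by simp
    have daw: "diff \<Omega> a \<otimes> w \<in> grade \<Omega> 2" using mult_grade[OF diff_A[OF a] w] by simp
    note mw = grade_minus[OF w]
    have dy: "jet_der E y \<in> carrier (OM 1 E)" by (rule jet_der_closed[OF E y])
    have lw: "lmul 2 E (\<ominus> w) (jet_der E y) \<in> carrier (OM 2 E)"
      by (rule lmul_closed[OF E _ mw dy]) simp
    have "lmul 2 E (\<ominus> (a \<otimes> w)) (jet_der E y) = lmul 2 E (a \<otimes> (\<ominus> w)) (jet_der E y)"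
      using w a by (simp add: r_minus A_carrier grade_carrier)
    also have "\<dots> = lmul 2 E a (lmul 2 E (\<ominus> w) (jet_der E y))"
      by (rule lmul_lmul[OF E _ mw dy, of _ 0]) (simp_all add: a grade_0)
    finally have e1: "lmul 2 E (\<ominus> (a \<otimes> w)) (jet_der E y) = lmul 2 E a (lmul 2 E (\<ominus> w) (jet_der E y))" .
    have e2: "lmul 2 E a (ot 2 E (diff \<Omega> w) (jet_val E y) \<oplus>\<^bsub>OM 2 E\<^esub> lmul 2 E (\<ominus> w) (jet_der E y)) =
        ot 2 E (a \<otimes> diff \<Omega> w) (jet_val E y) \<oplus>\<^bsub>OM 2 E\<^esub> lmul 2 E a (lmul 2 E (\<ominus> w) (jet_der E y))"
      using dw y lw by (simp add: additive_map_add[OF l2] ot_closed[OF E] jet_val_closed[OF E] lmul_0[OF E a])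
    have e3: "lmul 2 E (diff \<Omega> a) (ot 1 E w (jet_val E y)) = ot 2 E (diff \<Omega> a \<otimes> w) (jet_val E y)"
      by (rule lmul_ot[OF E, of _ 1]) (simp_all add: diff_A a w jet_val_closed[OF E y])
    show "Spencer1 \<Omega> 1 E (lmul 1 (J1 K \<Omega> E) a (ot 1 (J1 K \<Omega> E) w y)) =
        lmul 2 E (diff \<Omega> a) (Omap \<Omega> 1 E (jet_val E) (ot 1 (J1 K \<Omega> E) w y)) \<oplus>\<^bsub>OM 2 E\<^esub>
        lmul 2 E a (Spencer1 \<Omega> 1 E (ot 1 (J1 K \<Omega> E) w y))"
      using a w y dw daw e1 e2 e3 lw
      by (simp add: lmul_0[OF J a] Omap_ot[OF J E h] Spencer1_ot grade_0_mult spencer_term_def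
          sgn_mult_1 grade_carrier A_carrier diff_mult_A ot_add_left[OF E] jet_val_closed[OF E] O.a_ac
          ot_closed[OF E] lmul_0[OF E a])
  qed
qed

end

lemma Spencer1_natural:
  assumes E: "left_module A E" and F: "left_module A F" and f: "f \<in> mod_hom A E F"
    and X: "X \<in> carrier (OM m (J1 K \<Omega> E))"
  shows "Spencer1 \<Omega> m F (Omap \<Omega> m (J1 K \<Omega> F) (J1_map K \<Omega> F f) X) = Omap \<Omega> (m + 1) F f (Spencer1 \<Omega> m E X)"
proof (rule O_ext[OF left_module_J1[OF E] O_abelian_group[OF F] _ _ _ X])
  note JE = left_module_J1[OF E] and JF = left_module_J1[OF F]
  note Jf = J1_map_hom[OF E F f] and p = J1_map_props[OF E F f]
  show "additive_map (OM m (J1 K \<Omega> E)) (OM (m + 1) F)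
     (\<lambda>X. Spencer1 \<Omega> m F (Omap \<Omega> m (J1 K \<Omega> F) (J1_map K \<Omega> F f) X))"
    by (rule additive_map_comp[OF Omap_additive[OF JE JF Jf] Spencer1_additive[OF F]])
  show "additive_map (OM m (J1 K \<Omega> E)) (OM (m + 1) F) (\<lambda>X. Omap \<Omega> (m + 1) F f (Spencer1 \<Omega> m E X))"
    by (rule additive_map_comp[OF Spencer1_additive[OF E] Omap_additive[OF E F f]])
  fix w y assume w: "w \<in> grade \<Omega> m" and y: "y \<in> carrier (J1 K \<Omega> E)"
  show "Spencer1 \<Omega> m F (Omap \<Omega> m (J1 K \<Omega> F) (J1_map K \<Omega> F f) (ot m (J1 K \<Omega> E) w y)) =
    Omap \<Omega> (m + 1) F f (Spencer1 \<Omega> m E (ot m (J1 K \<Omega> E) w y))"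
    using w y
    by (simp add: Omap_ot[OF JE JF Jf] Spencer1_ot[OF E] Spencer1_ot[OF F] p spencer_term_def
        additive_map_add[OF Omap_additive[OF E F f]] ot_closed[OF E] diff_grade jet_val_closed[OF E]
        lmul_closed[OF E HOL.refl] sgn_mult_grade jet_der_closed[OF E] Omap_ot[OF E F f]
        Omap_lmul[OF E F f sgn_mult_grade jet_der_closed[OF E] HOL.refl])
qed

end

section \<open>Holonomic and sesquiholonomic jets\<close>

lemma l_hol_id [simp]: "l_hol n E = (\<lambda>x. x)"
  by (rule ext) (simp add: l_hol_def)

lemma l_sesq_id [simp]: "l_sesq n E = (\<lambda>x. x)"
  by (rule ext) (simp add: l_sesq_def)

lemma t_incl_id [simp]: "t_incl n E = (\<lambda>x. x)"
  by (rule ext) (simp add: t_incl_def)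

context exterior_algebra
begin

text \<open>Negatives in \<open>H\<close> come from the action of -1, that is, from closure under
  scalars.\<close>

lemma left_module_subset:
  fixes X :: "('w, 'x) module"
  assumes X: "left_module A X" and H: "H \<subseteq> carrier X" "\<zero>\<^bsub>X\<^esub> \<in> H"
    "\<And>x y. \<lbrakk>x \<in> H; y \<in> H\<rbrakk> \<Longrightarrow> x \<oplus>\<^bsub>X\<^esub> y \<in> H"
    "\<And>a x. \<lbrakk>a \<in> carrier A; x \<in> H\<rbrakk> \<Longrightarrow> a \<odot>\<^bsub>X\<^esub> x \<in> H"
  shows "left_module A (X\<lparr>carrier := H\<rparr>)"
proof -
  interpret X: left_module A X by (rule X)
  have c: "x \<in> carrier X" if "x \<in> H" for x using that H(1) by auto
  have m1: "\<ominus> \<one> \<in> carrier A" using grade_minus[OF one_grade] by (simp add: grade_0)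
  have inv: "(\<ominus> \<one>) \<odot>\<^bsub>X\<^esub> x \<oplus>\<^bsub>X\<^esub> x = \<zero>\<^bsub>X\<^esub>" if "x \<in> H" for x
    using X.lsmult_l_distr[OF m1 one_A c[OF that]] X.lsmult_one[OF c[OF that]] c[OF that]
    by (simp add: A_simps l_neg left_module_zero[OF X])
  have "abelian_group (X\<lparr>carrier := H\<rparr>)"
  proof (rule abelian_groupI)
    fix x assume "x \<in> carrier (X\<lparr>carrier := H\<rparr>)"
    then show "\<exists>y\<in>carrier (X\<lparr>carrier := H\<rparr>). y \<oplus>\<^bsub>X\<lparr>carrier := H\<rparr>\<^esub> x = \<zero>\<^bsub>X\<lparr>carrier := H\<rparr>\<^esub>"
      using H(4)[OF m1] inv by auto
  qed (use H c in \<open>auto simp: X.E.a_ac\<close>)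
  then show ?thesis
    by (intro left_module.intro left_module_axioms.intro A.ring_axioms)
      (use H c in \<open>auto simp: X.lsmult_l_distr X.lsmult_r_distr X.lsmult_assoc X.lsmult_one\<close>)
qed

lemma mod_hom_subset:
  fixes X :: "('w, 'x) module" and Y :: "('w, 'y) module"
  assumes "f \<in> mod_hom A X Y" "H \<subseteq> carrier X" "\<And>x. x \<in> H \<Longrightarrow> f x \<in> H'"
  shows "f \<in> mod_hom A (X\<lparr>carrier := H\<rparr>) (Y\<lparr>carrier := H'\<rparr>)"
  using assms by (auto simp: mod_hom_def subset_iff)

text \<open>Two defects cancel. The twist da \<otimes> v(x) in the derivative of a x is sent to
  minus da d(v(x)), while \<open>Spencer1_lmul\<close> adds da times the image of d(x) under Omega^1
  v. Vanishing of D^I says that d(v(x)) is that image.\<close>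

lemma Spencer1_jet_der_smult:
  assumes E: "left_module A E" and x: "x \<in> carrier (J1 K \<Omega> (J1 K \<Omega> E))"
    and DI: "D_I \<Omega> E x = \<zero>\<^bsub>OM 1 E\<^esub>" and a: "a \<in> carrier A"
  shows "Spencer1 \<Omega> 1 E (jet_der (J1 K \<Omega> E) (a \<odot>\<^bsub>J1 K \<Omega> (J1 K \<Omega> E)\<^esub> x)) =
    lmul 2 E a (Spencer1 \<Omega> 1 E (jet_der (J1 K \<Omega> E) x))"
proof -
  let ?J = "J1 K \<Omega> E"
  note J = left_module_J1[OF E] and h = jet_val_hom[OF E]
  interpret O: abelian_group "OM 2 E" by (rule O_abelian_group[OF E])
  interpret O1: abelian_group "OM 1 E" by (rule O_abelian_group[OF E])
  note add = Spencer1_additive[OF E, of 1, simplified one_add_one]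
  note v = jet_val_closed[OF J x] and d = jet_der_closed[OF J x]
  let ?L = "lmul 2 E (diff \<Omega> a) (jet_der E (jet_val ?J x))"
  have L: "?L \<in> carrier (OM 2 E)"
    by (rule lmul_closed[OF E _ diff_A[OF a] jet_der_closed[OF E v]]) simp
  have "Spencer1 \<Omega> 1 E (ot 1 ?J (diff \<Omega> a) (jet_val ?J x)) = \<ominus>\<^bsub>OM 2 E\<^esub> ?L"
    using a v L lmul_minus[OF E diff_A[OF a] jet_der_closed[OF E v], of 2]
    by (simp add: Spencer1_ot[OF E] diff_A spencer_term_def diff_diff A_carrier ot_zero[OF E]
        jet_val_closed[OF E] sgn_mult_1 diff_closed)
  \<comment> \<open>The semiholonomic condition enters here and makes the two defects refer to the
    same form \<open>?L\<close>.\<close>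
  moreover have "jet_der E (jet_val ?J x) = Omap \<Omega> 1 E (jet_val E) (jet_der ?J x)"
    using jet_der_jet_val[OF E x] DI Omap_closed[OF J E h d] by simp
  then have "Spencer1 \<Omega> 1 E (lmul 1 ?J a (jet_der ?J x)) =
      ?L \<oplus>\<^bsub>OM 2 E\<^esub> lmul 2 E a (Spencer1 \<Omega> 1 E (jet_der ?J x))"
    by (simp add: Spencer1_lmul[OF E a d])
  moreover have "lmul 2 E a (Spencer1 \<Omega> 1 E (jet_der ?J x)) \<in> carrier (OM 2 E)"
    by (rule lmul_0(1)[OF E a additive_map_closed[OF add d]])
  ultimately show ?thesis
    using L a d v
    by (simp add: J1_smult[OF J a x] additive_map_add[OF add] ot_closed[OF J] diff_A lmul_0[OF J a]
        O.a_assoc[symmetric] O.l_neg)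
qed

text \<open>\<open>M\<close> stands for J^{n-1} and \<open>N\<close> for J^{n-2}, with
  \<open>M\<close> contained in J^1 N; the identity function inside \<open>J1_map\<close> is that
  inclusion. Detached from the recursion, the conditions can be treated for all levels
  together.\<close>

definition sesq_jets where
  "sesq_jets M N = {x \<in> carrier (J1 K \<Omega> M). D_I \<Omega> N (J1_map K \<Omega> (J1 K \<Omega> N) (\<lambda>x. x) x) = \<zero>\<^bsub>OM 1 N\<^esub>}"

definition hol_jets where
  "hol_jets M N = {x \<in> sesq_jets M N. D_II \<Omega> N (J1_map K \<Omega> (J1 K \<Omega> N) (\<lambda>x. x) x) = \<zero>\<^bsub>OM 2 N\<^esub>}"

text \<open>The first set is the equaliser of the linear maps \<open>?u\<close> and
  \<open>?v\<close>, by \<open>D_I_zero_iff\<close>. The second is the kernel of \<open>?s\<close>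
  on it: \<open>?s\<close> is additive everywhere, and on the equaliser it is also compatible with
  scalars from \<open>A\<close>.\<close>

lemma left_module_jets:
  fixes M N :: "('w, ('w, 'e) jet) module"
  assumes M: "left_module A M" and N: "left_module A N" and i: "(\<lambda>x. x) \<in> mod_hom A M (J1 K \<Omega> N)"
  shows "left_module A ((J1 K \<Omega> M)\<lparr>carrier := sesq_jets M N\<rparr>)"
    and "left_module A ((J1 K \<Omega> M)\<lparr>carrier := hol_jets M N\<rparr>)"
proof -
  let ?j = "J1_map K \<Omega> (J1 K \<Omega> N) (\<lambda>x. x)" and ?J = "J1 K \<Omega> N" and ?M = "J1 K \<Omega> M"
  let ?u = "\<lambda>x. jet_val ?J (?j x)" and ?v = "\<lambda>x. J1_map K \<Omega> N (jet_val N) (?j x)"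
  note JM = left_module_J1[OF M] and JN = left_module_J1[OF N]
  note j = J1_map_hom[OF M JN i]
  note jc = additive_map_closed[OF mod_hom_additive[OF j]]
  note u = mod_hom_comp[OF j jet_val_hom[OF JN]]
  note v = mod_hom_comp[OF j J1_map_hom[OF JN N jet_val_hom[OF N]]]
  interpret JM: left_module A ?M by (rule JM)
  interpret JN: left_module A ?J by (rule JN)
  interpret O: abelian_group "OM 2 N" by (rule O_abelian_group[OF N])
  let ?s = "\<lambda>x. Spencer1 \<Omega> 1 N (jet_der ?J (?j x))"
  have s: "additive_map ?M (OM 2 N) ?s"
    by (rule additive_map_comp[OF additive_map_comp[OF mod_hom_additive[OF j] jet_der_additive[OF JN]]
          Spencer1_additive[OF N, of 1, simplified one_add_one]])
  have sesq: "sesq_jets M N = {x \<in> carrier ?M. ?u x = ?v x}"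
    using D_I_zero_iff[OF N jc] by (auto simp: sesq_jets_def)
  have hol: "hol_jets M N = {x \<in> sesq_jets M N. ?s x = \<zero>\<^bsub>OM 2 N\<^esub>}"
    using D_II_zero_iff[OF N jc] by (auto simp: hol_jets_def sesq_jets_def)
  note ab = JM.E.abelian_group_axioms JN.E.abelian_group_axioms
  have z: "\<zero>\<^bsub>?M\<^esub> \<in> sesq_jets M N"
    using additive_map_zero[OF ab mod_hom_additive[OF u]] additive_map_zero[OF ab mod_hom_additive[OF v]]
    by (simp add: sesq)
  have a: "x \<oplus>\<^bsub>?M\<^esub> y \<in> sesq_jets M N" if "x \<in> sesq_jets M N" "y \<in> sesq_jets M N" for x y
    using that additive_map_add[OF mod_hom_additive[OF u], of x y] additive_map_add[OF mod_hom_additive[OF v], of x y]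
    by (simp add: sesq)
  have m: "b \<odot>\<^bsub>?M\<^esub> x \<in> sesq_jets M N" if "b \<in> carrier A" "x \<in> sesq_jets M N" for b x
    using that mod_hom_smult[OF u, of b x] mod_hom_smult[OF v, of b x]
    by (simp add: sesq JM.lsmult_closed)
  have c: "x \<in> carrier ?M" if "x \<in> sesq_jets M N" for x using that by (simp add: sesq)
  show "left_module A (?M\<lparr>carrier := sesq_jets M N\<rparr>)"
    by (rule left_module_subset[OF JM _ z a m]) (auto dest: c)
  show "left_module A (?M\<lparr>carrier := hol_jets M N\<rparr>)"
  proof (rule left_module_subset[OF JM])
    show "hol_jets M N \<subseteq> carrier ?M" using c by (auto simp: hol)
    show "\<zero>\<^bsub>?M\<^esub> \<in> hol_jets M N"
      using z additive_map_zero[OF ab(1) O.abelian_group_axioms s] by (simp add: hol)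
    show "x \<oplus>\<^bsub>?M\<^esub> y \<in> hol_jets M N" if "x \<in> hol_jets M N" "y \<in> hol_jets M N" for x y
      using that a c additive_map_add[OF s, of x y] by (simp add: hol)
    show "b \<odot>\<^bsub>?M\<^esub> x \<in> hol_jets M N" if b: "b \<in> carrier A" and x: "x \<in> hol_jets M N" for b x
    proof -
      have x': "x \<in> sesq_jets M N" "?s x = \<zero>\<^bsub>OM 2 N\<^esub>" using x by (simp_all add: hol)
      have "?s (b \<odot>\<^bsub>?M\<^esub> x) = lmul 2 N b (?s x)"
        using Spencer1_jet_der_smult[OF N jc[OF c[OF x'(1)]] _ b] x'(1)
        by (simp add: mod_hom_smult[OF j b c[OF x'(1)]] sesq_jets_def)
      also have "\<dots> = \<zero>\<^bsub>OM 2 N\<^esub>"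
        unfolding x'(2)
        by (rule additive_map_zero[OF O.abelian_group_axioms O.abelian_group_axioms lmul_0(2)[OF N b]])
      finally show ?thesis using m[OF b x'(1)] by (simp add: hol)
    qed
  qed
qed

text \<open>Assumption \<open>fg\<close> says that \<open>f\<close> is a restriction of J^1 g, so
  J^1 f is intertwined with J^1 J^1 g after passing to J^1 J^1 N. There both conditions are
  expressed by natural maps: two projections to J^1 N, and the Spencer operator applied to the
  derivative.\<close>

lemma J1_map_jets:
  fixes M N M' N' :: "('w, ('w, 'e) jet) module"
  assumes M: "left_module A M" and N: "left_module A N" and i: "(\<lambda>x. x) \<in> mod_hom A M (J1 K \<Omega> N)"
    and M': "left_module A M'" and N': "left_module A N'" and i': "(\<lambda>x. x) \<in> mod_hom A M' (J1 K \<Omega> N')"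
    and f: "f \<in> mod_hom A M M'" and g: "g \<in> mod_hom A N N'"
    and fg: "\<And>m. m \<in> carrier M \<Longrightarrow> f m = J1_map K \<Omega> N' g m"
  shows "x \<in> sesq_jets M N \<Longrightarrow> J1_map K \<Omega> M' f x \<in> sesq_jets M' N'"
    and "x \<in> hol_jets M N \<Longrightarrow> J1_map K \<Omega> M' f x \<in> hol_jets M' N'"
proof -
  let ?J = "J1 K \<Omega> N" and ?J' = "J1 K \<Omega> N'"
  note J = left_module_J1[OF N] and J' = left_module_J1[OF N']
  note Jg = J1_map_hom[OF N N' g]
  let ?z = "J1_map K \<Omega> ?J (\<lambda>x. x) x" and ?y = "J1_map K \<Omega> M' f x"
  let ?z' = "J1_map K \<Omega> ?J' (\<lambda>x. x) ?y"
  have main: "?z \<in> carrier (J1 K \<Omega> ?J) \<and> ?y \<in> carrier (J1 K \<Omega> M') \<and>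
      ?z' = J1_map K \<Omega> ?J' (J1_map K \<Omega> N' g) ?z \<and> ?z' \<in> carrier (J1 K \<Omega> ?J')"
    if x: "x \<in> carrier (J1 K \<Omega> M)"
  proof -
    have "?z' = J1_map K \<Omega> ?J' f x"
      using J1_map_comp[OF M M' J' f i' x] by simp
    also have "\<dots> = J1_map K \<Omega> ?J' (J1_map K \<Omega> N' g) x"
      by (rule J1_map_cong[OF M x fg])
    also have "\<dots> = J1_map K \<Omega> ?J' (J1_map K \<Omega> N' g) ?z"
      using J1_map_comp[OF M J J' i Jg x] by simp
    finally show ?thesis
      using J1_map_props(1)[OF M J i x] J1_map_props(1)[OF M M' f x]
        J1_map_props(1)[OF M' J' i' J1_map_props(1)[OF M M' f x]] by simp
  qed
  have sesq: "?y \<in> sesq_jets M' N'" if x: "x \<in> sesq_jets M N"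
  proof -
    have "x \<in> carrier (J1 K \<Omega> M)" using x by (simp add: sesq_jets_def)
    note m = main[OF this]
    have z: "?z \<in> carrier (J1 K \<Omega> ?J)" using m by blast
    have eq: "jet_val ?J ?z = J1_map K \<Omega> N (jet_val N) ?z"
      using D_I_zero_iff[OF N z] x by (simp add: sesq_jets_def)
    have "jet_val ?J' ?z' = J1_map K \<Omega> N' g (jet_val ?J ?z)"
      using m J1_map_props(2)[OF J J' Jg z] by simp
    also have "\<dots> = J1_map K \<Omega> N' (\<lambda>e. g (jet_val N e)) ?z"
      unfolding eq by (rule J1_map_comp[OF J N N' jet_val_hom[OF N] g z])
    also have "\<dots> = J1_map K \<Omega> N' (\<lambda>e. jet_val N' (J1_map K \<Omega> N' g e)) ?z"
      by (rule J1_map_cong[OF J z]) (simp add: J1_map_props(2)[OF N N' g])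
    also have "\<dots> = J1_map K \<Omega> N' (jet_val N') ?z'"
      using m J1_map_comp[OF J J' N' Jg jet_val_hom[OF N'] z] by simp
    finally show ?thesis
      using m D_I_zero_iff[OF N', of ?z'] unfolding sesq_jets_def by blast
  qed
  then show "x \<in> sesq_jets M N \<Longrightarrow> ?y \<in> sesq_jets M' N'" .
  show "?y \<in> hol_jets M' N'" if x: "x \<in> hol_jets M N"
  proof -
    have xs: "x \<in> sesq_jets M N" using x by (simp add: hol_jets_def)
    then have "x \<in> carrier (J1 K \<Omega> M)" by (simp add: sesq_jets_def)
    note m = main[OF this]
    have z: "?z \<in> carrier (J1 K \<Omega> ?J)" using m by blast
    have "Spencer1 \<Omega> 1 N' (jet_der ?J' ?z') = Omap \<Omega> 2 N' g (Spencer1 \<Omega> 1 N (jet_der ?J ?z))"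
      using m J1_map_props(3)[OF J J' Jg z]
        Spencer1_natural[OF N N' g jet_der_closed[OF J z], simplified one_add_one] by simp
    also have "Spencer1 \<Omega> 1 N (jet_der ?J ?z) = \<zero>\<^bsub>OM 2 N\<^esub>"
      using D_II_zero_iff[OF N z] x by (simp add: hol_jets_def)
    also have "Omap \<Omega> 2 N' g \<zero>\<^bsub>OM 2 N\<^esub> = \<zero>\<^bsub>OM 2 N'\<^esub>"
      by (rule additive_map_zero[OF O_abelian_group[OF N] O_abelian_group[OF N'] Omap_additive[OF N N' g]])
    finally show ?thesis
      using m sesq[OF xs] D_II_zero_iff[OF N', of ?z'] unfolding hol_jets_def by blast
  qed
qed

lemma J_Suc_Suc:
  "J K \<Omega> (Suc (Suc n)) E = (J1 K \<Omega> (J K \<Omega> (Suc n) E))\<lparr>carrier := hol_jets (J K \<Omega> (Suc n) E) (J K \<Omega> n E)\<rparr>"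
  by (simp add: hol_jets_def sesq_jets_def)

lemma SJ_Suc_Suc:
  "SJ K \<Omega> (Suc (Suc n)) E = (J1 K \<Omega> (J K \<Omega> (Suc n) E))\<lparr>carrier := sesq_jets (J K \<Omega> (Suc n) E) (J K \<Omega> n E)\<rparr>"
  by (simp add: sesq_jets_def)

declare J.simps(3) [simp del] SJ.simps(3) [simp del]

lemma mod_hom_inclusion:
  fixes X :: "('w, 'x) module"
  shows "H \<subseteq> carrier X \<Longrightarrow> (\<lambda>x. x) \<in> mod_hom A (X\<lparr>carrier := H\<rparr>) X"
  by (auto simp: mod_hom_def)

lemma sesq_jets_subset: "sesq_jets M N \<subseteq> carrier (J1 K \<Omega> M)"
  by (auto simp: sesq_jets_def)

lemma hol_jets_subset: "hol_jets M N \<subseteq> sesq_jets M N"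
  by (auto simp: hol_jets_def)

lemma hol_jets_carrier: "hol_jets M N \<subseteq> carrier (J1 K \<Omega> M)"
  by (auto simp: hol_jets_def sesq_jets_def)

text \<open>Two consecutive levels and the inclusion between them go through the induction, because
  J^{n+2} is formed from J^{n+1}, J^n and the inclusion of J^{n+1} in J^1 J^n.\<close>

lemma J_module_aux:
  assumes "left_module A E"
  shows "left_module A (J K \<Omega> n E) \<and> left_module A (J K \<Omega> (Suc n) E) \<and>
    (\<lambda>x. x) \<in> mod_hom A (J K \<Omega> (Suc n) E) (J1 K \<Omega> (J K \<Omega> n E))"
proof (induction n)
  case 0
  then show ?case by (simp add: assms left_module_J1 mod_hom_id)
next
  case (Suc n)
  then have "left_module A (J K \<Omega> (Suc (Suc n)) E)"
    unfolding J_Suc_Suc by (intro left_module_jets(2)) simp_all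
  moreover have "(\<lambda>x. x) \<in> mod_hom A (J K \<Omega> (Suc (Suc n)) E) (J1 K \<Omega> (J K \<Omega> (Suc n) E))"
    unfolding J_Suc_Suc by (rule mod_hom_inclusion[OF hol_jets_carrier])
  ultimately show ?case using Suc by simp
qed

lemmas J_module = conjunct1[OF J_module_aux]
lemmas J_incl = conjunct2[OF conjunct2[OF J_module_aux]]

text \<open>Sesquiholonomic jets arise in one step from holonomic ones and not from each other, so a
  case distinction takes the place of induction.\<close>

lemma SJ_module:
  assumes E: "left_module A E"
  shows "left_module A (SJ K \<Omega> n E)"
proof (cases n)
  case 0
  then show ?thesis by (simp add: E)
next
  case (Suc m)
  show ?thesis
  proof (cases m)
    case 0
    then show ?thesis using Suc by (simp add: left_module_J1 E)
  next
    case (Suc k)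
    then show ?thesis
      using \<open>n = Suc m\<close> left_module_jets(1)[OF J_module[OF E] J_module[OF E] J_incl[OF E]]
      by (simp add: SJ_Suc_Suc)
  qed
qed

lemma SJ_incl: "(\<lambda>x. x) \<in> mod_hom A (SJ K \<Omega> (Suc n) E) (J1 K \<Omega> (J K \<Omega> n E))"
  by (cases n) (simp_all add: mod_hom_id SJ_Suc_Suc mod_hom_inclusion sesq_jets_subset)

lemma J_SJ_incl: "(\<lambda>x. x) \<in> mod_hom A (J K \<Omega> n E) (SJ K \<Omega> n E)"
proof (cases n)
  case (Suc m)
  then show ?thesis
    using hol_jets_subset
    by (cases m) (auto simp: mod_hom_id SJ_Suc_Suc J_Suc_Suc mod_hom_def)
qed (simp add: mod_hom_id)

context
  fixes E F :: "('w, ('w, 'e) jet) module" and f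
  assumes E: "left_module A E" and F: "left_module A F" and f: "f \<in> mod_hom A E F"
begin

text \<open>Two levels again: \<open>J1_map_jets\<close> needs the map on J^{n+1} as a restriction
  of J^1 applied to the map on J^n.\<close>

lemma J_map_hom_aux:
  "J_map K \<Omega> n F f \<in> mod_hom A (J K \<Omega> n E) (J K \<Omega> n F) \<and>
    J_map K \<Omega> (Suc n) F f \<in> mod_hom A (J K \<Omega> (Suc n) E) (J K \<Omega> (Suc n) F)"
proof (induction n)
  case 0
  then show ?case by (simp add: f J1_map_hom[OF E F f])
next
  case (Suc n)
  have "J_map K \<Omega> (Suc (Suc n)) F f \<in> mod_hom A (J K \<Omega> (Suc (Suc n)) E) (J K \<Omega> (Suc (Suc n)) F)"
    unfolding J_Suc_Suc J_map.simps(2)[of _ _ "Suc n"]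
  proof (rule mod_hom_subset)
    show "J1_map K \<Omega> (J K \<Omega> (Suc n) F) (J_map K \<Omega> (Suc n) F f) x \<in> hol_jets (J K \<Omega> (Suc n) F) (J K \<Omega> n F)"
      if "x \<in> hol_jets (J K \<Omega> (Suc n) E) (J K \<Omega> n E)" for x
      by (rule J1_map_jets(2)[OF J_module[OF E] J_module[OF E] J_incl[OF E] J_module[OF F] J_module[OF F]
            J_incl[OF F] _ _ _ that, where g = "J_map K \<Omega> n F f"]) (use Suc in simp_all)
  qed (use Suc hol_jets_carrier in \<open>auto intro!: J1_map_hom J_module E F\<close>)
  then show ?case using Suc by simp
qed

lemmas J_map_hom = conjunct1[OF J_map_hom_aux]

lemma SJ_map_hom: "SJ_map K \<Omega> n F f \<in> mod_hom A (SJ K \<Omega> n E) (SJ K \<Omega> n F)"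
proof (cases n)
  case (Suc m)
  show ?thesis
  proof (cases m)
    case 0
    then show ?thesis using Suc by (simp add: J1_map_hom[OF E F f])
  next
    case (Suc k)
    have "SJ_map K \<Omega> (Suc (Suc k)) F f \<in> mod_hom A (SJ K \<Omega> (Suc (Suc k)) E) (SJ K \<Omega> (Suc (Suc k)) F)"
      unfolding SJ_Suc_Suc SJ_map.simps(2)[of _ _ "Suc k"]
    proof (rule mod_hom_subset)
      show "J1_map K \<Omega> (J K \<Omega> (Suc k) F) (J_map K \<Omega> (Suc k) F f) x \<in> sesq_jets (J K \<Omega> (Suc k) F) (J K \<Omega> k F)"
        if "x \<in> sesq_jets (J K \<Omega> (Suc k) E) (J K \<Omega> k E)" for x
        by (rule J1_map_jets(1)[OF J_module[OF E] J_module[OF E] J_incl[OF E] J_module[OF F] J_module[OF F]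
              J_incl[OF F] J_map_hom J_map_hom _ that]) simp
    qed (use sesq_jets_subset in \<open>auto intro!: J1_map_hom J_module E F J_map_hom simp del: J_map.simps\<close>)
    then show ?thesis using \<open>n = Suc m\<close> Suc by simp
  qed
qed (simp add: f)

end

lemma J_carrier: "x \<in> carrier (J K \<Omega> (Suc n) E) \<Longrightarrow> x \<in> carrier (J1 K \<Omega> (J K \<Omega> n E))"
  by (cases n) (use hol_jets_carrier in \<open>auto simp: J_Suc_Suc\<close>)

lemma SJ_carrier: "x \<in> carrier (SJ K \<Omega> (Suc n) E) \<Longrightarrow> x \<in> carrier (J1 K \<Omega> (J K \<Omega> n E))"
  by (cases n) (use sesq_jets_subset in \<open>auto simp: SJ_Suc_Suc\<close>)

lemma J_map_id:
  assumes E: "left_module A E"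
  shows "x \<in> carrier (J K \<Omega> n E) \<Longrightarrow> J_map K \<Omega> n E (\<lambda>e. e) x = x"
proof (induction n arbitrary: x)
  case (Suc n)
  note x = J_carrier[OF Suc.prems] and J = J_module[OF E]
  show ?case
    using J1_map_cong[OF J x Suc.IH] J1_map_id[OF J x] by simp
qed simp

lemma J_map_cong:
  assumes E: "left_module A E" and fg: "\<And>e. e \<in> carrier E \<Longrightarrow> f e = g e"
  shows "x \<in> carrier (J K \<Omega> n E) \<Longrightarrow> J_map K \<Omega> n F f x = J_map K \<Omega> n F g x"
proof (induction n arbitrary: x)
  case (Suc n)
  show ?case
    using J1_map_cong[OF J_module[OF E] J_carrier[OF Suc.prems] Suc.IH] by simp
qed (simp add: fg)

lemma J_map_comp:
  assumes E: "left_module A E" and F: "left_module A F" and G: "left_module A G"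
    and f: "f \<in> mod_hom A E F" and g: "g \<in> mod_hom A F G"
  shows "x \<in> carrier (J K \<Omega> n E) \<Longrightarrow> J_map K \<Omega> n G (g \<circ> f) x = J_map K \<Omega> n G g (J_map K \<Omega> n F f x)"
proof (induction n arbitrary: x)
  case (Suc n)
  note x = J_carrier[OF Suc.prems]
  note J = J_module[OF E] J_module[OF F] J_module[OF G] J_map_hom[OF E F f] J_map_hom[OF F G g]
  show ?case
    using J1_map_cong[OF J(1) x Suc.IH] J1_map_comp[OF J x] by simp
qed simp

lemma SJ_map_id:
  assumes E: "left_module A E" and x: "x \<in> carrier (SJ K \<Omega> n E)"
  shows "SJ_map K \<Omega> n E (\<lambda>e. e) x = x"
proof (cases n)
  case (Suc m)
  then have x: "x \<in> carrier (J1 K \<Omega> (J K \<Omega> m E))" using x SJ_carrier by blast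
  note J = J_module[OF E]
  show ?thesis
    using J1_map_cong[OF J x J_map_id[OF E]] J1_map_id[OF J x] Suc by simp
qed simp

lemma SJ_map_cong:
  assumes E: "left_module A E" and fg: "\<And>e. e \<in> carrier E \<Longrightarrow> f e = g e"
    and x: "x \<in> carrier (SJ K \<Omega> n E)"
  shows "SJ_map K \<Omega> n F f x = SJ_map K \<Omega> n F g x"
proof (cases n)
  case (Suc m)
  then have x: "x \<in> carrier (J1 K \<Omega> (J K \<Omega> m E))" using x SJ_carrier by blast
  show ?thesis
    using J1_map_cong[OF J_module[OF E] x J_map_cong[OF E fg]] Suc by simp
qed (use fg x in simp)

lemma SJ_map_comp:
  assumes E: "left_module A E" and F: "left_module A F" and G: "left_module A G"
    and f: "f \<in> mod_hom A E F" and g: "g \<in> mod_hom A F G" and x: "x \<in> carrier (SJ K \<Omega> n E)"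
  shows "SJ_map K \<Omega> n G (g \<circ> f) x = SJ_map K \<Omega> n G g (SJ_map K \<Omega> n F f x)"
proof (cases n)
  case (Suc m)
  then have x: "x \<in> carrier (J1 K \<Omega> (J K \<Omega> m E))" using x SJ_carrier by blast
  note J = J_module[OF E] J_module[OF F] J_module[OF G] J_map_hom[OF E F f] J_map_hom[OF F G g]
  show ?thesis
    using J1_map_cong[OF J(1) x J_map_comp[OF assms(1-5)]] J1_map_comp[OF J x] Suc by simp
qed simp

end

section \<open>Composites of Spencer operators\<close>

context exterior_algebra
begin

lemma restrict_scalars_hom:
  "f \<in> mod_hom A E F \<Longrightarrow> f \<in> mod_hom K (restrict_scalars A E) (restrict_scalars A F)"
  by (auto simp: mod_hom_def restrict_scalars_def A_simps A_smult_one)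

lemma restrict_scalars_carrier: "carrier (restrict_scalars A E) = carrier E"
  by (simp add: restrict_scalars_def)

context
  fixes E :: "('w, ('w, 'e) jet) module" and k :: nat
  assumes E: "left_module A E"
begin

lemma Spencer_bar_unitor:
  assumes x: "x \<in> carrier (SJ K \<Omega> (Suc k) E)"
  shows "Spencer_bar K \<Omega> (Suc k) 0 E (unitor \<Omega> (SJ K \<Omega> (Suc k) E) x) = jet_der (J K \<Omega> k E) x"
  using x
  by (simp add: Spencer_bar_def unitor_def Omap_ot[OF SJ_module[OF E] left_module_J1[OF J_module[OF E]] SJ_incl]
      one_grade Spencer1_0_one[OF J_module[OF E]] SJ_carrier)

text \<open>Derivatives commute with J^1 of the inclusion of J^{k+1} in J^1 J^k. Thus the Spencer
  operator receives the derivative of an element of J^1 J^1 J^k, where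
  \<open>Spencer1_jet_der\<close> applies.\<close>

lemma Spencer_jet_der:
  assumes x: "x \<in> carrier (J1 K \<Omega> (J K \<Omega> (Suc k) E))"
  shows "Spencer K \<Omega> (Suc k) 1 E (jet_der (J K \<Omega> (Suc k) E) x) =
    \<ominus>\<^bsub>OM 2 (J K \<Omega> k E)\<^esub> D_II \<Omega> (J K \<Omega> k E) (J1_map K \<Omega> (J1 K \<Omega> (J K \<Omega> k E)) (\<lambda>x. x) x)"
proof -
  note p = J1_map_props[OF J_module[OF E] left_module_J1[OF J_module[OF E]] J_incl[OF E] x]
  show ?thesis
    using Spencer1_jet_der[OF J_module[OF E] p(1)] by (simp add: Spencer_def p(3))
qed

end

text \<open>The right side is a composite of maps already known to be \<open>K\<close>-linear and
  natural; linearity, naturality and the sesquiholonomic comparison all start from it.\<close>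

lemma Spencer_Spencer_bar:
  assumes E: "left_module A E" and x: "x \<in> carrier (SJ K \<Omega> (Suc (Suc k)) E)"
  shows "(Spencer K \<Omega> (Suc k) 1 E \<circ> Spencer_bar K \<Omega> (Suc (Suc k)) 0 E \<circ>
      unitor \<Omega> (SJ K \<Omega> (Suc (Suc k)) E)) x =
    Spencer1 \<Omega> 1 (J K \<Omega> k E) (Omap \<Omega> 1 (J1 K \<Omega> (J K \<Omega> k E)) (\<lambda>x. x) (jet_der (J K \<Omega> (Suc k) E) x))"
  using Spencer_bar_unitor[OF E x] by (simp add: Spencer_def)

lemma Spencer_Spencer_bar_D_II:
  assumes E: "left_module A E" and x: "x \<in> carrier (SJ K \<Omega> (Suc (Suc k)) E)"
  shows "(Spencer K \<Omega> (Suc k) 1 E \<circ> Spencer_bar K \<Omega> (Suc (Suc k)) 0 E \<circ>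
      unitor \<Omega> (SJ K \<Omega> (Suc (Suc k)) E)) x =
    \<ominus>\<^bsub>OM 2 (J K \<Omega> k E)\<^esub> D_II \<Omega> (J K \<Omega> k E) (J1_map K \<Omega> (J1 K \<Omega> (J K \<Omega> k E)) (\<lambda>x. x) x)"
  using Spencer_bar_unitor[OF E x] Spencer_jet_der[OF E SJ_carrier[OF x]] by simp

text \<open>A sesquiholonomic jet already satisfies the condition on D^I, so the vanishing of D^II
  is all that separates it from being holonomic.\<close>

lemma Spencer_Spencer_bar_zero_iff:
  assumes E: "left_module A E" and x: "x \<in> carrier (SJ K \<Omega> (Suc (Suc k)) E)"
  shows "(Spencer K \<Omega> (Suc k) 1 E \<circ> Spencer_bar K \<Omega> (Suc (Suc k)) 0 E \<circ>
      unitor \<Omega> (SJ K \<Omega> (Suc (Suc k)) E)) x = \<zero>\<^bsub>OM 2 (J K \<Omega> k E)\<^esub> \<longleftrightarrow>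
    x \<in> carrier (J K \<Omega> (Suc (Suc k)) E)"
proof -
  note J = J_module[OF E] and JJ = left_module_J1[OF J_module[OF E]]
  note p = J1_map_props[OF J JJ J_incl[OF E] SJ_carrier[OF x]]
  show ?thesis
    using x D_II_zero_iff[OF J p(1)]
    unfolding Spencer_Spencer_bar_D_II[OF E x] Spencer1_jet_der[OF J p(1), symmetric]
    by (simp add: SJ_Suc_Suc J_Suc_Suc hol_jets_def)
qed

lemma Spencer_Spencer_bar_hom:
  assumes E: "left_module A E"
  shows "(Spencer K \<Omega> (Suc k) 1 E \<circ> Spencer_bar K \<Omega> (Suc (Suc k)) 0 E \<circ>
      unitor \<Omega> (SJ K \<Omega> (Suc (Suc k)) E)) \<in>
    mod_hom K (restrict_scalars A (SJ K \<Omega> (Suc (Suc k)) E)) (OM 2 (J K \<Omega> k E))"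
proof -
  note J = J_module[OF E] and JJ = left_module_J1[OF J_module[OF E]]
  note S = Spencer1_hom[OF J, of 1, simplified one_add_one]
  have h: "(\<lambda>x. Spencer1 \<Omega> 1 (J K \<Omega> k E)
      (Omap \<Omega> 1 (J1 K \<Omega> (J K \<Omega> k E)) (\<lambda>x. x) (jet_der (J K \<Omega> (Suc k) E) x))) \<in>
    mod_hom K (restrict_scalars A (SJ K \<Omega> (Suc (Suc k)) E)) (OM 2 (J K \<Omega> k E))"
    by (rule mod_hom_comp[OF mod_hom_comp[OF mod_hom_comp[OF restrict_scalars_hom[OF SJ_incl]
            jet_der_hom[OF J]] Omap_mod_hom[OF J JJ J_incl[OF E]]] S])
  interpret M: module K "restrict_scalars A (SJ K \<Omega> (Suc (Suc k)) E)"
    by (rule module_restrict_scalars[OF SJ_module[OF E]])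
  have eq: "(\<lambda>x. Spencer1 \<Omega> 1 (J K \<Omega> k E)
      (Omap \<Omega> 1 (J1 K \<Omega> (J K \<Omega> k E)) (\<lambda>x. x) (jet_der (J K \<Omega> (Suc k) E) x))) x =
    (Spencer K \<Omega> (Suc k) 1 E \<circ> Spencer_bar K \<Omega> (Suc (Suc k)) 0 E \<circ>
      unitor \<Omega> (SJ K \<Omega> (Suc (Suc k)) E)) x"
    if "x \<in> carrier (restrict_scalars A (SJ K \<Omega> (Suc (Suc k)) E))" for x
    using Spencer_Spencer_bar[OF E] that by (simp add: restrict_scalars_carrier)
  show ?thesis
    by (rule mod_homI[OF additive_map_cong[OF mod_hom_additive[OF h] M.M.abelian_group_axioms eq]])
      (simp_all only: eq[symmetric] M.smult_closed mod_hom_smult[OF h])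
qed

text \<open>The map on J^{k+1} is J^1 of the map on J^k, hence it commutes with the inclusion into
  J^1 J^k. What remains is naturality of the derivative and of \<open>Spencer1\<close>.\<close>

lemma Spencer_Spencer_bar_natural:
  assumes E: "left_module A E" and F: "left_module A F" and f: "f \<in> mod_hom A E F"
    and x: "x \<in> carrier (SJ K \<Omega> (Suc (Suc k)) E)"
  shows "(Spencer K \<Omega> (Suc k) 1 F \<circ> Spencer_bar K \<Omega> (Suc (Suc k)) 0 F \<circ>
      unitor \<Omega> (SJ K \<Omega> (Suc (Suc k)) F)) (SJ_map K \<Omega> (Suc (Suc k)) F f x) =
    Omap \<Omega> 2 (J K \<Omega> k F) (J_map K \<Omega> k F f)
      ((Spencer K \<Omega> (Suc k) 1 E \<circ> Spencer_bar K \<Omega> (Suc (Suc k)) 0 E \<circ>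
        unitor \<Omega> (SJ K \<Omega> (Suc (Suc k)) E)) x)"
proof -
  note J = J_module[OF E] and J' = J_module[OF F]
  note JJ = left_module_J1[OF J] and JJ' = left_module_J1[OF J']
  note i = J_incl[OF E] and i' = J_incl[OF F] and h = J_map_hom[OF E F f]
  note Jh = J1_map_hom[OF J J' h]
  let ?d = "jet_der (J K \<Omega> (Suc k) E) x"
  have x1: "x \<in> carrier (J1 K \<Omega> (J K \<Omega> (Suc k) E))" by (rule SJ_carrier[OF x])
  have d: "?d \<in> carrier (OM 1 (J K \<Omega> (Suc k) E))" by (rule jet_der_closed[OF J x1])
  have y: "SJ_map K \<Omega> (Suc (Suc k)) F f x \<in> carrier (SJ K \<Omega> (Suc (Suc k)) F)"
    by (rule additive_map_closed[OF mod_hom_additive[OF SJ_map_hom[OF E F f]] x])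
  have "jet_der (J K \<Omega> (Suc k) F) (SJ_map K \<Omega> (Suc (Suc k)) F f x) =
      Omap \<Omega> 1 (J K \<Omega> (Suc k) F) (J_map K \<Omega> (Suc k) F f) ?d"
    unfolding SJ_map.simps(2)[of _ _ "Suc k"] by (rule J1_map_props(3)[OF J J' h x1])
  then have "Omap \<Omega> 1 (J1 K \<Omega> (J K \<Omega> k F)) (\<lambda>x. x)
        (jet_der (J K \<Omega> (Suc k) F) (SJ_map K \<Omega> (Suc (Suc k)) F f x)) =
      Omap \<Omega> 1 (J1 K \<Omega> (J K \<Omega> k F)) (J1_map K \<Omega> (J K \<Omega> k F) (J_map K \<Omega> k F f)) ?d"
    using Omap_comp[OF J J' JJ' h i' d] by simp
  also have "\<dots> = Omap \<Omega> 1 (J1 K \<Omega> (J K \<Omega> k F)) (J1_map K \<Omega> (J K \<Omega> k F) (J_map K \<Omega> k F f))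
      (Omap \<Omega> 1 (J1 K \<Omega> (J K \<Omega> k E)) (\<lambda>x. x) ?d)"
    using Omap_comp[OF J JJ JJ' i Jh d] by simp
  finally show ?thesis
    unfolding Spencer_Spencer_bar[OF E x] Spencer_Spencer_bar[OF F y]
    using Spencer1_natural[OF J J' h Omap_closed[OF J JJ i d], simplified one_add_one] by simp
qed

text \<open>Two routes lead from J^{k+1} to J^1 of the sesquiholonomic J^k, through the
  sesquiholonomic J^{k+1} or through J^1 J^k, and they are the same function. Naturality of
  \<open>Spencer1\<close> then moves the inclusion outside.\<close>

lemma Spencer_sesq_Spencer_sesq:
  assumes E: "left_module A E" and x: "x \<in> carrier (SJ K \<Omega> (Suc (Suc k)) E)"
  shows "(Spencer_sesq K \<Omega> (Suc k) 1 E \<circ> Spencer_sesq K \<Omega> (Suc (Suc k)) 0 E \<circ>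
      unitor \<Omega> (SJ K \<Omega> (Suc (Suc k)) E)) x =
    Omap \<Omega> 2 (SJ K \<Omega> k E) (\<lambda>x. x) ((Spencer K \<Omega> (Suc k) 1 E \<circ> Spencer_bar K \<Omega> (Suc (Suc k)) 0 E \<circ>
      unitor \<Omega> (SJ K \<Omega> (Suc (Suc k)) E)) x)"
proof -
  note J = J_module[OF E] and S = SJ_module[OF E]
  note JJ = left_module_J1[OF J] and JS = left_module_J1[OF S]
  note i = J_incl[OF E] and t = J_SJ_incl
  note Jt = J1_map_hom[OF J S t]
  note si = mod_hom_comp[OF SJ_incl Jt]
  let ?d = "jet_der (J K \<Omega> (Suc k) E) x"
  have x1: "x \<in> carrier (J1 K \<Omega> (J K \<Omega> (Suc k) E))" by (rule SJ_carrier[OF x])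
  have d: "?d \<in> carrier (OM 1 (J K \<Omega> (Suc k) E))" by (rule jet_der_closed[OF J x1])
  note p = J1_map_props[OF J S t x1]
  have "Spencer_sesq K \<Omega> (Suc (Suc k)) 0 E (unitor \<Omega> (SJ K \<Omega> (Suc (Suc k)) E) x) =
      Omap \<Omega> 1 (SJ K \<Omega> (Suc k) E) (\<lambda>x. x) ?d"
    using x by (simp add: Spencer_sesq_def unitor_def comp_def Omap_ot[OF S JS si] one_grade
        Spencer1_0_one[OF S p(1)] p(3))
  moreover have "Omap \<Omega> 1 (J1 K \<Omega> (SJ K \<Omega> k E)) (J1_map K \<Omega> (SJ K \<Omega> k E) (\<lambda>x. x))
        (Omap \<Omega> 1 (SJ K \<Omega> (Suc k) E) (\<lambda>x. x) ?d) =
      Omap \<Omega> 1 (J1 K \<Omega> (SJ K \<Omega> k E)) (J1_map K \<Omega> (SJ K \<Omega> k E) (\<lambda>x. x))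
        (Omap \<Omega> 1 (J1 K \<Omega> (J K \<Omega> k E)) (\<lambda>x. x) ?d)"
    using Omap_comp[OF J S JS t si d] Omap_comp[OF J JJ JS i Jt d] by simp
  ultimately show ?thesis
    unfolding Spencer_Spencer_bar[OF E x]
    using Spencer1_natural[OF J S t Omap_closed[OF J JJ i d], simplified one_add_one]
    by (simp add: Spencer_sesq_def comp_def)
qed

lemma Omap_zero:
  assumes E: "left_module A E" and F: "left_module A F" and f: "f \<in> mod_hom A E F"
  shows "Omap \<Omega> m F f \<zero>\<^bsub>OM m E\<^esub> = \<zero>\<^bsub>OM m F\<^esub>"
  by (rule additive_map_zero[OF O_abelian_group[OF E] O_abelian_group[OF F] Omap_additive[OF E F f]])

text \<open>The type argument of \<open>flat_right\<close> is the element type of all iterated jets,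
  so flatness can be applied directly to maps between jet modules.\<close>

lemma flat_Omap_zero_iff:
  fixes E F :: "('w, ('w, 'e) jet) module"
  assumes flat: "flat_right A (deg \<Omega> m) (mult \<Omega>) TYPE(('w, 'e) jet)"
    and E: "left_module A E" and F: "left_module A F" and f: "f \<in> mod_hom A E F" "inj_on f (carrier E)"
    and X: "X \<in> carrier (OM m E)"
  shows "Omap \<Omega> m F f X = \<zero>\<^bsub>OM m F\<^esub> \<longleftrightarrow> X = \<zero>\<^bsub>OM m E\<^esub>"
proof -
  interpret O: abelian_group "OM m E" by (rule O_abelian_group[OF E])
  have "inj_on (Omap \<Omega> m F f) (carrier (OM m E))"
    using flat E F f unfolding flat_right_def Omap_def Omod_def deg_0 by blast
  from inj_on_eq_iff[OF this X O.zero_closed] show ?thesis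
    by (simp add: Omap_zero[OF E F f(1)])
qed

lemma functor_SJ:
  "kmod_functor K A (\<lambda>E. restrict_scalars A (SJ K \<Omega> n E)) (SJ_map K \<Omega> n)"
  unfolding kmod_functor_def restrict_scalars_carrier
  by (intro conjI allI impI ballI; (elim conjE)?)
    (auto intro: module_restrict_scalars SJ_module SJ_map_id restrict_scalars_hom SJ_map_hom
      SJ_map_cong SJ_map_comp)

lemma functor_Omap_J:
  "kmod_functor K A (\<lambda>E. OM m (J K \<Omega> n E)) (\<lambda>F f. Omap \<Omega> m (J K \<Omega> n F) (J_map K \<Omega> n F f))"
  unfolding kmod_functor_def
proof (intro conjI allI impI ballI; (elim conjE)?)
  fix E F G :: "('w, ('w, 'e) jet) module" and f g :: "('w, 'e) jet \<Rightarrow> ('w, 'e) jet" and X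
  assume E: "left_module A E"
  note J = J_module[OF E]
  show "module K (OM m (J K \<Omega> n E))" by (rule O_module[OF J])
  show "Omap \<Omega> m (J K \<Omega> n E) (J_map K \<Omega> n E (\<lambda>e. e)) X = X" if "X \<in> carrier (OM m (J K \<Omega> n E))"
    using Omap_cong[OF J that J_map_id[OF E]] Omap_id[OF J that] by simp
  assume F: "left_module A F" and f: "f \<in> mod_hom A E F"
  note J' = J_module[OF F] and h = J_map_hom[OF E F f]
  show "Omap \<Omega> m (J K \<Omega> n F) (J_map K \<Omega> n F f) \<in> mod_hom K (OM m (J K \<Omega> n E)) (OM m (J K \<Omega> n F))"
    by (rule Omap_mod_hom[OF J J' h])
  show "Omap \<Omega> m (J K \<Omega> n F) (J_map K \<Omega> n F f) X = Omap \<Omega> m (J K \<Omega> n F) (J_map K \<Omega> n F g) X"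
    if "X \<in> carrier (OM m (J K \<Omega> n E))" "\<forall>e\<in>carrier E. f e = g e"
    by (rule Omap_cong[OF J that(1) J_map_cong[OF E]]) (use that(2) in auto)
  assume G: "left_module A G" and g: "g \<in> mod_hom A F G"
  show "Omap \<Omega> m (J K \<Omega> n G) (J_map K \<Omega> n G (g \<circ> f)) X =
      Omap \<Omega> m (J K \<Omega> n G) (J_map K \<Omega> n G g) (Omap \<Omega> m (J K \<Omega> n F) (J_map K \<Omega> n F f) X)"
    if "X \<in> carrier (OM m (J K \<Omega> n E))"
    using Omap_comp[OF J J' J_module[OF G] h J_map_hom[OF F G g] that]
      Omap_cong[OF J that J_map_comp[OF E F G f g]] by simp
qed

end

theorem lemma3p21:
  fixes K :: "'k ring" and A :: "('k, 'w) module" and \<Omega> :: "('k, 'w) dga" and n :: nat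
  assumes "exterior_algebra K A \<Omega>" and "n \<ge> 2"
  shows
    "nat_trans_eq K A
       (\<lambda>E. restrict_scalars A (SJ K \<Omega> n E)) (SJ_map K \<Omega> n)
       (\<lambda>E. Omod \<Omega> 2 (J K \<Omega> (n - 2) E))
       (\<lambda>F f. Omap \<Omega> 2 (J K \<Omega> (n - 2) F) (J_map K \<Omega> (n - 2) F f))
       (\<lambda>E. Spencer K \<Omega> (n - 1) 1 E \<circ> Spencer_bar K \<Omega> n 0 E \<circ> unitor \<Omega> (SJ K \<Omega> n E))
       (\<lambda>(E :: ('w, ('w, 'e) jet) module) x. \<ominus>\<^bsub>Omod \<Omega> 2 (J K \<Omega> (n - 2) E)\<^esub>
          D_II \<Omega> (J K \<Omega> (n - 2) E)
            (J1_map K \<Omega> (J1 K \<Omega> (J K \<Omega> (n - 2) E)) (l_hol (n - 1) E) (l_sesq n E x)))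
     \<and>
     (\<forall>E :: ('w, ('w, 'e) jet) module. left_module A E \<longrightarrow>
       a_kernel (SJ K \<Omega> n E) (Omod \<Omega> 2 (J K \<Omega> (n - 2) E))
         (Spencer K \<Omega> (n - 1) 1 E \<circ> Spencer_bar K \<Omega> n 0 E \<circ> unitor \<Omega> (SJ K \<Omega> n E))
       = t_incl n E ` carrier (J K \<Omega> n E))
     \<and>
     (\<forall>E :: ('w, ('w, 'e) jet) module. left_module A E \<longrightarrow>
       t_incl n E ` carrier (J K \<Omega> n E)
       \<subseteq> a_kernel (SJ K \<Omega> n E) (Omod \<Omega> 2 (SJ K \<Omega> (n - 2) E))
           (Spencer_sesq K \<Omega> (n - 1) 1 E \<circ> Spencer_sesq K \<Omega> n 0 E \<circ> unitor \<Omega> (SJ K \<Omega> n E)))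
     \<and>
     (flat_right A (deg \<Omega> 2) (mult \<Omega>) TYPE(('w, 'e) jet) \<longrightarrow>
       (\<forall>E :: ('w, ('w, 'e) jet) module. left_module A E \<longrightarrow>
         a_kernel (SJ K \<Omega> n E) (Omod \<Omega> 2 (SJ K \<Omega> (n - 2) E))
           (Spencer_sesq K \<Omega> (n - 1) 1 E \<circ> Spencer_sesq K \<Omega> n 0 E \<circ> unitor \<Omega> (SJ K \<Omega> n E))
         = t_incl n E ` carrier (J K \<Omega> n E)))"
proof -
  interpret exterior_algebra K A \<Omega> by (rule assms(1))
  obtain k where n: "n = Suc (Suc k)"
    using assms(2) by (metis One_nat_def Suc_1 Suc_le_D Suc_le_mono)
  have n1: "n - 1 = Suc k" and n2: "n - 2 = k" using n by simp_all
  let ?S = "\<lambda>E :: ('w, ('w, 'e) jet) module. Spencer K \<Omega> (Suc k) 1 E \<circ> Spencer_bar K \<Omega> n 0 E \<circ> unitor \<Omega> (SJ K \<Omega> n E)"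
  let ?Q = "\<lambda>E :: ('w, ('w, 'e) jet) module. Spencer_sesq K \<Omega> (Suc k) 1 E \<circ> Spencer_sesq K \<Omega> n 0 E \<circ> unitor \<Omega> (SJ K \<Omega> n E)"
  let ?R = "\<lambda>(E :: ('w, ('w, 'e) jet) module) x. \<ominus>\<^bsub>OM 2 (J K \<Omega> k E)\<^esub>
          D_II \<Omega> (J K \<Omega> k E) (J1_map K \<Omega> (J1 K \<Omega> (J K \<Omega> k E)) (\<lambda>x. x) x)"
  have S: "nat_trans K A (\<lambda>E. restrict_scalars A (SJ K \<Omega> n E)) (SJ_map K \<Omega> n)
      (\<lambda>E. OM 2 (J K \<Omega> k E)) (\<lambda>F f. Omap \<Omega> 2 (J K \<Omega> k F) (J_map K \<Omega> k F f)) ?S"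
    unfolding nat_trans_def
  proof (intro conjI allI impI ballI functor_SJ functor_Omap_J; (elim conjE)?)
    fix E F :: "('w, ('w, 'e) jet) module" and f x
    assume E: "left_module A E"
    show "?S E \<in> mod_hom K (restrict_scalars A (SJ K \<Omega> n E)) (OM 2 (J K \<Omega> k E))"
      unfolding n by (rule Spencer_Spencer_bar_hom[OF E])
    assume "left_module A F" "f \<in> mod_hom A E F" "x \<in> carrier (restrict_scalars A (SJ K \<Omega> n E))"
    then show "?S F (SJ_map K \<Omega> n F f x) = Omap \<Omega> 2 (J K \<Omega> k F) (J_map K \<Omega> k F f) (?S E x)"
      unfolding n restrict_scalars_carrier by (rule Spencer_Spencer_bar_natural[OF E])
  qed
  have SR: "?S E x = ?R E x" if "left_module A E" "x \<in> carrier (SJ K \<Omega> n E)" for E x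
    using Spencer_Spencer_bar_D_II that unfolding n by blast
  \<comment> \<open>Linearity and naturality are transferred from \<open>?S\<close> through the
    pointwise equality \<open>SR\<close>. The operator D^II by itself is defined on stored
    representatives and offers no direct access to either.\<close>
  have R: "nat_trans K A (\<lambda>E. restrict_scalars A (SJ K \<Omega> n E)) (SJ_map K \<Omega> n)
      (\<lambda>E. OM 2 (J K \<Omega> k E)) (\<lambda>F f. Omap \<Omega> 2 (J K \<Omega> k F) (J_map K \<Omega> k F f)) ?R"
    unfolding nat_trans_def
  proof (intro conjI allI impI ballI functor_SJ functor_Omap_J; (elim conjE)?)
    fix E F :: "('w, ('w, 'e) jet) module" and f x
    assume E: "left_module A E"
    interpret M: module K "restrict_scalars A (SJ K \<Omega> n E)"
      by (rule module_restrict_scalars[OF SJ_module[OF E]])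
    have h: "?S E \<in> mod_hom K (restrict_scalars A (SJ K \<Omega> n E)) (OM 2 (J K \<Omega> k E))"
      using S E by (simp add: nat_trans_def)
    have eq: "?S E x = ?R E x" if "x \<in> carrier (restrict_scalars A (SJ K \<Omega> n E))" for x
      using SR[OF E] that by (simp only: restrict_scalars_carrier)
    show "?R E \<in> mod_hom K (restrict_scalars A (SJ K \<Omega> n E)) (OM 2 (J K \<Omega> k E))"
      by (rule mod_homI[OF additive_map_cong[OF mod_hom_additive[OF h] M.M.abelian_group_axioms eq]])
        (simp_all only: eq[symmetric] M.smult_closed mod_hom_smult[OF h])
    assume F: "left_module A F" and f: "f \<in> mod_hom A E F"
      and x: "x \<in> carrier (restrict_scalars A (SJ K \<Omega> n E))"
    have "SJ_map K \<Omega> n F f x \<in> carrier (SJ K \<Omega> n F)"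
      using additive_map_closed[OF mod_hom_additive[OF SJ_map_hom[OF E F f]]] x
      by (simp only: restrict_scalars_carrier)
    moreover have "?S F (SJ_map K \<Omega> n F f x) = Omap \<Omega> 2 (J K \<Omega> k F) (J_map K \<Omega> k F f) (?S E x)"
      using S E F f x unfolding nat_trans_def by blast
    ultimately show "?R F (SJ_map K \<Omega> n F f x) = Omap \<Omega> 2 (J K \<Omega> k F) (J_map K \<Omega> k F f) (?R E x)"
      using SR[OF F] eq[OF x] by (simp only:)
  qed
  have kerS: "a_kernel (SJ K \<Omega> n E) (OM 2 (J K \<Omega> k E)) (?S E) = carrier (J K \<Omega> n E)"
    if E: "left_module A E" for E
  proof -
    \<comment> \<open>The kernel is formed inside the sesquiholonomic jets, where the zero criterion
      is stated; no holonomic jet may lie outside them.\<close>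
    have "carrier (J K \<Omega> n E) \<subseteq> carrier (SJ K \<Omega> n E)"
      using additive_map_closed[OF mod_hom_additive[OF J_SJ_incl]] by blast
    then show ?thesis
      using Spencer_Spencer_bar_zero_iff[OF E, of _ k] unfolding a_kernel_def' n by blast
  qed
  have QS: "?Q E x = Omap \<Omega> 2 (SJ K \<Omega> k E) (\<lambda>x. x) (?S E x)"
    if "left_module A E" "x \<in> carrier (SJ K \<Omega> n E)" for E x
    using Spencer_sesq_Spencer_sesq that unfolding n by blast
  \<comment> \<open>An additive map sends zero to zero, so the second composite vanishes wherever
    the first does.\<close>
  have kerQ: "carrier (J K \<Omega> n E) \<subseteq> a_kernel (SJ K \<Omega> n E) (OM 2 (SJ K \<Omega> k E)) (?Q E)"
    if E: "left_module A E" for E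
    using Omap_zero[OF J_module[OF E] SJ_module[OF E] J_SJ_incl]
    unfolding kerS[OF E, symmetric] a_kernel_def' by (auto simp: QS[OF E] simp del: comp_apply)
  have flat: "a_kernel (SJ K \<Omega> n E) (OM 2 (SJ K \<Omega> k E)) (?Q E) = carrier (J K \<Omega> n E)"
    if E: "left_module A E" and fl: "flat_right A (deg \<Omega> 2) (mult \<Omega>) TYPE(('w, 'e) jet)" for E
  proof -
    have c: "?S E x \<in> carrier (OM 2 (J K \<Omega> k E))" if "x \<in> carrier (SJ K \<Omega> n E)" for x
      using additive_map_closed[OF mod_hom_additive[OF Spencer_Spencer_bar_hom[OF E, of k]]] that
      unfolding n restrict_scalars_carrier by blast
    \<comment> \<open>By flatness Omega^2 of the inclusion of J^k in the sesquiholonomic J^k is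
      injective, so both composites vanish on the same jets.\<close>
    have "?Q E x = \<zero>\<^bsub>OM 2 (SJ K \<Omega> k E)\<^esub> \<longleftrightarrow> ?S E x = \<zero>\<^bsub>OM 2 (J K \<Omega> k E)\<^esub>"
      if "x \<in> carrier (SJ K \<Omega> n E)" for x
      unfolding QS[OF E that]
      by (rule flat_Omap_zero_iff[OF fl J_module[OF E] SJ_module[OF E] J_SJ_incl inj_on_id2 c[OF that]])
    then show ?thesis
      unfolding kerS[OF E, symmetric] a_kernel_def' by blast
  qed
  show ?thesis
    unfolding n1 n2 nat_trans_eq_def restrict_scalars_carrier l_hol_id l_sesq_id t_incl_id image_ident
    using S R SR kerS kerQ flat by blast
qed

end
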